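(* Let $d>0$ be an integer. Then there exists a (commutative) Noetherian local ring $R$ such that $\dim R=d$ and $\mathrm{Ext}_R^d(R/Q,R)=(0)$ for some parameter ideal $Q$ in $R$.
   Context: A parameter ideal of a $d$-dimensional Noetherian local ring $R$ is an ideal generated by a system of parameters, i.e. by $d$ elements of the maximal ideal $\mathfrak m$ generating an $\mathfrak m$-primary ideal. *)

theory Defs
  imports Complex_Main "HOL-Library.Extended_Nat" "HOL-Algebra.Ring_Divisibility" "HOL-Algebra.Module"
begin

section \<open>Local rings, Krull dimension, parameter ideals\<close>

definition local_ring :: "('a, 'm) ring_scheme \<Rightarrow> bool" where
  "local_ring R \<longleftrightarrow> cring R \<and> (\<exists>!m. maximalideal m R)"

definition max_ideal :: "('a, 'm) ring_scheme \<Rightarrow> 'a set" where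
  "max_ideal R = (THE m. maximalideal m R)"

definition krull_dim :: "('a, 'm) ring_scheme \<Rightarrow> enat" where
  "krull_dim R = Sup {enat n | n. \<exists>p :: nat \<Rightarrow> 'a set.
     (\<forall>i\<le>n. primeideal (p i) R) \<and> (\<forall>i<n. p i \<subset> p (Suc i))}"

definition ideal_radical :: "('a, 'm) ring_scheme \<Rightarrow> 'a set \<Rightarrow> 'a set" where
  "ideal_radical R I = {x \<in> carrier R. \<exists>n::nat. n > 0 \<and> x [^]\<^bsub>R\<^esub> n \<in> I}"

definition primary_ideal :: "('a, 'm) ring_scheme \<Rightarrow> 'a set \<Rightarrow> bool" where
  "primary_ideal R I \<longleftrightarrow> ideal I R \<and> I \<noteq> carrier R \<and>
     (\<forall>a\<in>carrier R. \<forall>b\<in>carrier R. a \<otimes>\<^bsub>R\<^esub> b \<in> I \<longrightarrow> a \<in> I \<or> b \<in> ideal_radical R I)"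

definition parameter_ideal :: "('a, 'm) ring_scheme \<Rightarrow> 'a set \<Rightarrow> bool" where
  "parameter_ideal R Q \<longleftrightarrow>
     (\<exists>xs. enat (length xs) = krull_dim R \<and> set xs \<subseteq> max_ideal R \<and> Q = Idl\<^bsub>R\<^esub> (set xs)) \<and>
     primary_ideal R Q \<and> ideal_radical R Q = max_ideal R"

section \<open>Modules\<close>

text \<open>The record of modules extends that of rings, so it carries fields \<open>mult\<close> and \<open>one\<close>
  which the module axioms never mention. They are left undefined where there is no natural
  choice.\<close>

definition self_module :: "('a, 'm) ring_scheme \<Rightarrow> ('a, 'a) module" where
  "self_module R = \<lparr>carrier = carrier R, monoid.mult = monoid.mult R, monoid.one = monoid.one R,
     ring.zero = ring.zero R, ring.add = ring.add R, smult = monoid.mult R\<rparr>"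

text \<open>As in the library's \<open>FactRing\<close>, scalar multiplication is the union of the cosets of the
  products with all representatives; for a submodule \<open>H\<close> these cosets coincide.\<close>

definition quotient_module :: "('a, 'b, 'n) module_scheme \<Rightarrow> 'b set \<Rightarrow> ('a, 'b set) module" where
  "quotient_module M H = \<lparr>carrier = a_rcosets\<^bsub>M\<^esub> H, monoid.mult = undefined, monoid.one = undefined,
     ring.zero = H, ring.add = set_add M, smult = (\<lambda>a X. \<Union>x\<in>X. H +>\<^bsub>M\<^esub> (a \<odot>\<^bsub>M\<^esub> x))\<rparr>"

text \<open>Homomorphisms are extensional functions, so that equality of homomorphisms is equality in
  HOL.\<close>

definition linear_maps ::
    "('a, 'm) ring_scheme \<Rightarrow> ('a, 'b, 'n) module_scheme \<Rightarrow> ('a, 'c, 'k) module_scheme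
      \<Rightarrow> ('b \<Rightarrow> 'c) set" where
  "linear_maps R M N = {f \<in> carrier M \<rightarrow>\<^sub>E carrier N.
     (\<forall>x\<in>carrier M. \<forall>y\<in>carrier M. f (x \<oplus>\<^bsub>M\<^esub> y) = f x \<oplus>\<^bsub>N\<^esub> f y) \<and>
     (\<forall>a\<in>carrier R. \<forall>x\<in>carrier M. f (a \<odot>\<^bsub>M\<^esub> x) = a \<odot>\<^bsub>N\<^esub> f x)}"

definition hom_module ::
    "('a, 'm) ring_scheme \<Rightarrow> ('a, 'b, 'n) module_scheme \<Rightarrow> ('a, 'c, 'k) module_scheme
      \<Rightarrow> ('a, 'b \<Rightarrow> 'c) module" where
  "hom_module R M N = \<lparr>carrier = linear_maps R M N, monoid.mult = undefined, monoid.one = undefined,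
     ring.zero = (\<lambda>x\<in>carrier M. \<zero>\<^bsub>N\<^esub>),
     ring.add = (\<lambda>f g. \<lambda>x\<in>carrier M. f x \<oplus>\<^bsub>N\<^esub> g x),
     smult = (\<lambda>a f. \<lambda>x\<in>carrier M. a \<odot>\<^bsub>N\<^esub> f x)\<rparr>"

text \<open>\<open>B\<close> is a basis: every element is a linear combination of \<open>B\<close> with exactly one finitely
  supported coefficient function.\<close>

definition module_basis ::
    "('a, 'm) ring_scheme \<Rightarrow> ('a, 'b, 'n) module_scheme \<Rightarrow> 'b set \<Rightarrow> bool" where
  "module_basis R M B \<longleftrightarrow> B \<subseteq> carrier M \<and>
     (\<forall>x\<in>carrier M. \<exists>!c. (\<forall>b\<in>B. c b \<in> carrier R) \<and> (\<forall>b. b \<notin> B \<longrightarrow> c b = \<zero>\<^bsub>R\<^esub>) \<and>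
        finite {b. c b \<noteq> \<zero>\<^bsub>R\<^esub>} \<and> x = (\<Oplus>\<^bsub>M\<^esub>b\<in>{b. c b \<noteq> \<zero>\<^bsub>R\<^esub>}. c b \<odot>\<^bsub>M\<^esub> b))"

definition free_module :: "('a, 'm) ring_scheme \<Rightarrow> ('a, 'b, 'n) module_scheme \<Rightarrow> bool" where
  "free_module R M \<longleftrightarrow> Module.module R M \<and> (\<exists>B. module_basis R M B)"

section \<open>Ext\<close>

text \<open>\<open>\<dots> \<longrightarrow> P 2 \<longrightarrow> P 1 \<longrightarrow> P 0 \<longrightarrow> M \<longrightarrow> 0\<close> is exact, with maps \<open>\<delta> n : P (n + 1) \<longrightarrow> P n\<close>
  and augmentation \<open>\<epsilon> : P 0 \<longrightarrow> M\<close>.\<close>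

definition free_resolution ::
    "('a, 'm) ring_scheme \<Rightarrow> ('a, 'b, 'n) module_scheme \<Rightarrow> (nat \<Rightarrow> ('a, 'c) module)
      \<Rightarrow> (nat \<Rightarrow> 'c \<Rightarrow> 'c) \<Rightarrow> ('c \<Rightarrow> 'b) \<Rightarrow> bool" where
  "free_resolution R M P \<delta> \<epsilon> \<longleftrightarrow>
     (\<forall>n. free_module R (P n)) \<and>
     (\<forall>n. \<delta> n \<in> linear_maps R (P (Suc n)) (P n)) \<and>
     \<epsilon> \<in> linear_maps R (P 0) M \<and>
     \<epsilon> ` carrier (P 0) = carrier M \<and>
     \<delta> 0 ` carrier (P 1) = {x \<in> carrier (P 0). \<epsilon> x = \<zero>\<^bsub>M\<^esub>} \<and>
     (\<forall>n. \<delta> (Suc n) ` carrier (P (Suc (Suc n))) = {x \<in> carrier (P (Suc n)). \<delta> n x = \<zero>\<^bsub>P n\<^esub>})"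

text \<open>HOL requires a type for the elements of the modules in a resolution of \<open>M\<close>. The type
  \<open>(nat + 'a + 'b) list\<close> is large enough for every module: \<open>(nat + 'a + 'b) list\<close> is infinite,
  \<open>'b\<close> and finite lists of pairs from \<open>'a \<times> (nat + 'a + 'b) list\<close> inject into it, and so does the
  free module on any set of elements of \<open>'b\<close> or of this type.\<close>

type_synonym ('a, 'b) res_elem = "(nat + 'a + 'b) list"

definition chosen_resolution ::
    "('a, 'm) ring_scheme \<Rightarrow> ('a, 'b, 'n) module_scheme
      \<Rightarrow> (nat \<Rightarrow> ('a, ('a, 'b) res_elem) module) \<times>
         (nat \<Rightarrow> ('a, 'b) res_elem \<Rightarrow> ('a, 'b) res_elem) \<times> (('a, 'b) res_elem \<Rightarrow> 'b)" where
  "chosen_resolution R M = (SOME (P, \<delta>, \<epsilon>). free_resolution R M P \<delta> \<epsilon>)"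

definition cocycles ::
    "('a, 'm) ring_scheme \<Rightarrow> (nat \<Rightarrow> ('a, 'c) module) \<Rightarrow> (nat \<Rightarrow> 'c \<Rightarrow> 'c)
      \<Rightarrow> ('a, 'e, 'k) module_scheme \<Rightarrow> nat \<Rightarrow> ('c \<Rightarrow> 'e) set" where
  "cocycles R P \<delta> N n =
     {f \<in> linear_maps R (P n) N. \<forall>x\<in>carrier (P (Suc n)). f (\<delta> n x) = \<zero>\<^bsub>N\<^esub>}"

primrec coboundaries ::
    "('a, 'm) ring_scheme \<Rightarrow> (nat \<Rightarrow> ('a, 'c) module) \<Rightarrow> (nat \<Rightarrow> 'c \<Rightarrow> 'c)
      \<Rightarrow> ('a, 'e, 'k) module_scheme \<Rightarrow> nat \<Rightarrow> ('c \<Rightarrow> 'e) set" where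
  "coboundaries R P \<delta> N 0 = {\<zero>\<^bsub>hom_module R (P 0) N\<^esub>}"
| "coboundaries R P \<delta> N (Suc n) =
     (\<lambda>g. compose (carrier (P (Suc n))) g (\<delta> n)) ` linear_maps R (P n) N"

definition Hom_cohomology ::
    "('a, 'm) ring_scheme \<Rightarrow> (nat \<Rightarrow> ('a, 'c) module) \<Rightarrow> (nat \<Rightarrow> 'c \<Rightarrow> 'c)
      \<Rightarrow> ('a, 'e, 'k) module_scheme \<Rightarrow> nat \<Rightarrow> ('a, ('c \<Rightarrow> 'e) set) module" where
  "Hom_cohomology R P \<delta> N n =
     quotient_module ((hom_module R (P n) N)\<lparr>carrier := cocycles R P \<delta> N n\<rparr>)
       (coboundaries R P \<delta> N n)"

text \<open>\<open>Ext R n M N\<close> is the \<open>n\<close>-th cohomology module of \<open>Hom\<^sub>R(P, N)\<close> for a free resolution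
  \<open>P\<close> of \<open>M\<close>.\<close>

definition Ext ::
    "('a, 'm) ring_scheme \<Rightarrow> nat \<Rightarrow> ('a, 'b, 'n) module_scheme \<Rightarrow> ('a, 'e, 'k) module_scheme
      \<Rightarrow> ('a, (('a, 'b) res_elem \<Rightarrow> 'e) set) module" where
  "Ext R n M N = (case chosen_resolution R M of (P, \<delta>, \<epsilon>) \<Rightarrow> Hom_cohomology R P \<delta> N n)"

section \<open>The type of ring elements\<close>

text \<open>HOL cannot quantify existentially over types, so rings asserted to exist need elements in
  a fixed type. This one contains the cosets of ideals in polynomial and power series rings over
  (subfields of) the complex numbers, with monomials given by their exponent functions; up to
  isomorphism it also contains every ring that is no larger than the type.\<close>

type_synonym ring_elem = "((nat \<Rightarrow> nat) \<Rightarrow> complex) set"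

end

theory Submission
  imports Defs "HOL-Library.Poly_Mapping" "HOL-Computational_Algebra.Fraction_Field"
begin

text \<open>Since \<open>Ext\<^sup>1(R/t, R) = (0 : (0 : t)) / tR\<close>, the case \<open>d = 1\<close> asks for a parameter \<open>t\<close> with
  \<open>0 : (0 : t) = tR\<close>. Then \<open>R/t\<close> acts faithfully on \<open>0 : t\<close>, a module of smaller length; such faithful
  modules come from spaces of square-zero matrices. We adjoin to \<open>k[t]\<close>, localised at the origin, a
  nilpotent ideal with \<open>k\<close>-basis \<open>y\<^sub>1, y\<^sub>2, z\<^sub>1, z\<^sub>2, f\<^sub>1, f\<^sub>2\<close>, where \<open>t z\<^sub>i = f\<^sub>i = y\<^sub>i\<^sup>2\<close>, \<open>z\<^sub>1 y\<^sub>2 = f\<^sub>1\<close>,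
  \<open>z\<^sub>2 y\<^sub>1 = f\<^sub>2\<close> and all other products of two of \<open>t, y\<^sub>i, z\<^sub>i, f\<^sub>i\<close> except \<open>t\<^sup>2\<close> vanish: on \<open>0 : t = \<langle>y\<^sub>1, y\<^sub>2, f\<^sub>1, f\<^sub>2\<rangle>\<close> the
  elements \<open>y\<^sub>1, y\<^sub>2, z\<^sub>1, z\<^sub>2\<close> act as the four matrix units from \<open>\<langle>y\<^sub>1, y\<^sub>2\<rangle>\<close> to \<open>\<langle>f\<^sub>1, f\<^sub>2\<rangle>\<close>.

  For \<open>d > 1\<close> adjoin further variables \<open>x\<^sub>1, \<dots>, x\<^sub>d\<^sub>-\<^sub>1\<close>. If \<open>x\<close> is regular on \<open>M\<close> and on \<open>L\<close>, the cone of
  \<open>x\<close> on a free resolution of \<open>M\<close> shows that \<open>Ext\<^sup>j(M, L/xL) = 0\<close> implies \<open>Ext\<^sup>j\<^sup>+\<^sup>1(M/xM, L) = 0\<close>; apply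
  this to \<open>M = R/(t, x\<^sub>1, \<dots>, x\<^sub>j\<^sub>-\<^sub>1)\<close> and \<open>L = R/(x\<^sub>j\<^sub>+\<^sub>1, \<dots>, x\<^sub>d\<^sub>-\<^sub>1)\<close>.

  The dimension is at most \<open>d\<close> because \<open>d + 1\<close> polynomials in \<open>d\<close> variables are algebraically dependent,
  whereas elements of \<open>p\<^sub>i\<^sub>+\<^sub>1 - p\<^sub>i\<close> along a chain of primes are independent over a field of units.\<close>

text \<open>If t were regular, 0 : t would vanish and Ext^1(R/t, R) would be R/t, so R cannot be
  Cohen-Macaulay. For d = 1 the length of R/t exceeds that of 0 : t by the multiplicity of t, which
  is positive; hence, over a coefficient field, a commutative algebra of dimension larger than n has
  to act faithfully on an n-dimensional space. By Schur's bound a commutative algebra of n x n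
  matrices has dimension at most 1 + floor(n^2/4), and this first exceeds n at n = 4. The scalars
  and the four matrix units of a 2 x 2 block attain 5, and these are the sizes here: R/t has basis
  1, y_1, y_2, z_1, z_2, while 0 : t has basis y_1, y_2, f_1, f_2. The resolution inside
  \<open>Ext\<close> is an unspecified choice, so vanishing has to be proved for every free
  resolution. The cone of a resolution consists of pairs and so lives on another type; comparing
  resolutions over different types carries the result back.\<close>

section \<open>Linear maps and free modules\<close>

text \<open>Unlike \<open>linear_maps\<close>, this predicate does not demand extensionality, so linear maps can be
  composed and added without restricting them to the carrier.\<close>

definition lin :: "('a, 'm) ring_scheme \<Rightarrow> ('a, 'b, 'n) module_scheme \<Rightarrow> ('a, 'c, 'k) module_scheme
    \<Rightarrow> ('b \<Rightarrow> 'c) \<Rightarrow> bool" where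
  "lin R M N f \<longleftrightarrow> (\<forall>x\<in>carrier M. f x \<in> carrier N) \<and>
     (\<forall>x\<in>carrier M. \<forall>y\<in>carrier M. f (x \<oplus>\<^bsub>M\<^esub> y) = f x \<oplus>\<^bsub>N\<^esub> f y) \<and>
     (\<forall>a\<in>carrier R. \<forall>x\<in>carrier M. f (a \<odot>\<^bsub>M\<^esub> x) = a \<odot>\<^bsub>N\<^esub> f x)"

lemma linI:
  assumes "\<And>x. x \<in> carrier M \<Longrightarrow> f x \<in> carrier N"
    and "\<And>x y. x \<in> carrier M \<Longrightarrow> y \<in> carrier M \<Longrightarrow> f (x \<oplus>\<^bsub>M\<^esub> y) = f x \<oplus>\<^bsub>N\<^esub> f y"
    and "\<And>a x. a \<in> carrier R \<Longrightarrow> x \<in> carrier M \<Longrightarrow> f (a \<odot>\<^bsub>M\<^esub> x) = a \<odot>\<^bsub>N\<^esub> f x"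
  shows "lin R M N f"
  using assms by (auto simp: lin_def)

lemma lin_closed [simp]: "lin R M N f \<Longrightarrow> x \<in> carrier M \<Longrightarrow> f x \<in> carrier N"
  by (simp add: lin_def)

lemma lin_add:
  "lin R M N f \<Longrightarrow> x \<in> carrier M \<Longrightarrow> y \<in> carrier M \<Longrightarrow> f (x \<oplus>\<^bsub>M\<^esub> y) = f x \<oplus>\<^bsub>N\<^esub> f y"
  by (simp add: lin_def)

lemma lin_smult:
  "lin R M N f \<Longrightarrow> a \<in> carrier R \<Longrightarrow> x \<in> carrier M \<Longrightarrow> f (a \<odot>\<^bsub>M\<^esub> x) = a \<odot>\<^bsub>N\<^esub> f x"
  by (simp add: lin_def)

lemma linear_maps_iff: "f \<in> linear_maps R M N \<longleftrightarrow> lin R M N f \<and> f \<in> extensional (carrier M)"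
  by (auto simp: linear_maps_def lin_def PiE_def Pi_def)

lemma lin_cong:
  assumes "lin R M N f" "Module.module R M" "\<And>x. x \<in> carrier M \<Longrightarrow> g x = f x"
  shows "lin R M N g"
proof -
  interpret Module.module R M by fact
  show ?thesis using assms(1,3) by (auto simp: lin_def)
qed

lemma linear_maps_restrict:
  assumes "lin R M N f" "Module.module R M"
  shows "restrict f (carrier M) \<in> linear_maps R M N"
  using assms lin_cong[OF assms] by (simp add: linear_maps_iff)

lemma lin_zero:
  assumes "Module.module R M" "Module.module R N" "lin R M N f"
  shows "f \<zero>\<^bsub>M\<^esub> = \<zero>\<^bsub>N\<^esub>"
proof -
  interpret M: Module.module R M by fact
  interpret N: Module.module R N by fact
  have "f (\<zero>\<^bsub>R\<^esub> \<odot>\<^bsub>M\<^esub> \<zero>\<^bsub>M\<^esub>) = \<zero>\<^bsub>R\<^esub> \<odot>\<^bsub>N\<^esub> f \<zero>\<^bsub>M\<^esub>"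
    using assms(3) by (intro lin_smult) auto
  then show ?thesis using assms(3) by simp
qed

lemma lin_minus:
  assumes "Module.module R M" "Module.module R N" "lin R M N f" "x \<in> carrier M"
  shows "f (\<ominus>\<^bsub>M\<^esub> x) = \<ominus>\<^bsub>N\<^esub> f x"
proof -
  interpret M: Module.module R M by fact
  interpret N: Module.module R N by fact
  have "f ((\<ominus>\<^bsub>R\<^esub> \<one>\<^bsub>R\<^esub>) \<odot>\<^bsub>M\<^esub> x) = (\<ominus>\<^bsub>R\<^esub> \<one>\<^bsub>R\<^esub>) \<odot>\<^bsub>N\<^esub> f x"
    using assms by (intro lin_smult) auto
  then show ?thesis using assms by (simp add: M.smult_l_minus N.smult_l_minus)
qed

lemma lin_diff:
  assumes "Module.module R M" "Module.module R N" "lin R M N f" "x \<in> carrier M" "y \<in> carrier M"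
  shows "f (x \<ominus>\<^bsub>M\<^esub> y) = f x \<ominus>\<^bsub>N\<^esub> f y"
proof -
  interpret M: Module.module R M by fact
  interpret N: Module.module R N by fact
  show ?thesis using assms by (simp add: a_minus_def lin_add lin_minus)
qed

lemma lin_comp:
  assumes "lin R M N f" "lin R N L g"
  shows "lin R M L (\<lambda>x. g (f x))"
  using assms by (auto simp: lin_def)

lemma lin_plus:
  assumes "Module.module R N" "lin R M N f" "lin R M N g"
  shows "lin R M N (\<lambda>x. f x \<oplus>\<^bsub>N\<^esub> g x)"
proof -
  interpret N: Module.module R N by fact
  show ?thesis using assms(2,3)
    by (intro linI) (simp_all add: lin_add lin_smult N.M.a_ac N.smult_r_distr)
qed

lemma lin_uminus:
  assumes "Module.module R N" "lin R M N f"
  shows "lin R M N (\<lambda>x. \<ominus>\<^bsub>N\<^esub> f x)"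
proof -
  interpret N: Module.module R N by fact
  show ?thesis using assms(2)
    by (intro linI) (simp_all add: lin_add lin_smult N.smult_r_minus N.M.minus_add)
qed

lemma lin_sub:
  assumes "Module.module R N" "lin R M N f" "lin R M N g"
  shows "lin R M N (\<lambda>x. f x \<ominus>\<^bsub>N\<^esub> g x)"
  using lin_plus[OF assms(1,2) lin_uminus[OF assms(1,3)]] by (simp add: a_minus_def)

lemma lin_scale:
  assumes "Module.module R N" "lin R M N f" "a \<in> carrier R"
  shows "lin R M N (\<lambda>x. a \<odot>\<^bsub>N\<^esub> f x)"
proof -
  interpret N: Module.module R N by fact
  show ?thesis using assms(2,3)
    by (intro linI) (simp_all add: lin_add lin_smult N.smult_r_distr flip: N.smult_assoc1,
        simp add: N.R.m_comm)
qed

lemma lin_id: "lin R M M (\<lambda>x. x)"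
  by (simp add: lin_def)

lemma lin_finsum:
  assumes "Module.module R M" "Module.module R N" "lin R M N f" "finite A" "g \<in> A \<rightarrow> carrier M"
  shows "f (\<Oplus>\<^bsub>M\<^esub>i\<in>A. g i) = (\<Oplus>\<^bsub>N\<^esub>i\<in>A. f (g i))"
proof -
  interpret M: Module.module R M by fact
  interpret N: Module.module R N by fact
  show ?thesis using assms(4,5)
  proof (induction A)
    case empty
    then show ?case using lin_zero[OF assms(1-3)] by simp
  next
    case (insert a A)
    then have "g \<in> A \<rightarrow> carrier M" "g a \<in> carrier M" by auto
    moreover from this have "(\<lambda>i. f (g i)) \<in> A \<rightarrow> carrier N" "f (g a) \<in> carrier N"
      using assms(3) by (auto simp: Pi_def)
    ultimately show ?case using insert assms(3) by (simp add: lin_add)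
  qed
qed

text \<open>Supports of different coefficient functions differ; this moves all sums to one common
  finite index set.\<close>

lemma finsum_superset:
  assumes "Module.module R N" "finite A" "S \<subseteq> A" "v \<in> A \<rightarrow> carrier N"
    and "c \<in> A \<rightarrow> carrier R" "\<And>b. b \<in> A - S \<Longrightarrow> c b = \<zero>\<^bsub>R\<^esub>"
  shows "(\<Oplus>\<^bsub>N\<^esub>b\<in>S. c b \<odot>\<^bsub>N\<^esub> v b) = (\<Oplus>\<^bsub>N\<^esub>b\<in>A. c b \<odot>\<^bsub>N\<^esub> v b)"
proof -
  interpret N: Module.module R N by fact
  show ?thesis using assms(2-)
    by (intro N.M.add.finprod_mono_neutral_cong_left) (auto simp: Pi_def)
qed

text \<open>Free modules are projective: send each basis element to a chosen preimage of its image
  and extend linearly. \<open>module_basis\<close> provides only unique coefficients, so additivity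
  and homogeneity of the coordinates are derived first, from uniqueness.\<close>

lemma free_module_lift:
  assumes free: "free_module R F" and X: "Module.module R X" and Y: "Module.module R Y"
    and \<alpha>: "lin R F X \<alpha>" and \<beta>: "lin R Y X \<beta>" and sub: "\<alpha> ` carrier F \<subseteq> \<beta> ` carrier Y"
  shows "\<exists>\<gamma>. lin R F Y \<gamma> \<and> (\<forall>x\<in>carrier F. \<beta> (\<gamma> x) = \<alpha> x)"
proof -
  interpret X: Module.module R X by fact
  interpret Y: Module.module R Y by fact
  obtain B where F: "Module.module R F" and B: "module_basis R F B"
    using free unfolding free_module_def by blast
  interpret F: Module.module R F by fact
  define P where "P x c \<longleftrightarrow> (\<forall>b\<in>B. c b \<in> carrier R) \<and> (\<forall>b. b \<notin> B \<longrightarrow> c b = \<zero>\<^bsub>R\<^esub>) \<and>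
        finite {b. c b \<noteq> \<zero>\<^bsub>R\<^esub>} \<and> x = (\<Oplus>\<^bsub>F\<^esub>b\<in>{b. c b \<noteq> \<zero>\<^bsub>R\<^esub>}. c b \<odot>\<^bsub>F\<^esub> b)" for x c
  have BF: "B \<subseteq> carrier F" and ex1: "\<And>x. x \<in> carrier F \<Longrightarrow> \<exists>!c. P x c"
    using B unfolding module_basis_def P_def by auto
  define cf where "cf x = (THE c. P x c)" for x
  have cf: "P x (cf x)" if "x \<in> carrier F" for x
    unfolding cf_def by (rule theI'[OF ex1[OF that]])
  have cf_eq: "cf x = c" if "x \<in> carrier F" "P x c" for x c
    using ex1[OF that(1)] cf[OF that(1)] that(2) by blast
  define S where "S x = {b. cf x b \<noteq> \<zero>\<^bsub>R\<^esub>}" for x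
  have S: "finite (S x)" "S x \<subseteq> B" if "x \<in> carrier F" for x
    using cf[OF that] unfolding P_def S_def by auto
  have cfR: "cf x b \<in> carrier R" if "x \<in> carrier F" for x b
    using cf[OF that] unfolding P_def by (cases "b \<in> B") auto
  \<comment> \<open>Coefficients may be tested over any finite part of the basis that contains the
    support. Sums and multiples can shrink the support, so the exact support would be awkward to
    track.\<close>
  have PI: "P x c" if c: "\<And>b. c b \<in> carrier R" and A: "finite A" "A \<subseteq> B" and z: "\<And>b. b \<notin> A \<Longrightarrow> c b = \<zero>\<^bsub>R\<^esub>"
    and x: "x = (\<Oplus>\<^bsub>F\<^esub>b\<in>A. c b \<odot>\<^bsub>F\<^esub> b)" for x c A
  proof -
    have "{b. c b \<noteq> \<zero>\<^bsub>R\<^esub>} \<subseteq> A" using z by auto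
    moreover have "(\<Oplus>\<^bsub>F\<^esub>b\<in>{b. c b \<noteq> \<zero>\<^bsub>R\<^esub>}. c b \<odot>\<^bsub>F\<^esub> b) = (\<Oplus>\<^bsub>F\<^esub>b\<in>A. c b \<odot>\<^bsub>F\<^esub> b)"
      by (rule finsum_superset[OF F A(1) calculation]) (use A BF c in auto)
    ultimately show ?thesis unfolding P_def using c A z x finite_subset by auto
  qed
  have repr: "x = (\<Oplus>\<^bsub>F\<^esub>b\<in>A. cf x b \<odot>\<^bsub>F\<^esub> b)" if x: "x \<in> carrier F" and A: "finite A" "A \<subseteq> B" "S x \<subseteq> A" for x A
  proof -
    have "x = (\<Oplus>\<^bsub>F\<^esub>b\<in>S x. cf x b \<odot>\<^bsub>F\<^esub> b)" using cf[OF x] unfolding P_def S_def by blast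
    also have "\<dots> = (\<Oplus>\<^bsub>F\<^esub>b\<in>A. cf x b \<odot>\<^bsub>F\<^esub> b)"
      by (rule finsum_superset[OF F A(1,3)]) (use A BF cfR[OF x] in \<open>auto simp: S_def\<close>)
    finally show ?thesis .
  qed
  have cf_add: "cf (x \<oplus>\<^bsub>F\<^esub> y) = (\<lambda>b. cf x b \<oplus>\<^bsub>R\<^esub> cf y b)" if x: "x \<in> carrier F" and y: "y \<in> carrier F" for x y
  proof (rule cf_eq)
    let ?A = "S x \<union> S y"
    have A: "finite ?A" "?A \<subseteq> B" using S x y by auto
    have "x \<oplus>\<^bsub>F\<^esub> y = (\<Oplus>\<^bsub>F\<^esub>b\<in>?A. cf x b \<odot>\<^bsub>F\<^esub> b) \<oplus>\<^bsub>F\<^esub> (\<Oplus>\<^bsub>F\<^esub>b\<in>?A. cf y b \<odot>\<^bsub>F\<^esub> b)"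
      using repr[OF x A] repr[OF y A] by simp
    also have "\<dots> = (\<Oplus>\<^bsub>F\<^esub>b\<in>?A. cf x b \<odot>\<^bsub>F\<^esub> b \<oplus>\<^bsub>F\<^esub> cf y b \<odot>\<^bsub>F\<^esub> b)"
      using A BF cfR x y by (intro F.M.finsum_addf[symmetric]) auto
    also have "\<dots> = (\<Oplus>\<^bsub>F\<^esub>b\<in>?A. (cf x b \<oplus>\<^bsub>R\<^esub> cf y b) \<odot>\<^bsub>F\<^esub> b)"
      by (rule F.M.finsum_cong') (use A BF cfR x y in \<open>auto simp: F.smult_l_distr\<close>)
    finally show "P (x \<oplus>\<^bsub>F\<^esub> y) (\<lambda>b. cf x b \<oplus>\<^bsub>R\<^esub> cf y b)"
      using cfR x y A by (intro PI[of _ ?A]) (auto simp: S_def)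
  qed (use x y in auto)
  have cf_smult: "cf (a \<odot>\<^bsub>F\<^esub> x) = (\<lambda>b. a \<otimes>\<^bsub>R\<^esub> cf x b)" if a: "a \<in> carrier R" and x: "x \<in> carrier F" for a x
  proof (rule cf_eq)
    have "a \<odot>\<^bsub>F\<^esub> x = a \<odot>\<^bsub>F\<^esub> (\<Oplus>\<^bsub>F\<^esub>b\<in>S x. cf x b \<odot>\<^bsub>F\<^esub> b)"
      using repr[OF x S[OF x]] by simp
    also have "\<dots> = (\<Oplus>\<^bsub>F\<^esub>b\<in>S x. a \<odot>\<^bsub>F\<^esub> (cf x b \<odot>\<^bsub>F\<^esub> b))"
      using S[OF x] BF cfR x a by (intro F.finsum_smult_ldistr) auto
    also have "\<dots> = (\<Oplus>\<^bsub>F\<^esub>b\<in>S x. (a \<otimes>\<^bsub>R\<^esub> cf x b) \<odot>\<^bsub>F\<^esub> b)"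
      by (rule F.M.finsum_cong') (use S[OF x] BF cfR x a in \<open>auto simp: F.smult_assoc1\<close>)
    finally show "P (a \<odot>\<^bsub>F\<^esub> x) (\<lambda>b. a \<otimes>\<^bsub>R\<^esub> cf x b)"
      using cfR x a S[OF x] by (intro PI[of _ "S x"]) (auto simp: S_def)
  qed (use x a in auto)
  have "\<forall>b\<in>B. \<exists>y\<in>carrier Y. \<beta> y = \<alpha> b" using sub BF by (fastforce simp: image_iff)
  then obtain y where y: "\<And>b. b \<in> B \<Longrightarrow> y b \<in> carrier Y" "\<And>b. b \<in> B \<Longrightarrow> \<beta> (y b) = \<alpha> b" by metis
  define \<gamma> where "\<gamma> x = (\<Oplus>\<^bsub>Y\<^esub>b\<in>S x. cf x b \<odot>\<^bsub>Y\<^esub> y b)" for x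
  have \<gamma>: "\<gamma> x = (\<Oplus>\<^bsub>Y\<^esub>b\<in>A. cf x b \<odot>\<^bsub>Y\<^esub> y b)" if x: "x \<in> carrier F" and A: "finite A" "A \<subseteq> B" "S x \<subseteq> A" for x A
    unfolding \<gamma>_def
    by (rule finsum_superset[OF Y A(1,3)]) (use A y cfR[OF x] in \<open>auto simp: S_def\<close>)
  have "lin R F Y \<gamma>"
  proof (rule linI)
    fix x assume x: "x \<in> carrier F"
    show "\<gamma> x \<in> carrier Y" unfolding \<gamma>_def
      by (rule Y.M.finsum_closed) (use S[OF x] y cfR[OF x] in auto)
    fix y' assume y': "y' \<in> carrier F"
    let ?A = "S x \<union> S y'"
    have A: "finite ?A" "?A \<subseteq> B" using S x y' by auto
    have "S (x \<oplus>\<^bsub>F\<^esub> y') \<subseteq> ?A" using cfR x y' by (auto simp: S_def cf_add)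
    then have "\<gamma> (x \<oplus>\<^bsub>F\<^esub> y') = (\<Oplus>\<^bsub>Y\<^esub>b\<in>?A. (cf x b \<oplus>\<^bsub>R\<^esub> cf y' b) \<odot>\<^bsub>Y\<^esub> y b)"
      using \<gamma>[OF _ A, of "x \<oplus>\<^bsub>F\<^esub> y'"] x y' by (simp add: cf_add)
    also have "\<dots> = (\<Oplus>\<^bsub>Y\<^esub>b\<in>?A. cf x b \<odot>\<^bsub>Y\<^esub> y b \<oplus>\<^bsub>Y\<^esub> cf y' b \<odot>\<^bsub>Y\<^esub> y b)"
      by (rule Y.M.finsum_cong') (use A y cfR x y' in \<open>auto simp: Y.smult_l_distr\<close>)
    also have "\<dots> = \<gamma> x \<oplus>\<^bsub>Y\<^esub> \<gamma> y'"
      using \<gamma>[OF x A] \<gamma>[OF y' A] A y cfR x y'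
      by (simp, intro Y.M.finsum_addf) auto
    finally show "\<gamma> (x \<oplus>\<^bsub>F\<^esub> y') = \<gamma> x \<oplus>\<^bsub>Y\<^esub> \<gamma> y'" .
  next
    fix a x assume a: "a \<in> carrier R" and x: "x \<in> carrier F"
    have "S (a \<odot>\<^bsub>F\<^esub> x) \<subseteq> S x" using cfR x a by (auto simp: S_def cf_smult)
    then have "\<gamma> (a \<odot>\<^bsub>F\<^esub> x) = (\<Oplus>\<^bsub>Y\<^esub>b\<in>S x. (a \<otimes>\<^bsub>R\<^esub> cf x b) \<odot>\<^bsub>Y\<^esub> y b)"
      using \<gamma>[OF _ S[OF x], of "a \<odot>\<^bsub>F\<^esub> x"] x a by (simp add: cf_smult)
    also have "\<dots> = (\<Oplus>\<^bsub>Y\<^esub>b\<in>S x. a \<odot>\<^bsub>Y\<^esub> (cf x b \<odot>\<^bsub>Y\<^esub> y b))"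
      by (rule Y.M.finsum_cong') (use S[OF x] y cfR x a in \<open>auto simp: Y.smult_assoc1\<close>)
    also have "\<dots> = a \<odot>\<^bsub>Y\<^esub> \<gamma> x" unfolding \<gamma>_def
      using S[OF x] y cfR x a by (intro Y.finsum_smult_ldistr[symmetric]) auto
    finally show "\<gamma> (a \<odot>\<^bsub>F\<^esub> x) = a \<odot>\<^bsub>Y\<^esub> \<gamma> x" .
  qed
  moreover have "\<beta> (\<gamma> x) = \<alpha> x" if x: "x \<in> carrier F" for x
  proof -
    have "\<beta> (\<gamma> x) = (\<Oplus>\<^bsub>X\<^esub>b\<in>S x. \<beta> (cf x b \<odot>\<^bsub>Y\<^esub> y b))" unfolding \<gamma>_def
      by (rule lin_finsum[OF Y X \<beta>]) (use S[OF x] y cfR x in auto)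
    also have "\<dots> = (\<Oplus>\<^bsub>X\<^esub>b\<in>S x. \<alpha> (cf x b \<odot>\<^bsub>F\<^esub> b))"
      by (rule X.M.finsum_cong')
        (use S[OF x] y cfR x \<alpha> \<beta> BF in \<open>auto simp: lin_smult[OF \<alpha>] lin_smult[OF \<beta>] subset_iff\<close>)
    also have "\<dots> = \<alpha> (\<Oplus>\<^bsub>F\<^esub>b\<in>S x. cf x b \<odot>\<^bsub>F\<^esub> b)"
      by (rule lin_finsum[OF F X \<alpha>, symmetric]) (use S[OF x] cfR x BF in auto)
    also have "\<dots> = \<alpha> x" using repr[OF x S[OF x]] by simp
    finally show ?thesis .
  qed
  ultimately show ?thesis by blast
qed

section \<open>Resolutions and comparison\<close>

text \<open>Freeness and extensionality are left out in comparison with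
  \<open>free_resolution\<close>: the cone built later is an exact complex whose projectivity is
  recorded through \<open>lifts\<close>, and its maps are not restricted to carriers.\<close>

definition resolution ::
    "('a, 'm) ring_scheme \<Rightarrow> ('a, 'b, 'n) module_scheme \<Rightarrow> (nat \<Rightarrow> ('a, 'c) module)
      \<Rightarrow> (nat \<Rightarrow> 'c \<Rightarrow> 'c) \<Rightarrow> ('c \<Rightarrow> 'b) \<Rightarrow> bool" where
  "resolution R M P \<delta> \<epsilon> \<longleftrightarrow>
     Module.module R M \<and> (\<forall>n. Module.module R (P n)) \<and>
     (\<forall>n. lin R (P (Suc n)) (P n) (\<delta> n)) \<and>
     lin R (P 0) M \<epsilon> \<and>
     \<epsilon> ` carrier (P 0) = carrier M \<and>
     \<delta> 0 ` carrier (P 1) = {x \<in> carrier (P 0). \<epsilon> x = \<zero>\<^bsub>M\<^esub>} \<and>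
     (\<forall>n. \<delta> (Suc n) ` carrier (P (Suc (Suc n))) = {x \<in> carrier (P (Suc n)). \<delta> n x = \<zero>\<^bsub>P n\<^esub>})"

lemma free_module_module: "free_module R M \<Longrightarrow> Module.module R M"
  by (simp add: free_module_def)

lemma free_resolution_iff:
  assumes "Module.module R M"
  shows "free_resolution R M P \<delta> \<epsilon> \<longleftrightarrow> (\<forall>n. free_module R (P n)) \<and> resolution R M P \<delta> \<epsilon> \<and>
    (\<forall>n. \<delta> n \<in> extensional (carrier (P (Suc n)))) \<and> \<epsilon> \<in> extensional (carrier (P 0))"
  unfolding free_resolution_def resolution_def linear_maps_iff
  by (rule iffI; simp add: all_conj_distrib assms free_module_module)

text \<open>The kernel of the map leaving \<open>P n\<close>, with the augmentation as case 0;
  exactness at all places then becomes one equation, uniform in n.\<close>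

definition syz :: "('a, 'b, 'n) module_scheme \<Rightarrow> (nat \<Rightarrow> ('a, 'c) module)
      \<Rightarrow> (nat \<Rightarrow> 'c \<Rightarrow> 'c) \<Rightarrow> ('c \<Rightarrow> 'b) \<Rightarrow> nat \<Rightarrow> 'c set" where
  "syz M P \<delta> \<epsilon> n = (case n of 0 \<Rightarrow> {x \<in> carrier (P 0). \<epsilon> x = \<zero>\<^bsub>M\<^esub>}
     | Suc k \<Rightarrow> {x \<in> carrier (P (Suc k)). \<delta> k x = \<zero>\<^bsub>P k\<^esub>})"

lemma resolutionD:
  assumes "resolution R M P \<delta> \<epsilon>"
  shows "Module.module R M" "Module.module R (P n)" "lin R (P (Suc n)) (P n) (\<delta> n)" "lin R (P 0) M \<epsilon>"
    "\<epsilon> ` carrier (P 0) = carrier M" "\<delta> n ` carrier (P (Suc n)) = syz M P \<delta> \<epsilon> n"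
  using assms unfolding resolution_def syz_def by (auto split: nat.splits)

lemma syz_subset: "syz M P \<delta> \<epsilon> n \<subseteq> carrier (P n)"
  by (auto simp: syz_def split: nat.splits)

lemma syz_0: "x \<in> syz M P \<delta> \<epsilon> 0 \<longleftrightarrow> x \<in> carrier (P 0) \<and> \<epsilon> x = \<zero>\<^bsub>M\<^esub>"
  by (simp add: syz_def)

lemma syz_Suc: "x \<in> syz M P \<delta> \<epsilon> (Suc n) \<longleftrightarrow> x \<in> carrier (P (Suc n)) \<and> \<delta> n x = \<zero>\<^bsub>P n\<^esub>"
  by (simp add: syz_def)

text \<open>Projectivity of \<open>F\<close>, but only against a fixed pair of modules, as HOL cannot quantify over
  their types.\<close>

definition lifts :: "('a, 'm) ring_scheme \<Rightarrow> ('a, 'b, 'n) module_scheme \<Rightarrow> ('a, 'c, 'k) module_scheme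
    \<Rightarrow> ('a, 'd, 'l) module_scheme \<Rightarrow> bool" where
  "lifts R F X Y \<longleftrightarrow> (\<forall>\<alpha> \<beta>. lin R F X \<alpha> \<longrightarrow> lin R Y X \<beta> \<longrightarrow> \<alpha> ` carrier F \<subseteq> \<beta> ` carrier Y \<longrightarrow>
     (\<exists>\<gamma>. lin R F Y \<gamma> \<and> (\<forall>x\<in>carrier F. \<beta> (\<gamma> x) = \<alpha> x)))"

lemma free_module_lifts:
  "free_module R F \<Longrightarrow> Module.module R X \<Longrightarrow> Module.module R Y \<Longrightarrow> lifts R F X Y"
  unfolding lifts_def using free_module_lift by blast

text \<open>The comparison theorem: lift the augmentation, then in each degree the composite of the
  previous map with the differential.\<close>

lemma chain_map_exists:
  assumes P: "resolution R M P \<delta> \<epsilon>" and P': "resolution R M P' \<delta>' \<epsilon>'"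
    and L0: "lifts R (P 0) M (P' 0)" and L: "\<And>n. lifts R (P (Suc n)) (P' n) (P' (Suc n))"
  shows "\<exists>\<phi>. (\<forall>n. lin R (P n) (P' n) (\<phi> n)) \<and> (\<forall>x\<in>carrier (P 0). \<epsilon>' (\<phi> 0 x) = \<epsilon> x) \<and>
    (\<forall>n. \<forall>x\<in>carrier (P (Suc n)). \<delta>' n (\<phi> (Suc n) x) = \<phi> n (\<delta> n x))"
proof -
  note D = resolutionD[OF P] and D' = resolutionD[OF P']
  let ?Z = "syz M P \<delta> \<epsilon>" and ?Z' = "syz M P' \<delta>' \<epsilon>'"
  \<comment> \<open>Sending cycles to cycles is what makes the next lift possible. The clause for
    \<open>n = 0\<close> carries the compatibility with the augmentations through the dependent
    choice.\<close>
  define A where "A n \<phi> \<longleftrightarrow> lin R (P n) (P' n) \<phi> \<and> (\<forall>z\<in>?Z n. \<phi> z \<in> ?Z' n) \<and>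
     (n = 0 \<longrightarrow> (\<forall>x\<in>carrier (P 0). \<epsilon>' (\<phi> x) = \<epsilon> x))" for n \<phi>
  have "\<exists>f. \<forall>n. A n (f n) \<and> (\<forall>x\<in>carrier (P (Suc n)). \<delta>' n (f (Suc n) x) = f n (\<delta> n x))"
  proof (rule dependent_nat_choice)
    have "\<epsilon> ` carrier (P 0) \<subseteq> \<epsilon>' ` carrier (P' 0)" using D(5) D'(5) by simp
    then obtain \<phi> where "lin R (P 0) (P' 0) \<phi>" "\<forall>x\<in>carrier (P 0). \<epsilon>' (\<phi> x) = \<epsilon> x"
      using L0 D(4) D'(4) unfolding lifts_def by blast
    then show "\<exists>\<phi>. A 0 \<phi>" unfolding A_def by (auto simp: syz_0)
  next
    fix \<phi> n assume "A n \<phi>"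
    then have \<phi>: "lin R (P n) (P' n) \<phi>" "\<And>z. z \<in> ?Z n \<Longrightarrow> \<phi> z \<in> ?Z' n" unfolding A_def by auto
    have "lin R (P (Suc n)) (P' n) (\<lambda>x. \<phi> (\<delta> n x))" using lin_comp[OF D(3) \<phi>(1)] .
    moreover have "(\<lambda>x. \<phi> (\<delta> n x)) ` carrier (P (Suc n)) \<subseteq> \<delta>' n ` carrier (P' (Suc n))"
      using \<phi>(2) D(6)[of n] D'(6)[of n] by auto
    ultimately obtain \<psi> where \<psi>: "lin R (P (Suc n)) (P' (Suc n)) \<psi>"
        "\<forall>x\<in>carrier (P (Suc n)). \<delta>' n (\<psi> x) = \<phi> (\<delta> n x)"
      using L[of n] D'(3)[of n] unfolding lifts_def by blast
    then have "A (Suc n) \<psi>" using lin_zero[OF D(2) D'(2) \<phi>(1)] unfolding A_def by (auto simp: syz_Suc)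
    with \<psi> show "\<exists>\<psi>. A (Suc n) \<psi> \<and> (\<forall>x\<in>carrier (P (Suc n)). \<delta>' n (\<psi> x) = \<phi> (\<delta> n x))" by blast
  qed
  then obtain f where "A n (f n)" and "\<forall>x\<in>carrier (P (Suc n)). \<delta>' n (f (Suc n) x) = f n (\<delta> n x)" for n by blast
  then show ?thesis by (intro exI[of _ f]) (simp add: A_def)
qed

text \<open>A chain endomorphism inducing zero on \<open>M\<close> is null-homotopic. The homotopy
  identity is returned in degrees n + 1, where cocycles will be compared.\<close>

lemma homotopy_exists:
  assumes P: "resolution R M P \<delta> \<epsilon>" and L: "\<And>n. lifts R (P n) (P n) (P (Suc n))"
    and \<chi>: "\<And>n. lin R (P n) (P n) (\<chi> n)" and \<chi>0: "\<And>x. x \<in> carrier (P 0) \<Longrightarrow> \<epsilon> (\<chi> 0 x) = \<zero>\<^bsub>M\<^esub>"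
    and \<chi>\<delta>: "\<And>n x. x \<in> carrier (P (Suc n)) \<Longrightarrow> \<delta> n (\<chi> (Suc n) x) = \<chi> n (\<delta> n x)"
  shows "\<exists>s. (\<forall>n. lin R (P n) (P (Suc n)) (s n)) \<and>
    (\<forall>n. \<forall>x\<in>carrier (P (Suc n)). \<delta> (Suc n) (s (Suc n) x) = \<chi> (Suc n) x \<ominus>\<^bsub>P (Suc n)\<^esub> s n (\<delta> n x))"
proof -
  note D = resolutionD[OF P]
  let ?Z = "syz M P \<delta> \<epsilon>"
  \<comment> \<open>On cycles the homotopy identity loses its second term. This weaker form already
    forces \<chi> - s \<delta> into the cycles of the next degree, which are boundaries by
    exactness.\<close>
  define A where "A n s \<longleftrightarrow> lin R (P n) (P (Suc n)) s \<and> (\<forall>z\<in>?Z n. \<delta> n (s z) = \<chi> n z)" for n s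
  have "\<exists>s. \<forall>n. A n (s n) \<and> (\<forall>x\<in>carrier (P (Suc n)). \<delta> (Suc n) (s (Suc n) x) = \<chi> (Suc n) x \<ominus>\<^bsub>P (Suc n)\<^esub> s n (\<delta> n x))"
  proof (rule dependent_nat_choice)
    have "\<chi> 0 ` carrier (P 0) \<subseteq> \<delta> 0 ` carrier (P (Suc 0))"
      unfolding D(6) using \<chi>0 \<chi>[of 0] by (auto simp: syz_0)
    then obtain s where "lin R (P 0) (P (Suc 0)) s" "\<forall>x\<in>carrier (P 0). \<delta> 0 (s x) = \<chi> 0 x"
      using L[of 0] \<chi>[of 0] D(3)[of 0] unfolding lifts_def by blast
    then show "\<exists>s. A 0 s" unfolding A_def by (auto simp: syz_0)
  next
    fix s n assume "A n s"
    then have s: "lin R (P n) (P (Suc n)) s" "\<And>z. z \<in> ?Z n \<Longrightarrow> \<delta> n (s z) = \<chi> n z" unfolding A_def by auto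
    interpret Pn: Module.module R "P n" by (rule D)
    interpret PS: Module.module R "P (Suc n)" by (rule D)
    have lc: "lin R (P (Suc n)) (P (Suc n)) (\<lambda>x. \<chi> (Suc n) x \<ominus>\<^bsub>P (Suc n)\<^esub> s (\<delta> n x))"
      by (intro lin_sub D \<chi> lin_comp[OF D(3) s(1)])
    have "\<chi> (Suc n) x \<ominus>\<^bsub>P (Suc n)\<^esub> s (\<delta> n x) \<in> ?Z (Suc n)" if x: "x \<in> carrier (P (Suc n))" for x
    proof -
      have dx: "\<delta> n x \<in> ?Z n" using D(6)[of n] x by auto
      then have dxc: "\<delta> n x \<in> carrier (P n)" using syz_subset by fast
      have "\<delta> n (\<chi> (Suc n) x \<ominus>\<^bsub>P (Suc n)\<^esub> s (\<delta> n x)) = \<delta> n (\<chi> (Suc n) x) \<ominus>\<^bsub>P n\<^esub> \<delta> n (s (\<delta> n x))"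
        by (intro lin_diff[OF D(2) D(2) D(3)] lin_closed[OF \<chi> x] lin_closed[OF s(1) dxc])
      also have "\<dots> = \<zero>\<^bsub>P n\<^esub>" using s(2)[OF dx] \<chi>\<delta>[OF x] lin_closed[OF \<chi> dxc] by (simp add: Pn.M.r_neg a_minus_def)
      finally show ?thesis using lin_closed[OF lc x] by (simp add: syz_Suc)
    qed
    then have "(\<lambda>x. \<chi> (Suc n) x \<ominus>\<^bsub>P (Suc n)\<^esub> s (\<delta> n x)) ` carrier (P (Suc n))
        \<subseteq> \<delta> (Suc n) ` carrier (P (Suc (Suc n)))"
      unfolding D(6) by auto
    then obtain s' where s': "lin R (P (Suc n)) (P (Suc (Suc n))) s'"
       "\<forall>x\<in>carrier (P (Suc n)). \<delta> (Suc n) (s' x) = \<chi> (Suc n) x \<ominus>\<^bsub>P (Suc n)\<^esub> s (\<delta> n x)"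
      using L[of "Suc n"] lc D(3)[of "Suc n"] unfolding lifts_def by blast
    have "\<delta> (Suc n) (s' z) = \<chi> (Suc n) z" if "z \<in> ?Z (Suc n)" for z
      using that s'(2) lin_zero[OF D(2) D(2) s(1)] lin_closed[OF \<chi>, of z "Suc n"]
      by (simp add: syz_Suc a_minus_def)
    then have "A (Suc n) s'" using s'(1) unfolding A_def by blast
    with s' show "\<exists>s'. A (Suc n) s' \<and> (\<forall>x\<in>carrier (P (Suc n)). \<delta> (Suc n) (s' x) = \<chi> (Suc n) x \<ominus>\<^bsub>P (Suc n)\<^esub> s (\<delta> n x))"
      by blast
  qed
  then obtain f where "A n (f n)" and "\<forall>x\<in>carrier (P (Suc n)). \<delta> (Suc n) (f (Suc n) x) = \<chi> (Suc n) x \<ominus>\<^bsub>P (Suc n)\<^esub> f n (\<delta> n x)" for n by blast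
  then show ?thesis by (intro exI[of _ f]) (simp add: A_def)
qed

text \<open>Indexed so that \<open>vanishes R P \<delta> N n\<close> speaks about cohomology in degree \<open>n + 1\<close>.\<close>

definition vanishes :: "('a, 'm) ring_scheme \<Rightarrow> (nat \<Rightarrow> ('a, 'c) module) \<Rightarrow> (nat \<Rightarrow> 'c \<Rightarrow> 'c)
      \<Rightarrow> ('a, 'e, 'k) module_scheme \<Rightarrow> nat \<Rightarrow> bool" where
  "vanishes R P \<delta> N n \<longleftrightarrow> (\<forall>f. lin R (P (Suc n)) N f \<longrightarrow>
     (\<forall>x\<in>carrier (P (Suc (Suc n))). f (\<delta> (Suc n) x) = \<zero>\<^bsub>N\<^esub>) \<longrightarrow>
     (\<exists>g. lin R (P n) N g \<and> (\<forall>x\<in>carrier (P (Suc n)). f x = g (\<delta> n x))))"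

text \<open>With chain maps \<phi>, \<psi> between the resolutions and a homotopy s for \<psi>
  \<phi> - 1, a cocycle f satisfies f \<psi> \<phi> - f = f s \<delta>. So f is a coboundary as soon
  as f \<psi> is one. \<open>P'\<close> may live on another type; the cone will take its
  place.\<close>

lemma vanishes_comparison:
  assumes P: "resolution R M P \<delta> \<epsilon>" and free: "\<And>n. free_module R (P n)"
    and P': "resolution R M P' \<delta>' \<epsilon>'"
    and L0: "lifts R (P' 0) M (P 0)" and L: "\<And>n. lifts R (P' (Suc n)) (P n) (P (Suc n))"
    and N: "Module.module R N" and van: "vanishes R P' \<delta>' N n"
  shows "vanishes R P \<delta> N n"
  unfolding vanishes_def
proof (intro allI impI)
  fix f assume f: "lin R (P (Suc n)) N f" and fc: "\<forall>x\<in>carrier (P (Suc (Suc n))). f (\<delta> (Suc n) x) = \<zero>\<^bsub>N\<^esub>"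
  note D = resolutionD[OF P] and D' = resolutionD[OF P']
  interpret N: Module.module R N by fact
  obtain \<phi> where \<phi>: "\<And>n. lin R (P n) (P' n) (\<phi> n)" "\<And>x. x \<in> carrier (P 0) \<Longrightarrow> \<epsilon>' (\<phi> 0 x) = \<epsilon> x"
      "\<And>n x. x \<in> carrier (P (Suc n)) \<Longrightarrow> \<delta>' n (\<phi> (Suc n) x) = \<phi> n (\<delta> n x)"
    using chain_map_exists[OF P P' free_module_lifts[OF free D(1) D'(2)] free_module_lifts[OF free D'(2) D'(2)]]
    by blast
  obtain \<psi> where \<psi>: "\<And>n. lin R (P' n) (P n) (\<psi> n)" "\<And>x. x \<in> carrier (P' 0) \<Longrightarrow> \<epsilon> (\<psi> 0 x) = \<epsilon>' x"
      "\<And>n x. x \<in> carrier (P' (Suc n)) \<Longrightarrow> \<delta> n (\<psi> (Suc n) x) = \<psi> n (\<delta>' n x)"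
    using chain_map_exists[OF P' P L0 L] by blast
  define \<chi> where "\<chi> n x = \<psi> n (\<phi> n x) \<ominus>\<^bsub>P n\<^esub> x" for n x
  have \<chi>: "lin R (P n) (P n) (\<chi> n)" for n unfolding \<chi>_def
    by (intro lin_sub D lin_id lin_comp[OF \<phi>(1) \<psi>(1)])
  have dc: "\<delta> n x \<in> carrier (P n)" if "x \<in> carrier (P (Suc n))" for n x
    by (rule lin_closed[OF D(3) that])
  have e0: "\<epsilon> (\<chi> 0 x) = \<zero>\<^bsub>M\<^esub>" if x: "x \<in> carrier (P 0)" for x
  proof -
    interpret M: Module.module R M by (rule D)
    have "\<epsilon> (\<chi> 0 x) = \<epsilon> (\<psi> 0 (\<phi> 0 x)) \<ominus>\<^bsub>M\<^esub> \<epsilon> x" unfolding \<chi>_def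
      by (intro lin_diff[OF D(2) D(1) D(4)] x lin_closed[OF \<psi>(1)] lin_closed[OF \<phi>(1)])
    then show ?thesis using x \<phi>(2) \<psi>(2)[OF lin_closed[OF \<phi>(1) x]] lin_closed[OF D(4) x]
      by (simp add: a_minus_def M.M.r_neg)
  qed
  have d\<chi>: "\<delta> n (\<chi> (Suc n) x) = \<chi> n (\<delta> n x)" if x: "x \<in> carrier (P (Suc n))" for n x
  proof -
    have "\<delta> n (\<chi> (Suc n) x) = \<delta> n (\<psi> (Suc n) (\<phi> (Suc n) x)) \<ominus>\<^bsub>P n\<^esub> \<delta> n x" unfolding \<chi>_def
      by (intro lin_diff[OF D(2) D(2) D(3)] x lin_closed[OF \<psi>(1)] lin_closed[OF \<phi>(1)])
    then show ?thesis using \<phi>(3)[OF x] \<psi>(3)[OF lin_closed[OF \<phi>(1) x]] by (simp add: \<chi>_def)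
  qed
  have "\<exists>s. (\<forall>n. lin R (P n) (P (Suc n)) (s n)) \<and>
    (\<forall>n. \<forall>x\<in>carrier (P (Suc n)). \<delta> (Suc n) (s (Suc n) x) = \<chi> (Suc n) x \<ominus>\<^bsub>P (Suc n)\<^esub> s n (\<delta> n x))"
    by (rule homotopy_exists[OF P free_module_lifts[OF free D(2) D(2)] \<chi> e0 d\<chi>])
  then obtain s where s: "\<And>n. lin R (P n) (P (Suc n)) (s n)"
    "\<And>n x. x \<in> carrier (P (Suc n)) \<Longrightarrow> \<delta> (Suc n) (s (Suc n) x) = \<chi> (Suc n) x \<ominus>\<^bsub>P (Suc n)\<^esub> s n (\<delta> n x)"
    by blast
  have "lin R (P' (Suc n)) N (\<lambda>x. f (\<psi> (Suc n) x))" using lin_comp[OF \<psi>(1) f] .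
  moreover have "f (\<psi> (Suc n) (\<delta>' (Suc n) x)) = \<zero>\<^bsub>N\<^esub>" if "x \<in> carrier (P' (Suc (Suc n)))" for x
    using \<psi>(3)[OF that] fc lin_closed[OF \<psi>(1) that] by metis
  ultimately obtain g where g: "lin R (P' n) N g"
      "\<And>x. x \<in> carrier (P' (Suc n)) \<Longrightarrow> f (\<psi> (Suc n) x) = g (\<delta>' n x)"
    using van unfolding vanishes_def by blast
  \<comment> \<open>Writing f \<psi> = g \<delta>', the homotopy identity rearranges to f = (g
    \<phi> - f s) \<delta>.\<close>
  let ?h = "\<lambda>x. g (\<phi> n x) \<ominus>\<^bsub>N\<^esub> f (s n x)"
  have "lin R (P n) N ?h"
    by (intro lin_sub N lin_comp[OF \<phi>(1) g(1)] lin_comp[OF s(1) f])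
  moreover have "f x = ?h (\<delta> n x)" if x: "x \<in> carrier (P (Suc n))" for x
  proof -
    interpret PS: Module.module R "P (Suc n)" by (rule D)
    let ?y = "s n (\<delta> n x)" and ?z = "\<psi> (Suc n) (\<phi> (Suc n) x)"
    have yc: "?y \<in> carrier (P (Suc n))" and zc: "?z \<in> carrier (P (Suc n))"
      by (rule lin_closed[OF s(1) dc[OF x]], rule lin_closed[OF \<psi>(1) lin_closed[OF \<phi>(1) x]])
    have "f (\<delta> (Suc n) (s (Suc n) x)) = \<zero>\<^bsub>N\<^esub>" using fc lin_closed[OF s(1) x] by blast
    then have "f (?z \<ominus>\<^bsub>P (Suc n)\<^esub> x \<ominus>\<^bsub>P (Suc n)\<^esub> ?y) = \<zero>\<^bsub>N\<^esub>" using s(2)[OF x] by (simp add: \<chi>_def)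
    then have eq: "f ?z \<ominus>\<^bsub>N\<^esub> f x \<ominus>\<^bsub>N\<^esub> f ?y = \<zero>\<^bsub>N\<^esub>"
      using x yc zc by (simp add: lin_diff[OF D(2) N f] PS.M.minus_closed)
    have fz: "f ?z = g (\<phi> n (\<delta> n x))" using \<phi>(3)[OF x] g(2)[OF lin_closed[OF \<phi>(1) x]] by simp
    have c: "f ?z \<in> carrier N" "f x \<in> carrier N" "f ?y \<in> carrier N" using f x yc zc by auto
    have "f x \<oplus>\<^bsub>N\<^esub> (f ?z \<ominus>\<^bsub>N\<^esub> f x \<ominus>\<^bsub>N\<^esub> f ?y) = f ?z \<ominus>\<^bsub>N\<^esub> f ?y"
      using c by (simp add: a_minus_def N.M.a_assoc N.M.a_lcomm[of "f x" "f ?z"] N.M.r_neg2)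
    with eq c have "f ?z \<ominus>\<^bsub>N\<^esub> f ?y = f x" by simp
    with fz show ?thesis by simp
  qed
  ultimately show "\<exists>g. lin R (P n) N g \<and> (\<forall>x\<in>carrier (P (Suc n)). f x = g (\<delta> n x))" by blast
qed

text \<open>\<open>chosen_resolution\<close> is an arbitrary choice, hence the hypothesis on all
  free resolutions over the prescribed element type and the existence claim that makes the choice
  meaningful. Cocycles and coboundaries then coincide, and the quotient has the coboundaries as its
  single coset.\<close>

lemma Ext_zero:
  assumes M: "Module.module R M" and N: "Module.module R N"
    and ex: "\<exists>(P :: nat \<Rightarrow> ('a, ('a, 'b) res_elem) module) \<delta> \<epsilon>. free_resolution R M P \<delta> \<epsilon>"
    and van: "\<And>(P :: nat \<Rightarrow> ('a, ('a, 'b) res_elem) module) \<delta> \<epsilon>.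
      free_resolution R M P \<delta> \<epsilon> \<Longrightarrow> vanishes R P \<delta> N n"
  shows "carrier (Ext R (Suc n) (M :: ('a, 'b, 'n) module_scheme) N) = {\<zero>\<^bsub>Ext R (Suc n) M N\<^esub>}"
proof -
  interpret N: Module.module R N by fact
  obtain P \<delta> \<epsilon> where ch: "chosen_resolution R M = (P, \<delta>, \<epsilon>)" by (metis prod_cases3)
  have "case chosen_resolution R M of (P, \<delta>, \<epsilon>) \<Rightarrow> free_resolution R M P \<delta> \<epsilon>"
    unfolding chosen_resolution_def by (rule someI_ex) (use ex in auto)
  then have fr: "free_resolution R M P \<delta> \<epsilon>" by (simp add: ch)
  then have "resolution R M P \<delta> \<epsilon>" using free_resolution_iff[OF M] by blast
  note D = resolutionD[OF this]
  have v: "vanishes R P \<delta> N n" using van[OF fr] .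
  let ?H = "coboundaries R P \<delta> N (Suc n)" and ?C = "cocycles R P \<delta> N (Suc n)"
  let ?A = "(hom_module R (P (Suc n)) N)\<lparr>carrier := ?C\<rparr>"
  have dd: "\<delta> n (\<delta> (Suc n) x) = \<zero>\<^bsub>P n\<^esub>" if "x \<in> carrier (P (Suc (Suc n)))" for x
    using D(6)[of "Suc n"] that syz_Suc[of "\<delta> (Suc n) x"] by blast
  have H: "f \<in> ?H \<longleftrightarrow> f \<in> extensional (carrier (P (Suc n))) \<and>
    (\<exists>g. lin R (P n) N g \<and> (\<forall>x\<in>carrier (P (Suc n)). f x = g (\<delta> n x)))" for f
  proof
    assume "f \<in> ?H"
    then show "f \<in> extensional (carrier (P (Suc n))) \<and>
      (\<exists>g. lin R (P n) N g \<and> (\<forall>x\<in>carrier (P (Suc n)). f x = g (\<delta> n x)))"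
      by (auto simp: linear_maps_iff compose_def)
  next
    assume r: "f \<in> extensional (carrier (P (Suc n))) \<and>
      (\<exists>g. lin R (P n) N g \<and> (\<forall>x\<in>carrier (P (Suc n)). f x = g (\<delta> n x)))"
    then obtain g where g: "lin R (P n) N g" "\<And>x. x \<in> carrier (P (Suc n)) \<Longrightarrow> f x = g (\<delta> n x)" by blast
    have "f = compose (carrier (P (Suc n))) (restrict g (carrier (P n))) (\<delta> n)"
      by (rule extensionalityI[of _ "carrier (P (Suc n))"])
        (use r g D(3)[of n] in \<open>auto simp: compose_def\<close>)
    then show "f \<in> ?H" using linear_maps_restrict[OF g(1) D(2)] by auto
  qed
  have CH: "?C = ?H"
  proof (intro equalityI subsetI)
    fix f assume "f \<in> ?C"
    then show "f \<in> ?H" using v unfolding H cocycles_def vanishes_def linear_maps_iff by blast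
  next
    fix f assume "f \<in> ?H"
    then obtain g where g: "lin R (P n) N g" "\<And>x. x \<in> carrier (P (Suc n)) \<Longrightarrow> f x = g (\<delta> n x)"
      and ext: "f \<in> extensional (carrier (P (Suc n)))" unfolding H by blast
    have "lin R (P (Suc n)) N f" by (rule lin_cong[OF lin_comp[OF D(3) g(1)] D(2) g(2)])
    moreover have "f (\<delta> (Suc n) x) = \<zero>\<^bsub>N\<^esub>" if "x \<in> carrier (P (Suc (Suc n)))" for x
      using that g dd[OF that] lin_closed[OF D(3) that] lin_zero[OF D(2) N g(1)] by simp
    ultimately show "f \<in> ?C" using ext unfolding cocycles_def linear_maps_iff by blast
  qed
  have lm: "lin R (P (Suc n)) N f" "f \<in> extensional (carrier (P (Suc n)))" if "f \<in> ?H" for f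
    using that CH unfolding cocycles_def linear_maps_iff by blast+
  \<comment> \<open>Coboundaries are closed under adding and subtracting a coboundary, so
    translation by one of them permutes them.\<close>
  have coset: "?H #>\<^bsub>add_monoid ?A\<^esub> f = ?H" if f: "f \<in> ?H" for f
  proof -
    obtain g where g: "lin R (P n) N g" "\<And>x. x \<in> carrier (P (Suc n)) \<Longrightarrow> f x = g (\<delta> n x)" using f unfolding H by blast
    let ?pl = "\<lambda>h. \<lambda>x\<in>carrier (P (Suc n)). h x \<oplus>\<^bsub>N\<^esub> f x"
    have "?H #>\<^bsub>add_monoid ?A\<^esub> f = ?pl ` ?H"
      by (auto simp: r_coset_def hom_module_def simp del: coboundaries.simps)
    also have "\<dots> = ?H"
    proof (intro equalityI subsetI)
      fix h assume "h \<in> ?pl ` ?H"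
      then obtain h' where h': "h = ?pl h'" "h' \<in> ?H" by blast
      then obtain g' where g': "lin R (P n) N g'" "\<And>x. x \<in> carrier (P (Suc n)) \<Longrightarrow> h' x = g' (\<delta> n x)"
        unfolding H by blast
      show "h \<in> ?H" unfolding H h'(1) using g g' lin_plus[OF N g'(1) g(1)] by auto
    next
      fix h assume h: "h \<in> ?H"
      then obtain g' where g': "lin R (P n) N g'" "\<And>x. x \<in> carrier (P (Suc n)) \<Longrightarrow> h x = g' (\<delta> n x)"
        unfolding H by blast
      let ?k = "\<lambda>x\<in>carrier (P (Suc n)). h x \<ominus>\<^bsub>N\<^esub> f x"
      have "?k \<in> ?H" unfolding H using g g' lin_sub[OF N g'(1) g(1)] by auto
      moreover have "h = ?pl ?k"
        by (rule extensionalityI[of _ "carrier (P (Suc n))"])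
          (use lm[OF h] lm[OF f] in \<open>auto simp: a_minus_def N.M.a_assoc N.M.l_neg\<close>)
      ultimately show "h \<in> ?pl ` ?H" by blast
    qed
    finally show ?thesis .
  qed
  have "?H \<noteq> {}"
  proof -
    have "lin R (P n) N (\<lambda>x. \<zero>\<^bsub>N\<^esub>)" by (intro linI) auto
    then have "(\<lambda>x\<in>carrier (P (Suc n)). \<zero>\<^bsub>N\<^esub>) \<in> ?H" unfolding H by auto
    then show ?thesis by blast
  qed
  then have "a_rcosets\<^bsub>?A\<^esub> ?H = {?H}"
    unfolding A_RCOSETS_def RCOSETS_def using coset by (auto simp: CH simp del: coboundaries.simps)
  then show ?thesis
    by (simp add: Ext_def ch Hom_cohomology_def quotient_module_def del: coboundaries.simps)
qed

lemma (in abelian_group) minus_eq_zero_iff: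
  assumes "x \<in> carrier G" "y \<in> carrier G"
  shows "x \<ominus> y = \<zero> \<longleftrightarrow> x = y"
proof
  assume "x \<ominus> y = \<zero>"
  then have "x = \<ominus> (\<ominus> y)" using assms by (intro minus_equality[symmetric]) (auto simp: a_minus_def)
  then show "x = y" using assms by simp
qed (use assms in \<open>simp add: a_minus_def r_neg\<close>)

text \<open>Defines a linear map through non-unique representations of its argument.
  Single-valuedness reduces to the fibre over zero by subtracting two related pairs.\<close>

lemma lin_of_relation:
  assumes M: "Module.module R M" and N: "Module.module R N"
    and total: "\<And>x. x \<in> carrier M \<Longrightarrow> \<exists>y. G x y"
    and closed: "\<And>x y. G x y \<Longrightarrow> x \<in> carrier M \<and> y \<in> carrier N"
    and add: "\<And>x y x' y'. G x y \<Longrightarrow> G x' y' \<Longrightarrow> G (x \<oplus>\<^bsub>M\<^esub> x') (y \<oplus>\<^bsub>N\<^esub> y')"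
    and smult: "\<And>a x y. a \<in> carrier R \<Longrightarrow> G x y \<Longrightarrow> G (a \<odot>\<^bsub>M\<^esub> x) (a \<odot>\<^bsub>N\<^esub> y)"
    and zero: "\<And>y. G \<zero>\<^bsub>M\<^esub> y \<Longrightarrow> y = \<zero>\<^bsub>N\<^esub>"
  shows "\<exists>g. lin R M N g \<and> (\<forall>x y. G x y \<longrightarrow> y = g x)"
proof -
  interpret M: Module.module R M by fact
  interpret N: Module.module R N by fact
  have uniq: "y = y'" if "G x y" "G x y'" for x y y'
  proof -
    have x: "x \<in> carrier M" and y: "y \<in> carrier N" "y' \<in> carrier N" using that closed by auto
    have "G (x \<oplus>\<^bsub>M\<^esub> (\<ominus>\<^bsub>R\<^esub> \<one>\<^bsub>R\<^esub>) \<odot>\<^bsub>M\<^esub> x) (y \<oplus>\<^bsub>N\<^esub> (\<ominus>\<^bsub>R\<^esub> \<one>\<^bsub>R\<^esub>) \<odot>\<^bsub>N\<^esub> y')"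
      using that by (intro add smult) auto
    then have "G \<zero>\<^bsub>M\<^esub> (y \<ominus>\<^bsub>N\<^esub> y')" using x y by (simp add: M.smult_l_minus N.smult_l_minus M.M.r_neg a_minus_def)
    then have "y \<ominus>\<^bsub>N\<^esub> y' = \<zero>\<^bsub>N\<^esub>" by (rule zero)
    then show ?thesis using y by (simp add: N.M.minus_eq_zero_iff)
  qed
  from total obtain g where g: "\<And>x. x \<in> carrier M \<Longrightarrow> G x (g x)" by metis
  have "lin R M N g"
    using closed g uniq add smult by (intro linI) (meson M.M.a_closed M.smult_closed)+
  then show ?thesis using closed g uniq by blast
qed

text \<open>For \<open>M = R/t\<close> with generator \<open>e\<close>, a 1-cocycle is a linear map on \<open>ker \<epsilon>\<close>. If \<open>p\<close> lifts \<open>e\<close> to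
  \<open>P 0\<close>, the value \<open>c\<close> at \<open>t p\<close> is killed by \<open>0 : t\<close>, hence \<open>c = t n\<close>, and mapping \<open>p\<close> to \<open>n\<close> extends the
  cocycle to \<open>P 0\<close>.\<close>

lemma vanishes_0_cyclic:
  assumes P: "resolution R M P \<delta> \<epsilon>" and N: "Module.module R N" and t: "t \<in> carrier R"
    and e: "e \<in> carrier M" and gen: "\<And>m. m \<in> carrier M \<Longrightarrow> \<exists>r\<in>carrier R. m = r \<odot>\<^bsub>M\<^esub> e"
    and ann: "\<And>r. r \<in> carrier R \<Longrightarrow> r \<odot>\<^bsub>M\<^esub> e = \<zero>\<^bsub>M\<^esub> \<longleftrightarrow> (\<exists>u\<in>carrier R. r = u \<otimes>\<^bsub>R\<^esub> t)"
    and div: "\<And>c. c \<in> carrier N \<Longrightarrow> (\<And>s. s \<in> carrier R \<Longrightarrow> s \<otimes>\<^bsub>R\<^esub> t = \<zero>\<^bsub>R\<^esub> \<Longrightarrow> s \<odot>\<^bsub>N\<^esub> c = \<zero>\<^bsub>N\<^esub>)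
      \<Longrightarrow> \<exists>n\<in>carrier N. c = t \<odot>\<^bsub>N\<^esub> n"
  shows "vanishes R P \<delta> N 0"
  unfolding vanishes_def
proof (intro allI impI)
  fix f assume f: "lin R (P (Suc 0)) N f" and fc: "\<forall>x\<in>carrier (P (Suc (Suc 0))). f (\<delta> (Suc 0) x) = \<zero>\<^bsub>N\<^esub>"
  note D = resolutionD[OF P]
  interpret M: Module.module R M by (rule D)
  interpret N: Module.module R N by fact
  interpret P0: Module.module R "P 0" by (rule D)
  interpret P1: Module.module R "P (Suc 0)" by (rule D)
  have d: "lin R (P (Suc 0)) (P 0) (\<delta> 0)" by (rule D)
  \<comment> \<open>Cocycles kill the image of \<open>\<delta> 1\<close>, which by exactness is the
    kernel of \<open>\<delta> 0\<close>; so f factors through the image of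
    \<open>\<delta> 0\<close>.\<close>
  have ker: "f x = \<zero>\<^bsub>N\<^esub>" if "x \<in> carrier (P (Suc 0))" "\<delta> 0 x = \<zero>\<^bsub>P 0\<^esub>" for x
  proof -
    have "x \<in> syz M P \<delta> \<epsilon> (Suc 0)" using that by (simp add: syz_Suc)
    then show ?thesis using fc unfolding D(6)[symmetric] by blast
  qed
  have im: "\<exists>x\<in>carrier (P (Suc 0)). z = \<delta> 0 x" if "z \<in> carrier (P 0)" "\<epsilon> z = \<zero>\<^bsub>M\<^esub>" for z
    using that D(6)[of 0] by (auto simp: syz_0 set_eq_iff image_iff)
  have \<epsilon>d: "\<epsilon> (\<delta> 0 x) = \<zero>\<^bsub>M\<^esub>" if "x \<in> carrier (P (Suc 0))" for x
    using that D(6)[of 0] by (auto simp: syz_0 set_eq_iff image_iff)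
  have inj: "f x = f y" if "x \<in> carrier (P (Suc 0))" "y \<in> carrier (P (Suc 0))" "\<delta> 0 x = \<delta> 0 y" for x y
  proof -
    have "\<delta> 0 (x \<ominus>\<^bsub>P (Suc 0)\<^esub> y) = \<zero>\<^bsub>P 0\<^esub>"
      unfolding lin_diff[OF D(2) D(2) d that(1,2)] using that lin_closed[OF d] by (simp add: P0.M.minus_eq_zero_iff)
    then have "f (x \<ominus>\<^bsub>P (Suc 0)\<^esub> y) = \<zero>\<^bsub>N\<^esub>" using that by (intro ker P1.M.minus_closed)
    then have "f x \<ominus>\<^bsub>N\<^esub> f y = \<zero>\<^bsub>N\<^esub>" using that by (simp add: lin_diff[OF D(2) N f])
    then show ?thesis using lin_closed[OF f] that by (simp add: N.M.minus_eq_zero_iff)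
  qed
  obtain p where p: "p \<in> carrier (P 0)" "\<epsilon> p = e" using e unfolding D(5)[symmetric] by blast
  have "\<epsilon> (t \<odot>\<^bsub>P 0\<^esub> p) = \<zero>\<^bsub>M\<^esub>" using p t ann[OF t] by (auto simp: lin_smult[OF D(4)] intro!: bexI[of _ "\<one>\<^bsub>R\<^esub>"])
  then obtain xp where xp: "xp \<in> carrier (P (Suc 0))" "t \<odot>\<^bsub>P 0\<^esub> p = \<delta> 0 xp" using im p t by blast
  have "\<exists>n\<in>carrier N. f xp = t \<odot>\<^bsub>N\<^esub> n"
  proof (rule div)
    fix s assume s: "s \<in> carrier R" "s \<otimes>\<^bsub>R\<^esub> t = \<zero>\<^bsub>R\<^esub>"
    have "\<delta> 0 (s \<odot>\<^bsub>P (Suc 0)\<^esub> xp) = s \<odot>\<^bsub>P 0\<^esub> (t \<odot>\<^bsub>P 0\<^esub> p)" using s xp by (simp add: lin_smult[OF d])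
    also have "\<dots> = \<zero>\<^bsub>P 0\<^esub>" using s t p by (simp flip: P0.smult_assoc1)
    finally have "f (s \<odot>\<^bsub>P (Suc 0)\<^esub> xp) = \<zero>\<^bsub>N\<^esub>" using s xp by (intro ker) auto
    then show "s \<odot>\<^bsub>N\<^esub> f xp = \<zero>\<^bsub>N\<^esub>" using s xp by (simp add: lin_smult[OF f])
  qed (use f xp in auto)
  then obtain n where n: "n \<in> carrier N" "f xp = t \<odot>\<^bsub>N\<^esub> n" by blast
  \<comment> \<open>Every element of \<open>P 0\<close> is a multiple of p plus a boundary, in
    several ways. The extension is to send p to n and \<open>\<delta> 0 x\<close> to
    \<open>f x\<close>.\<close>
  define G where "G q y \<longleftrightarrow> (\<exists>r\<in>carrier R. \<exists>x\<in>carrier (P (Suc 0)).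
    q = r \<odot>\<^bsub>P 0\<^esub> p \<oplus>\<^bsub>P 0\<^esub> \<delta> 0 x \<and> y = r \<odot>\<^bsub>N\<^esub> n \<oplus>\<^bsub>N\<^esub> f x)" for q y
  note dc = lin_closed[OF d] and fcl = lin_closed[OF f]
  have "\<exists>g. lin R (P 0) N g \<and> (\<forall>x y. G x y \<longrightarrow> y = g x)"
  proof (rule lin_of_relation[OF D(2) N])
    fix q assume q: "q \<in> carrier (P 0)"
    obtain r where r: "r \<in> carrier R" "\<epsilon> q = r \<odot>\<^bsub>M\<^esub> e" using gen q lin_closed[OF D(4)] by blast
    have "\<epsilon> (q \<ominus>\<^bsub>P 0\<^esub> r \<odot>\<^bsub>P 0\<^esub> p) = \<zero>\<^bsub>M\<^esub>"
      using q r p e by (simp add: lin_diff[OF D(2) D(1) D(4)] lin_smult[OF D(4)] M.M.minus_eq_zero_iff)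
    then obtain x where x: "x \<in> carrier (P (Suc 0))" "q \<ominus>\<^bsub>P 0\<^esub> r \<odot>\<^bsub>P 0\<^esub> p = \<delta> 0 x"
      using im q r p by (metis P0.M.minus_closed P0.smult_closed)
    have "q = r \<odot>\<^bsub>P 0\<^esub> p \<oplus>\<^bsub>P 0\<^esub> \<delta> 0 x" unfolding x(2)[symmetric]
      using q r p by (simp add: a_minus_def P0.M.a_lcomm P0.M.r_neg)
    then show "\<exists>y. G q y" unfolding G_def using r x by blast
  next
    fix q y assume "G q y" then show "q \<in> carrier (P 0) \<and> y \<in> carrier N"
      unfolding G_def using p n dc fcl by auto
  next
    fix q y q' y' assume "G q y" "G q' y'"
    then obtain r x r' x' where *: "r \<in> carrier R" "x \<in> carrier (P (Suc 0))" "r' \<in> carrier R" "x' \<in> carrier (P (Suc 0))"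
      "q = r \<odot>\<^bsub>P 0\<^esub> p \<oplus>\<^bsub>P 0\<^esub> \<delta> 0 x" "y = r \<odot>\<^bsub>N\<^esub> n \<oplus>\<^bsub>N\<^esub> f x"
      "q' = r' \<odot>\<^bsub>P 0\<^esub> p \<oplus>\<^bsub>P 0\<^esub> \<delta> 0 x'" "y' = r' \<odot>\<^bsub>N\<^esub> n \<oplus>\<^bsub>N\<^esub> f x'"
      unfolding G_def by blast
    show "G (q \<oplus>\<^bsub>P 0\<^esub> q') (y \<oplus>\<^bsub>N\<^esub> y')"
      unfolding G_def *(5-)
      by (rule bexI[of _ "r \<oplus>\<^bsub>R\<^esub> r'"], rule bexI[of _ "x \<oplus>\<^bsub>P (Suc 0)\<^esub> x'"])
        (use * p n dc fcl in \<open>simp_all add: P0.smult_l_distr N.smult_l_distr lin_add[OF d] lin_add[OF f] P0.M.a_ac N.M.a_ac\<close>)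
  next
    fix a q y assume a: "a \<in> carrier R" and "G q y"
    then obtain r x where *: "r \<in> carrier R" "x \<in> carrier (P (Suc 0))"
      "q = r \<odot>\<^bsub>P 0\<^esub> p \<oplus>\<^bsub>P 0\<^esub> \<delta> 0 x" "y = r \<odot>\<^bsub>N\<^esub> n \<oplus>\<^bsub>N\<^esub> f x"
      unfolding G_def by blast
    show "G (a \<odot>\<^bsub>P 0\<^esub> q) (a \<odot>\<^bsub>N\<^esub> y)"
      unfolding G_def *(3-)
      by (rule bexI[of _ "a \<otimes>\<^bsub>R\<^esub> r"], rule bexI[of _ "a \<odot>\<^bsub>P (Suc 0)\<^esub> x"])
        (use a * p n dc fcl in \<open>simp_all add: P0.smult_r_distr N.smult_r_distr lin_smult[OF d] lin_smult[OF f]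
          P0.smult_assoc1 N.smult_assoc1\<close>)
  next
    fix y assume "G \<zero>\<^bsub>P 0\<^esub> y"
    then obtain r x where *: "r \<in> carrier R" "x \<in> carrier (P (Suc 0))"
      "\<zero>\<^bsub>P 0\<^esub> = r \<odot>\<^bsub>P 0\<^esub> p \<oplus>\<^bsub>P 0\<^esub> \<delta> 0 x" "y = r \<odot>\<^bsub>N\<^esub> n \<oplus>\<^bsub>N\<^esub> f x"
      unfolding G_def by blast
    have "\<epsilon> (r \<odot>\<^bsub>P 0\<^esub> p \<oplus>\<^bsub>P 0\<^esub> \<delta> 0 x) = \<zero>\<^bsub>M\<^esub>" using lin_zero[OF D(2) D(1) D(4)] *(3) by simp
    then have "r \<odot>\<^bsub>M\<^esub> e = \<zero>\<^bsub>M\<^esub>"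
      using * p dc e by (simp add: lin_add[OF D(4)] lin_smult[OF D(4)] \<epsilon>d)
    \<comment> \<open>The ambiguity arises when r p is itself a boundary. Then r = u t, and f xp = t
      n makes the two contributions to y cancel.\<close>
    then obtain u where u: "u \<in> carrier R" "r = u \<otimes>\<^bsub>R\<^esub> t" using ann * by blast
    have "r \<odot>\<^bsub>P 0\<^esub> p = \<delta> 0 (u \<odot>\<^bsub>P (Suc 0)\<^esub> xp)"
      using u t p xp by (simp add: P0.smult_assoc1 lin_smult[OF d])
    then have "\<delta> 0 (u \<odot>\<^bsub>P (Suc 0)\<^esub> xp \<oplus>\<^bsub>P (Suc 0)\<^esub> x) = \<zero>\<^bsub>P 0\<^esub>"
      using *(3) u xp * by (simp add: lin_add[OF d])
    then have "f (u \<odot>\<^bsub>P (Suc 0)\<^esub> xp \<oplus>\<^bsub>P (Suc 0)\<^esub> x) = \<zero>\<^bsub>N\<^esub>" using u xp * by (intro ker) auto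
    then show "y = \<zero>\<^bsub>N\<^esub>" using u xp * n t by (simp add: lin_add[OF f] lin_smult[OF f] N.smult_assoc1)
  qed
  then obtain g where g: "lin R (P 0) N g" "\<And>x y. G x y \<Longrightarrow> y = g x" by blast
  have "f x = g (\<delta> 0 x)" if "x \<in> carrier (P (Suc 0))" for x
    by (rule g(2)) (use that p n dc fcl in \<open>auto simp: G_def intro!: bexI[of _ "\<zero>\<^bsub>R\<^esub>"] bexI[of _ x]\<close>)
  with g show "\<exists>g. lin R (P 0) N g \<and> (\<forall>x\<in>carrier (P (Suc 0)). f x = g (\<delta> 0 x))" by blast
qed

section \<open>Direct sums, zero modules and their lifting property\<close>

definition direct_sum :: "('a, 'b) module \<Rightarrow> ('a, 'c) module \<Rightarrow> ('a, 'b \<times> 'c) module" where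
  "direct_sum M N = \<lparr>carrier = carrier M \<times> carrier N, monoid.mult = undefined, monoid.one = undefined,
     ring.zero = (\<zero>\<^bsub>M\<^esub>, \<zero>\<^bsub>N\<^esub>),
     ring.add = (\<lambda>u v. (fst u \<oplus>\<^bsub>M\<^esub> fst v, snd u \<oplus>\<^bsub>N\<^esub> snd v)),
     smult = (\<lambda>r u. (r \<odot>\<^bsub>M\<^esub> fst u, r \<odot>\<^bsub>N\<^esub> snd u))\<rparr>"

lemma direct_sum_simps [simp]:
  "carrier (direct_sum M N) = carrier M \<times> carrier N"
  "\<zero>\<^bsub>direct_sum M N\<^esub> = (\<zero>\<^bsub>M\<^esub>, \<zero>\<^bsub>N\<^esub>)"
  "u \<oplus>\<^bsub>direct_sum M N\<^esub> v = (fst u \<oplus>\<^bsub>M\<^esub> fst v, snd u \<oplus>\<^bsub>N\<^esub> snd v)"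
  "r \<odot>\<^bsub>direct_sum M N\<^esub> u = (r \<odot>\<^bsub>M\<^esub> fst u, r \<odot>\<^bsub>N\<^esub> snd u)"
  by (simp_all add: direct_sum_def)

lemma direct_sum_module:
  assumes "Module.module R M" "Module.module R N"
  shows "Module.module R (direct_sum M N)"
proof -
  interpret M: Module.module R M by fact
  interpret N: Module.module R N by fact
  show ?thesis
  proof (rule moduleI)
    show "abelian_group (direct_sum M N)"
    proof (rule abelian_groupI)
      fix x assume "x \<in> carrier (direct_sum M N)"
      then show "\<exists>y\<in>carrier (direct_sum M N). y \<oplus>\<^bsub>direct_sum M N\<^esub> x = \<zero>\<^bsub>direct_sum M N\<^esub>"
        by (intro bexI[of _ "(\<ominus>\<^bsub>M\<^esub> fst x, \<ominus>\<^bsub>N\<^esub> snd x)"]) (auto simp: M.M.l_neg N.M.l_neg)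
    qed (auto simp: M.M.a_ac N.M.a_ac)
  qed (auto simp: M.R.is_cring M.smult_l_distr N.smult_l_distr M.smult_r_distr N.smult_r_distr
      M.smult_assoc1 N.smult_assoc1)
qed

lemma lifts_direct_sum:
  assumes "Module.module R M" "Module.module R N" "Module.module R X" "Module.module R Y"
    "lifts R M X Y" "lifts R N X Y"
  shows "lifts R (direct_sum M N) X Y"
  unfolding lifts_def
proof (intro allI impI)
  interpret M: Module.module R M by fact
  interpret N: Module.module R N by fact
  interpret X: Module.module R X by fact
  interpret Y: Module.module R Y by fact
  fix \<alpha> \<beta>
  assume \<alpha>: "lin R (direct_sum M N) X \<alpha>" and \<beta>: "lin R Y X \<beta>"
    and sub: "\<alpha> ` carrier (direct_sum M N) \<subseteq> \<beta> ` carrier Y"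
  have "lin R M (direct_sum M N) (\<lambda>a. (a, \<zero>\<^bsub>N\<^esub>))" by (auto intro: linI)
  note l1 = lin_comp[OF this \<alpha>]
  have "lin R N (direct_sum M N) (\<lambda>b. (\<zero>\<^bsub>M\<^esub>, b))" by (auto intro: linI)
  note l2 = lin_comp[OF this \<alpha>]
  have "(\<lambda>a. \<alpha> (a, \<zero>\<^bsub>N\<^esub>)) ` carrier M \<subseteq> \<beta> ` carrier Y" using sub by auto
  then obtain \<gamma>1 where g1: "lin R M Y \<gamma>1" "\<And>a. a \<in> carrier M \<Longrightarrow> \<beta> (\<gamma>1 a) = \<alpha> (a, \<zero>\<^bsub>N\<^esub>)"
    using assms(5) l1 \<beta> unfolding lifts_def by meson
  have "(\<lambda>b. \<alpha> (\<zero>\<^bsub>M\<^esub>, b)) ` carrier N \<subseteq> \<beta> ` carrier Y" using sub by auto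
  then obtain \<gamma>2 where g2: "lin R N Y \<gamma>2" "\<And>b. b \<in> carrier N \<Longrightarrow> \<beta> (\<gamma>2 b) = \<alpha> (\<zero>\<^bsub>M\<^esub>, b)"
    using assms(6) l2 \<beta> unfolding lifts_def by meson
  have "lin R (direct_sum M N) M fst" "lin R (direct_sum M N) N snd" by (auto intro: linI)
  then have "lin R (direct_sum M N) Y (\<lambda>u. \<gamma>1 (fst u) \<oplus>\<^bsub>Y\<^esub> \<gamma>2 (snd u))"
    by (intro lin_plus assms lin_comp[OF _ g1(1)] lin_comp[OF _ g2(1)])
  moreover have "\<beta> (\<gamma>1 (fst u) \<oplus>\<^bsub>Y\<^esub> \<gamma>2 (snd u)) = \<alpha> u" if "u \<in> carrier (direct_sum M N)" for u
  proof -
    from that obtain a b where u: "u = (a, b)" "a \<in> carrier M" "b \<in> carrier N" by auto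
    have "\<alpha> ((a, \<zero>\<^bsub>N\<^esub>) \<oplus>\<^bsub>direct_sum M N\<^esub> (\<zero>\<^bsub>M\<^esub>, b)) = \<alpha> (a, \<zero>\<^bsub>N\<^esub>) \<oplus>\<^bsub>X\<^esub> \<alpha> (\<zero>\<^bsub>M\<^esub>, b)"
      using u by (intro lin_add[OF \<alpha>]) auto
    then show ?thesis using u g1 g2 by (simp add: lin_add[OF \<beta>])
  qed
  ultimately show "\<exists>\<gamma>. lin R (direct_sum M N) Y \<gamma> \<and> (\<forall>x\<in>carrier (direct_sum M N). \<beta> (\<gamma> x) = \<alpha> x)"
    by blast
qed

lemma zero_module:
  assumes "Module.module R M"
  shows "Module.module R (M\<lparr>carrier := {\<zero>\<^bsub>M\<^esub>}\<rparr>)"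
proof -
  interpret M: Module.module R M by fact
  show ?thesis
    by (rule moduleI, rule M.R.is_cring, rule abelian_groupI) auto
qed

lemma lifts_zero_module:
  assumes "Module.module R M" "Module.module R X" "Module.module R Y"
  shows "lifts R (M\<lparr>carrier := {\<zero>\<^bsub>M\<^esub>}\<rparr>) X Y"
  unfolding lifts_def
proof (intro allI impI)
  interpret M: Module.module R M by fact
  interpret Y: Module.module R Y by fact
  fix \<alpha> \<beta> assume \<alpha>: "lin R (M\<lparr>carrier := {\<zero>\<^bsub>M\<^esub>}\<rparr>) X \<alpha>" and \<beta>: "lin R Y X \<beta>"
  have "lin R (M\<lparr>carrier := {\<zero>\<^bsub>M\<^esub>}\<rparr>) Y (\<lambda>_. \<zero>\<^bsub>Y\<^esub>)" by (auto intro!: linI)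
  moreover have "\<alpha> \<zero>\<^bsub>M\<^esub> = \<zero>\<^bsub>X\<^esub>" using lin_zero[OF zero_module[OF assms(1)] assms(2) \<alpha>] by simp
  ultimately show "\<exists>\<gamma>. lin R (M\<lparr>carrier := {\<zero>\<^bsub>M\<^esub>}\<rparr>) Y \<gamma> \<and>
      (\<forall>x\<in>carrier (M\<lparr>carrier := {\<zero>\<^bsub>M\<^esub>}\<rparr>). \<beta> (\<gamma> x) = \<alpha> x)"
    using lin_zero[OF assms(3,2) \<beta>] by auto
qed

section \<open>The mapping cone of a scalar\<close>

text \<open>The zero module in degree 0 is carved out of \<open>P 0\<close>, so that all terms keep
  one element type.\<close>

definition shifted :: "(nat \<Rightarrow> ('a, 'c) module) \<Rightarrow> nat \<Rightarrow> ('a, 'c) module" where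
  "shifted P n = (case n of 0 \<Rightarrow> (P 0)\<lparr>carrier := {\<zero>\<^bsub>P 0\<^esub>}\<rparr> | Suc k \<Rightarrow> P k)"

definition cone :: "(nat \<Rightarrow> ('a, 'c) module) \<Rightarrow> nat \<Rightarrow> ('a, 'c \<times> 'c) module" where
  "cone P n = direct_sum (P n) (shifted P n)"

text \<open>The minus sign makes consecutive differentials compose to zero: \<delta> (x b) + x (-
  \<delta> b) = 0. For \<open>n = 0\<close> the second component lands in the zero module.\<close>

definition cone_diff :: "(nat \<Rightarrow> ('a, 'c) module) \<Rightarrow> (nat \<Rightarrow> 'c \<Rightarrow> 'c) \<Rightarrow> 'a \<Rightarrow> nat \<Rightarrow> 'c \<times> 'c \<Rightarrow> 'c \<times> 'c" where
  "cone_diff P \<delta> x n u = (\<delta> n (fst u) \<oplus>\<^bsub>P n\<^esub> x \<odot>\<^bsub>P n\<^esub> snd u,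
     case n of 0 \<Rightarrow> \<zero>\<^bsub>P 0\<^esub> | Suc k \<Rightarrow> \<ominus>\<^bsub>P k\<^esub> \<delta> k (snd u))"

lemma lin_pair:
  "lin R M N f \<Longrightarrow> lin R M L g \<Longrightarrow> lin R M (direct_sum N L) (\<lambda>u. (f u, g u))"
  by (auto simp: lin_def)

lemma shifted_Suc [simp]: "shifted P (Suc n) = P n"
  by (simp add: shifted_def)

lemma shifted_module:
  assumes "\<And>n. Module.module R (P n)"
  shows "Module.module R (shifted P n)"
  using assms zero_module[OF assms] by (auto simp: shifted_def split: nat.splits)

lemma lifts_cone:
  assumes "\<And>n. free_module R (P n)" "Module.module R X" "Module.module R Y"
  shows "lifts R (cone P n) X Y"
proof -
  have P: "Module.module R (P n)" for n using assms(1) by (rule free_module_module)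
  have "lifts R (shifted P n) X Y"
    using free_module_lifts[OF assms(1-3)] lifts_zero_module[OF P assms(2,3)]
    by (auto simp: shifted_def split: nat.splits)
  then show ?thesis unfolding cone_def
    by (rule lifts_direct_sum[OF P shifted_module[OF P] assms(2,3) free_module_lifts[OF assms]])
qed

text \<open>The cone of multiplication by x has homology in degree 0 alone because x is injective on
  \<open>M\<close>; there it is M / x M, which \<pi> identifies with \<open>M'\<close>.\<close>

lemma cone_resolution:
  assumes P: "resolution R M P \<delta> \<epsilon>" and M': "Module.module R M'" and x: "x \<in> carrier R"
    and nzd: "\<And>m. m \<in> carrier M \<Longrightarrow> x \<odot>\<^bsub>M\<^esub> m = \<zero>\<^bsub>M\<^esub> \<Longrightarrow> m = \<zero>\<^bsub>M\<^esub>"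
    and \<pi>: "lin R M M' \<pi>" and surj: "\<pi> ` carrier M = carrier M'"
    and ker: "\<And>m. m \<in> carrier M \<Longrightarrow> \<pi> m = \<zero>\<^bsub>M'\<^esub> \<longleftrightarrow> (\<exists>m'\<in>carrier M. m = x \<odot>\<^bsub>M\<^esub> m')"
  shows "resolution R M' (cone P) (cone_diff P \<delta> x) (\<lambda>u. \<pi> (\<epsilon> (fst u)))"
proof -
  note D = resolutionD[OF P]
  interpret M: Module.module R M by (rule D)
  interpret M': Module.module R M' by fact
  note \<delta>c = lin_closed[OF D(3)] and \<epsilon>c = lin_closed[OF D(4)]
  have mS: "Module.module R (shifted P n)" for n by (rule shifted_module[OF D(2)])
  have mC: "Module.module R (cone P n)" for n unfolding cone_def by (rule direct_sum_module[OF D(2) mS])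
  have syz_im: "z \<in> syz M P \<delta> \<epsilon> n \<longleftrightarrow> (\<exists>y\<in>carrier (P (Suc n)). z = \<delta> n y)" for z n
    unfolding D(6)[symmetric] by (simp add: image_iff)
  have \<delta>\<delta>: "\<delta> n (\<delta> (Suc n) y) = \<zero>\<^bsub>P n\<^esub>" if "y \<in> carrier (P (Suc (Suc n)))" for n y
    using that syz_im[of "\<delta> (Suc n) y" "Suc n"] by (auto simp: syz_Suc)
  have \<epsilon>\<delta>: "\<epsilon> (\<delta> 0 y) = \<zero>\<^bsub>M\<^esub>" if "y \<in> carrier (P (Suc 0))" for y
    using that syz_im[of "\<delta> 0 y" 0] by (auto simp: syz_0)
  have linC: "lin R (cone P (Suc n)) (cone P n) (cone_diff P \<delta> x n)" for n
  proof -
    have fst: "lin R (cone P (Suc n)) (P (Suc n)) fst" and snd: "lin R (cone P (Suc n)) (P n) snd"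
      by (auto intro!: linI simp: cone_def)
    have "lin R (cone P (Suc n)) (P n) (\<lambda>u. \<delta> n (fst u) \<oplus>\<^bsub>P n\<^esub> x \<odot>\<^bsub>P n\<^esub> snd u)"
      by (rule lin_plus[OF D(2) lin_comp[OF fst D(3)] lin_scale[OF D(2) snd x]])
    moreover have "lin R (cone P (Suc n)) (shifted P n) (\<lambda>u. case n of 0 \<Rightarrow> \<zero>\<^bsub>P 0\<^esub> | Suc k \<Rightarrow> \<ominus>\<^bsub>P k\<^esub> \<delta> k (snd u))"
    proof (cases n)
      case 0
      interpret P0: Module.module R "P 0" by (rule D)
      show ?thesis unfolding 0 shifted_def by (auto intro!: linI)
    next
      case (Suc k)
      have "lin R (cone P (Suc n)) (P (Suc k)) snd" using snd Suc by simp
      from lin_uminus[OF D(2) lin_comp[OF this D(3)]] show ?thesis by (simp add: Suc)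
    qed
    ultimately show ?thesis unfolding cone_def[of P n] cone_diff_def by (rule lin_pair)
  qed
  have l\<epsilon>: "lin R (cone P 0) M' (\<lambda>u. \<pi> (\<epsilon> (fst u)))"
  proof -
    have "lin R (cone P 0) (P 0) fst" by (auto intro!: linI simp: cone_def)
    then show ?thesis by (intro lin_comp[OF _ \<pi>] lin_comp[OF _ D(4)])
  qed
  have surj': "(\<lambda>u. \<pi> (\<epsilon> (fst u))) ` carrier (cone P 0) = carrier M'"
  proof -
    have "(\<lambda>u. \<pi> (\<epsilon> (fst u))) ` carrier (cone P 0) = \<pi> ` \<epsilon> ` (fst ` carrier (cone P 0))"
      by (simp add: image_image)
    also have "fst ` carrier (cone P 0) = carrier (P 0)" by (simp add: cone_def shifted_def)
    finally show ?thesis using surj D(5) by simp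
  qed
  have ex0: "cone_diff P \<delta> x 0 ` carrier (cone P 1) = {u \<in> carrier (cone P 0). \<pi> (\<epsilon> (fst u)) = \<zero>\<^bsub>M'\<^esub>}"
  proof (intro equalityI subsetI)
    interpret P0: Module.module R "P 0" by (rule D)
    fix u assume "u \<in> cone_diff P \<delta> x 0 ` carrier (cone P 1)"
    then obtain a b where u: "u = cone_diff P \<delta> x 0 (a, b)" "a \<in> carrier (P (Suc 0))" "b \<in> carrier (P 0)"
      by (auto simp: cone_def)
    have "\<epsilon> (fst u) = x \<odot>\<^bsub>M\<^esub> \<epsilon> b"
      using u x \<delta>c[OF u(2)] \<epsilon>c by (simp add: cone_diff_def lin_add[OF D(4)] lin_smult[OF D(4)] \<epsilon>\<delta>)
    then have "\<pi> (\<epsilon> (fst u)) = \<zero>\<^bsub>M'\<^esub>" using ker[of "\<epsilon> (fst u)"] x \<epsilon>c[OF u(3)] by auto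
    moreover have "u \<in> carrier (cone P 0)" using u x \<delta>c[OF u(2)] by (simp add: cone_diff_def cone_def shifted_def)
    ultimately show "u \<in> {u \<in> carrier (cone P 0). \<pi> (\<epsilon> (fst u)) = \<zero>\<^bsub>M'\<^esub>}" by simp
  next
    interpret P0: Module.module R "P 0" by (rule D)
    fix u assume u: "u \<in> {u \<in> carrier (cone P 0). \<pi> (\<epsilon> (fst u)) = \<zero>\<^bsub>M'\<^esub>}"
    then obtain a where a: "u = (a, \<zero>\<^bsub>P 0\<^esub>)" "a \<in> carrier (P 0)" by (auto simp: cone_def shifted_def)
    then obtain m where m: "m \<in> carrier M" "\<epsilon> a = x \<odot>\<^bsub>M\<^esub> m" using u ker[of "\<epsilon> a"] \<epsilon>c[of a] by auto
    obtain b where b: "b \<in> carrier (P 0)" "\<epsilon> b = m" using m(1) unfolding D(5)[symmetric] by blast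
    have "\<epsilon> (a \<ominus>\<^bsub>P 0\<^esub> x \<odot>\<^bsub>P 0\<^esub> b) = \<epsilon> a \<ominus>\<^bsub>M\<^esub> \<epsilon> (x \<odot>\<^bsub>P 0\<^esub> b)"
      using a b x by (intro lin_diff[OF D(2) D(1) D(4)]) auto
    also have "\<dots> = \<zero>\<^bsub>M\<^esub>" using m b x by (simp add: lin_smult[OF D(4)] M.M.minus_eq_zero_iff)
    finally obtain y where y: "y \<in> carrier (P (Suc 0))" "a \<ominus>\<^bsub>P 0\<^esub> x \<odot>\<^bsub>P 0\<^esub> b = \<delta> 0 y"
      using syz_im[of "a \<ominus>\<^bsub>P 0\<^esub> x \<odot>\<^bsub>P 0\<^esub> b" 0] a b x P0.M.minus_closed by (auto simp: syz_0)
    have "a = \<delta> 0 y \<oplus>\<^bsub>P 0\<^esub> x \<odot>\<^bsub>P 0\<^esub> b" unfolding y(2)[symmetric]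
      using a b x by (simp add: a_minus_def P0.M.a_assoc P0.M.l_neg)
    then have "u = cone_diff P \<delta> x 0 (y, b)" using a by (simp add: cone_diff_def)
    then show "u \<in> cone_diff P \<delta> x 0 ` carrier (cone P 1)" using y b by (simp add: cone_def)
  qed
  have exS: "cone_diff P \<delta> x (Suc n) ` carrier (cone P (Suc (Suc n))) =
      {u \<in> carrier (cone P (Suc n)). cone_diff P \<delta> x n u = \<zero>\<^bsub>cone P n\<^esub>}" for n
  proof (intro equalityI subsetI)
    interpret Pn: Module.module R "P n" by (rule D)
    interpret PS: Module.module R "P (Suc n)" by (rule D)
    fix u assume "u \<in> cone_diff P \<delta> x (Suc n) ` carrier (cone P (Suc (Suc n)))"
    then obtain a b where u: "u = cone_diff P \<delta> x (Suc n) (a, b)" "a \<in> carrier (P (Suc (Suc n)))" "b \<in> carrier (P (Suc n))"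
      by (auto simp: cone_def)
    have u': "u = (\<delta> (Suc n) a \<oplus>\<^bsub>P (Suc n)\<^esub> x \<odot>\<^bsub>P (Suc n)\<^esub> b, \<ominus>\<^bsub>P n\<^esub> \<delta> n b)"
      using u(1) by (simp add: cone_diff_def)
    have c: "\<delta> (Suc n) a \<in> carrier (P (Suc n))" "\<delta> n b \<in> carrier (P n)"
      using \<delta>c u by auto
    have "\<delta> n (\<delta> (Suc n) a \<oplus>\<^bsub>P (Suc n)\<^esub> x \<odot>\<^bsub>P (Suc n)\<^esub> b) \<oplus>\<^bsub>P n\<^esub> x \<odot>\<^bsub>P n\<^esub> (\<ominus>\<^bsub>P n\<^esub> \<delta> n b) = \<zero>\<^bsub>P n\<^esub>"
      using u(2,3) x c by (simp add: lin_add[OF D(3)] lin_smult[OF D(3)] \<delta>\<delta> Pn.smult_r_minus Pn.M.r_neg)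
    moreover have "\<ominus>\<^bsub>P k\<^esub> \<delta> k (\<ominus>\<^bsub>P n\<^esub> \<delta> n b) = \<zero>\<^bsub>P k\<^esub>" if "n = Suc k" for k
    proof -
      interpret Pk: Module.module R "P k" by (rule D)
      have "lin R (P n) (P k) (\<delta> k)" using D(3) that by simp
      then show ?thesis using \<delta>\<delta>[of b k] u(3) c that
        by (simp add: lin_minus[OF D(2) D(2)])
    qed
    ultimately have "cone_diff P \<delta> x n u = \<zero>\<^bsub>cone P n\<^esub>"
      by (auto simp: u' cone_diff_def cone_def shifted_def split: nat.splits)
    moreover have "u \<in> carrier (cone P (Suc n))" using u' c x u(3) by (simp add: cone_def)
    ultimately show "u \<in> {u \<in> carrier (cone P (Suc n)). cone_diff P \<delta> x n u = \<zero>\<^bsub>cone P n\<^esub>}" by simp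
  next
    interpret Pn: Module.module R "P n" by (rule D)
    interpret PS: Module.module R "P (Suc n)" by (rule D)
    fix u assume "u \<in> {u \<in> carrier (cone P (Suc n)). cone_diff P \<delta> x n u = \<zero>\<^bsub>cone P n\<^esub>}"
    then obtain a b where u: "u = (a, b)" "a \<in> carrier (P (Suc n))" "b \<in> carrier (P n)"
      "cone_diff P \<delta> x n (a, b) = \<zero>\<^bsub>cone P n\<^esub>"
      by (auto simp: cone_def)
    have e1: "\<delta> n a \<oplus>\<^bsub>P n\<^esub> x \<odot>\<^bsub>P n\<^esub> b = \<zero>\<^bsub>P n\<^esub>"
      using u(4) by (simp add: cone_diff_def cone_def)
    \<comment> \<open>In degree 0 this is where regularity of x on \<open>M\<close> enters; in
      higher degrees the second component of the cone differential says directly that b is a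
      cycle.\<close>
    have "b \<in> syz M P \<delta> \<epsilon> n"
    proof (cases n)
      case 0
      have "\<epsilon> (\<delta> n a \<oplus>\<^bsub>P n\<^esub> x \<odot>\<^bsub>P n\<^esub> b) = \<zero>\<^bsub>M\<^esub>" unfolding e1 using 0 lin_zero[OF D(2) D(1) D(4)] by simp
      then have "x \<odot>\<^bsub>M\<^esub> \<epsilon> b = \<zero>\<^bsub>M\<^esub>"
        using 0 u x \<delta>c[of a 0] \<epsilon>c[of b] Pn.smult_closed[OF x u(3)]
        by (simp add: lin_add[OF D(4)] lin_smult[OF D(4)] \<epsilon>\<delta>)
      then show ?thesis using 0 u nzd \<epsilon>c[of b] by (auto simp: syz_0)
    next
      case (Suc k)
      interpret Pk: Module.module R "P k" by (rule D)
      have "\<ominus>\<^bsub>P k\<^esub> \<delta> k b = \<zero>\<^bsub>P k\<^esub>" using u(4) Suc by (simp add: cone_diff_def cone_def)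
      moreover have "\<delta> k b \<in> carrier (P k)" using \<delta>c[of b k] u(3) Suc by simp
      ultimately show ?thesis using Suc u(3) by (simp add: syz_Suc)
    qed
    then obtain b' where b': "b' \<in> carrier (P (Suc n))" "b = \<delta> n b'" using syz_im by blast
    have "\<delta> n (a \<oplus>\<^bsub>P (Suc n)\<^esub> x \<odot>\<^bsub>P (Suc n)\<^esub> b') = \<zero>\<^bsub>P n\<^esub>"
      using u b' x e1 by (simp add: lin_add[OF D(3)] lin_smult[OF D(3)])
    then have "a \<oplus>\<^bsub>P (Suc n)\<^esub> x \<odot>\<^bsub>P (Suc n)\<^esub> b' \<in> syz M P \<delta> \<epsilon> (Suc n)" using u b' x by (simp add: syz_Suc)
    then obtain a' where a': "a' \<in> carrier (P (Suc (Suc n)))"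
        "a \<oplus>\<^bsub>P (Suc n)\<^esub> x \<odot>\<^bsub>P (Suc n)\<^esub> b' = \<delta> (Suc n) a'" using syz_im by blast
    have "a = \<delta> (Suc n) a' \<oplus>\<^bsub>P (Suc n)\<^esub> x \<odot>\<^bsub>P (Suc n)\<^esub> (\<ominus>\<^bsub>P (Suc n)\<^esub> b')" unfolding a'(2)[symmetric]
      using u b' x by (simp add: PS.smult_r_minus PS.M.a_assoc PS.M.r_neg)
    moreover have "b = \<ominus>\<^bsub>P n\<^esub> \<delta> n (\<ominus>\<^bsub>P (Suc n)\<^esub> b')"
      using b' u(3) by (simp add: lin_minus[OF D(2) D(2) D(3)])
    ultimately have "u = cone_diff P \<delta> x (Suc n) (a', \<ominus>\<^bsub>P (Suc n)\<^esub> b')" using u(1) by (simp add: cone_diff_def)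
    then show "u \<in> cone_diff P \<delta> x (Suc n) ` carrier (cone P (Suc (Suc n)))"
      using a' b' by (simp add: cone_def)
  qed
  show ?thesis unfolding resolution_def using M' mC linC l\<epsilon> surj' ex0 exS by auto
qed

text \<open>A cocycle of the cone is a pair \<open>(f, g)\<close> with \<open>f \<delta> = 0\<close> and \<open>x f = g \<delta>\<close>. Modulo \<open>x\<close> the second
  component is a cocycle of \<open>P\<close>, so \<open>g = u \<delta> + x v\<close>; cancelling \<open>x\<close> gives \<open>f = v \<delta>\<close>, and \<open>(f, g)\<close> is the
  coboundary of \<open>(v, - u)\<close>.\<close>

lemma cone_vanishes:
  assumes P: "resolution R M P \<delta> \<epsilon>" and free: "\<And>n. free_module R (P n)"
    and L: "Module.module R L" and L': "Module.module R L'" and x: "x \<in> carrier R"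
    and nzd: "\<And>l. l \<in> carrier L \<Longrightarrow> x \<odot>\<^bsub>L\<^esub> l = \<zero>\<^bsub>L\<^esub> \<Longrightarrow> l = \<zero>\<^bsub>L\<^esub>"
    and \<rho>: "lin R L L' \<rho>" and surj: "\<rho> ` carrier L = carrier L'"
    and ker: "\<And>l. l \<in> carrier L \<Longrightarrow> \<rho> l = \<zero>\<^bsub>L'\<^esub> \<longleftrightarrow> (\<exists>l'\<in>carrier L. l = x \<odot>\<^bsub>L\<^esub> l')"
    and van: "vanishes R P \<delta> L' n"
  shows "vanishes R (cone P) (cone_diff P \<delta> x) L (Suc n)"
  unfolding vanishes_def
proof (intro allI impI)
  note D = resolutionD[OF P]
  interpret L: Module.module R L by fact
  interpret L': Module.module R L' by fact
  fix F assume F: "lin R (cone P (Suc (Suc n))) L F"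
    and Fc: "\<forall>u\<in>carrier (cone P (Suc (Suc (Suc n)))). F (cone_diff P \<delta> x (Suc (Suc n)) u) = \<zero>\<^bsub>L\<^esub>"
  let ?P0 = "P n" and ?P1 = "P (Suc n)" and ?P2 = "P (Suc (Suc n))" and ?P3 = "P (Suc (Suc (Suc n)))"
  interpret P0: Module.module R ?P0 by (rule D)
  interpret P1: Module.module R ?P1 by (rule D)
  interpret P2: Module.module R ?P2 by (rule D)
  interpret P3: Module.module R ?P3 by (rule D)
  note \<delta>c = lin_closed[OF D(3)]
  have \<delta>\<delta>: "\<delta> n (\<delta> (Suc n) y) = \<zero>\<^bsub>P n\<^esub>" if "y \<in> carrier ?P2" for y
    using that D(6)[of "Suc n"] syz_Suc[of "\<delta> (Suc n) y"] by blast
  \<comment> \<open>Index shift: in cone degree n + 2 the components live on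
    \<open>P (n + 2)\<close> and \<open>P (n + 1)\<close>, so g modulo x is a cocycle in the degree
    that \<open>van\<close> speaks about.\<close>
  define f where "f a = F (a, \<zero>\<^bsub>?P1\<^esub>)" for a
  define g where "g b = F (\<zero>\<^bsub>?P2\<^esub>, b)" for b
  have "lin R ?P2 (cone P (Suc (Suc n))) (\<lambda>a. (a, \<zero>\<^bsub>?P1\<^esub>))" by (auto intro: linI simp: cone_def)
  then have f: "lin R ?P2 L f" unfolding f_def by (rule lin_comp[OF _ F])
  have "lin R ?P1 (cone P (Suc (Suc n))) (\<lambda>b. (\<zero>\<^bsub>?P2\<^esub>, b))" by (auto intro: linI simp: cone_def)
  then have g: "lin R ?P1 L g" unfolding g_def by (rule lin_comp[OF _ F])
  have Fab: "F (a, b) = f a \<oplus>\<^bsub>L\<^esub> g b" if "a \<in> carrier ?P2" "b \<in> carrier ?P1" for a b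
  proof -
    have "F ((a, \<zero>\<^bsub>?P1\<^esub>) \<oplus>\<^bsub>cone P (Suc (Suc n))\<^esub> (\<zero>\<^bsub>?P2\<^esub>, b)) = f a \<oplus>\<^bsub>L\<^esub> g b"
      unfolding f_def g_def by (rule lin_add[OF F]) (use that in \<open>auto simp: cone_def\<close>)
    then show ?thesis using that by (simp add: cone_def)
  qed
  have xf: "x \<odot>\<^bsub>L\<^esub> f b = g (\<delta> (Suc n) b)" if b: "b \<in> carrier ?P2" for b
  proof -
    have \<delta>0: "\<delta> (Suc (Suc n)) \<zero>\<^bsub>?P3\<^esub> = \<zero>\<^bsub>?P2\<^esub>" by (rule lin_zero[OF D(2) D(2) D(3)])
    have "F (cone_diff P \<delta> x (Suc (Suc n)) (\<zero>\<^bsub>?P3\<^esub>, b)) = \<zero>\<^bsub>L\<^esub>"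
      using Fc b by (auto simp: cone_def)
    then have "f (x \<odot>\<^bsub>?P2\<^esub> b) \<oplus>\<^bsub>L\<^esub> g (\<ominus>\<^bsub>?P1\<^esub> \<delta> (Suc n) b) = \<zero>\<^bsub>L\<^esub>"
      using b x \<delta>c[OF b] by (simp add: cone_diff_def Fab \<delta>0)
    then have "x \<odot>\<^bsub>L\<^esub> f b \<ominus>\<^bsub>L\<^esub> g (\<delta> (Suc n) b) = \<zero>\<^bsub>L\<^esub>"
      using b x \<delta>c[OF b] by (simp add: lin_smult[OF f] lin_minus[OF D(2) L g] a_minus_def)
    then show ?thesis using L.M.minus_eq_zero_iff x lin_closed[OF f b] lin_closed[OF g \<delta>c[OF b]] by simp
  qed
  have "lin R ?P1 L' (\<lambda>b. \<rho> (g b))" by (rule lin_comp[OF g \<rho>])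
  moreover have "\<rho> (g (\<delta> (Suc n) b)) = \<zero>\<^bsub>L'\<^esub>" if "b \<in> carrier ?P2" for b
    using ker[OF lin_closed[OF g \<delta>c[OF that]]] lin_closed[OF f that] xf[OF that, symmetric] by blast
  ultimately obtain u' where u': "lin R ?P0 L' u'" "\<And>b. b \<in> carrier ?P1 \<Longrightarrow> \<rho> (g b) = u' (\<delta> n b)"
    using van unfolding vanishes_def by blast
  \<comment> \<open>Freeness of \<open>P n\<close> lifts \<open>u'\<close> from \<open>L'\<close> to
    \<open>L\<close>. Then g - u \<delta> takes values in x L, and freeness of
    \<open>P (n + 1)\<close> divides it by x.\<close>
  have "u' ` carrier ?P0 \<subseteq> \<rho> ` carrier L" using surj lin_closed[OF u'(1)] by blast
  then obtain u where u: "lin R ?P0 L u" "\<And>b. b \<in> carrier ?P0 \<Longrightarrow> \<rho> (u b) = u' b"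
    using free_module_lift[OF free L' L u'(1) \<rho>] by blast
  have gl: "lin R ?P1 L (\<lambda>b. g b \<ominus>\<^bsub>L\<^esub> u (\<delta> n b))" by (rule lin_sub[OF L g lin_comp[OF D(3) u(1)]])
  have xl: "lin R L L (\<lambda>l. x \<odot>\<^bsub>L\<^esub> l)" by (rule lin_scale[OF L lin_id x])
  have "(\<lambda>b. g b \<ominus>\<^bsub>L\<^esub> u (\<delta> n b)) ` carrier ?P1 \<subseteq> (\<lambda>l. x \<odot>\<^bsub>L\<^esub> l) ` carrier L"
  proof safe
    fix b assume b: "b \<in> carrier ?P1"
    have "\<rho> (g b \<ominus>\<^bsub>L\<^esub> u (\<delta> n b)) = \<rho> (g b) \<ominus>\<^bsub>L'\<^esub> \<rho> (u (\<delta> n b))"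
      by (rule lin_diff[OF L L' \<rho> lin_closed[OF g b] lin_closed[OF u(1) \<delta>c[OF b]]])
    also have "\<dots> = \<zero>\<^bsub>L'\<^esub>" using u(2)[OF \<delta>c[OF b]] u'(2)[OF b] lin_closed[OF u'(1) \<delta>c[OF b]]
      by (simp add: L'.M.minus_eq_zero_iff)
    finally show "g b \<ominus>\<^bsub>L\<^esub> u (\<delta> n b) \<in> (\<lambda>l. x \<odot>\<^bsub>L\<^esub> l) ` carrier L"
      using ker[OF lin_closed[OF gl b]] by blast
  qed
  then obtain v where v: "lin R ?P1 L v" "\<And>b. b \<in> carrier ?P1 \<Longrightarrow> x \<odot>\<^bsub>L\<^esub> v b = g b \<ominus>\<^bsub>L\<^esub> u (\<delta> n b)"
    using free_module_lift[OF free L L gl xl] by blast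
  have gv: "g b = x \<odot>\<^bsub>L\<^esub> v b \<oplus>\<^bsub>L\<^esub> u (\<delta> n b)" if b: "b \<in> carrier ?P1" for b
    unfolding v(2)[OF b] using lin_closed[OF g b] lin_closed[OF u(1) \<delta>c[OF b]]
    by (simp add: a_minus_def L.M.a_assoc L.M.l_neg)
  have fv: "f a = v (\<delta> (Suc n) a)" if a: "a \<in> carrier ?P2" for a
  proof -
    have c: "f a \<in> carrier L" "v (\<delta> (Suc n) a) \<in> carrier L"
      by (rule lin_closed[OF f a], rule lin_closed[OF v(1) \<delta>c[OF a]])
    have "x \<odot>\<^bsub>L\<^esub> f a = x \<odot>\<^bsub>L\<^esub> v (\<delta> (Suc n) a)"
      unfolding xf[OF a] gv[OF \<delta>c[OF a]] \<delta>\<delta>[OF a] lin_zero[OF D(2) L u(1)] using c x by simp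
    then have "x \<odot>\<^bsub>L\<^esub> (f a \<ominus>\<^bsub>L\<^esub> v (\<delta> (Suc n) a)) = \<zero>\<^bsub>L\<^esub>"
      using c x by (simp add: a_minus_def L.smult_r_distr L.smult_r_minus L.M.r_neg)
    then have "f a \<ominus>\<^bsub>L\<^esub> v (\<delta> (Suc n) a) = \<zero>\<^bsub>L\<^esub>" by (rule nzd[rotated]) (use c in simp)
    then show ?thesis using c by (simp add: L.M.minus_eq_zero_iff)
  qed
  define G where "G w = v (fst w) \<ominus>\<^bsub>L\<^esub> u (snd w)" for w
  have "lin R (cone P (Suc n)) ?P1 fst" "lin R (cone P (Suc n)) ?P0 snd" by (auto intro: linI simp: cone_def)
  then have "lin R (cone P (Suc n)) L G" unfolding G_def
    by (intro lin_sub L lin_comp[OF _ v(1)] lin_comp[OF _ u(1)])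
  moreover have "F w = G (cone_diff P \<delta> x (Suc n) w)" if w': "w \<in> carrier (cone P (Suc (Suc n)))" for w
  proof -
    obtain a b where w: "w = (a, b)" "a \<in> carrier ?P2" "b \<in> carrier ?P1" using w' by (auto simp: cone_def)
    have c: "v (\<delta> (Suc n) a) \<in> carrier L" "v b \<in> carrier L" "u (\<delta> n b) \<in> carrier L"
      using lin_closed[OF v(1) \<delta>c[OF w(2)]] lin_closed[OF v(1) w(3)] lin_closed[OF u(1) \<delta>c[OF w(3)]] by auto
    show ?thesis
      using w c x \<delta>c[OF w(2)] \<delta>c[OF w(3)]
      by (simp add: G_def cone_diff_def Fab fv gv lin_add[OF v(1)] lin_smult[OF v(1)] lin_minus[OF D(2) L u(1)]
          a_minus_def L.M.a_assoc)
  qed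
  ultimately show "\<exists>G. lin R (cone P (Suc n)) L G \<and> (\<forall>w\<in>carrier (cone P (Suc (Suc n))). F w = G (cone_diff P \<delta> x (Suc n) w))"
    by blast
qed

section \<open>Existence of free resolutions\<close>

text \<open>The module axioms pass along a surjection compatible with the operations. Quotients and
  encoded copies, which are mere records beforehand, become modules this way.\<close>

lemma module_image:
  assumes M: "Module.module R M" and f: "lin R M N f" and surj: "f ` carrier M = carrier N"
    and zero: "\<zero>\<^bsub>N\<^esub> = f \<zero>\<^bsub>M\<^esub>"
  shows "Module.module R N"
proof -
  interpret M: Module.module R M by fact
  have ex: "\<exists>m\<in>carrier M. x = f m" if "x \<in> carrier N" for x using that surj by auto
  note fl = lin_add[OF f, symmetric] lin_smult[OF f, symmetric]
  show ?thesis
  proof (rule moduleI)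
    show "abelian_group N"
    proof (rule abelian_groupI)
      fix x y assume "x \<in> carrier N" "y \<in> carrier N"
      then obtain a b where "a \<in> carrier M" "x = f a" "b \<in> carrier M" "y = f b" using ex by metis
      then show "x \<oplus>\<^bsub>N\<^esub> y \<in> carrier N" "x \<oplus>\<^bsub>N\<^esub> y = y \<oplus>\<^bsub>N\<^esub> x"
        using lin_closed[OF f] by (auto simp: fl M.M.a_comm)
    next
      fix x y z assume "x \<in> carrier N" "y \<in> carrier N" "z \<in> carrier N"
      then obtain a b c where "a \<in> carrier M" "x = f a" "b \<in> carrier M" "y = f b" "c \<in> carrier M" "z = f c"
        using ex by metis
      then show "x \<oplus>\<^bsub>N\<^esub> y \<oplus>\<^bsub>N\<^esub> z = x \<oplus>\<^bsub>N\<^esub> (y \<oplus>\<^bsub>N\<^esub> z)" by (simp add: fl M.M.a_assoc)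
    next
      show "\<zero>\<^bsub>N\<^esub> \<in> carrier N" using zero lin_closed[OF f] by simp
    next
      fix x assume "x \<in> carrier N"
      then obtain a where a: "a \<in> carrier M" "x = f a" using ex by metis
      then show "\<zero>\<^bsub>N\<^esub> \<oplus>\<^bsub>N\<^esub> x = x" by (simp add: fl zero)
      show "\<exists>y\<in>carrier N. y \<oplus>\<^bsub>N\<^esub> x = \<zero>\<^bsub>N\<^esub>"
        using a lin_closed[OF f] by (intro bexI[of _ "f (\<ominus>\<^bsub>M\<^esub> a)"]) (simp_all add: fl zero M.M.l_neg)
    qed
  next
    fix a x assume a: "a \<in> carrier R" and "x \<in> carrier N"
    then obtain m where m: "m \<in> carrier M" "x = f m" using ex by metis
    then show "a \<odot>\<^bsub>N\<^esub> x \<in> carrier N" using a lin_closed[OF f] by (simp add: fl)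
  next
    fix a b x assume "a \<in> carrier R" "b \<in> carrier R" "x \<in> carrier N"
    moreover from this obtain m where "m \<in> carrier M" "x = f m" using ex by metis
    ultimately show "(a \<oplus>\<^bsub>R\<^esub> b) \<odot>\<^bsub>N\<^esub> x = a \<odot>\<^bsub>N\<^esub> x \<oplus>\<^bsub>N\<^esub> b \<odot>\<^bsub>N\<^esub> x"
      "(a \<otimes>\<^bsub>R\<^esub> b) \<odot>\<^bsub>N\<^esub> x = a \<odot>\<^bsub>N\<^esub> (b \<odot>\<^bsub>N\<^esub> x)"
      by (simp_all add: fl M.smult_l_distr M.smult_assoc1)
  next
    fix a x y assume a: "a \<in> carrier R" and "x \<in> carrier N" "y \<in> carrier N"
    moreover from this obtain m k where "m \<in> carrier M" "x = f m" "k \<in> carrier M" "y = f k" using ex by metis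
    ultimately show "a \<odot>\<^bsub>N\<^esub> (x \<oplus>\<^bsub>N\<^esub> y) = a \<odot>\<^bsub>N\<^esub> x \<oplus>\<^bsub>N\<^esub> a \<odot>\<^bsub>N\<^esub> y"
      by (simp add: fl M.smult_r_distr)
  next
    fix x assume "x \<in> carrier N"
    then obtain m where "m \<in> carrier M" "x = f m" using ex by metis
    then show "\<one>\<^bsub>R\<^esub> \<odot>\<^bsub>N\<^esub> x = x" by (simp add: fl)
  qed (rule M.R.is_cring)
qed

section \<open>Free modules on a set of generators\<close>

definition finsupp :: "('a, 'm) ring_scheme \<Rightarrow> 'e set \<Rightarrow> ('e \<Rightarrow> 'a) set" where
  "finsupp R X = {c. (\<forall>x. c x \<in> carrier R) \<and> (\<forall>x. x \<notin> X \<longrightarrow> c x = \<zero>\<^bsub>R\<^esub>) \<and> finite {x. c x \<noteq> \<zero>\<^bsub>R\<^esub>}}"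

definition finsupp_module :: "('a, 'm) ring_scheme \<Rightarrow> 'e set \<Rightarrow> ('a, 'e \<Rightarrow> 'a) module" where
  "finsupp_module R X = \<lparr>carrier = finsupp R X, monoid.mult = undefined, monoid.one = undefined,
     ring.zero = (\<lambda>_. \<zero>\<^bsub>R\<^esub>), ring.add = (\<lambda>c c' x. c x \<oplus>\<^bsub>R\<^esub> c' x),
     smult = (\<lambda>a c x. a \<otimes>\<^bsub>R\<^esub> c x)\<rparr>"

lemma finsupp_closed:
  assumes "cring R"
  shows "(\<lambda>_. \<zero>\<^bsub>R\<^esub>) \<in> finsupp R X"
    and "c \<in> finsupp R X \<Longrightarrow> c' \<in> finsupp R X \<Longrightarrow> (\<lambda>x. c x \<oplus>\<^bsub>R\<^esub> c' x) \<in> finsupp R X"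
    and "c \<in> finsupp R X \<Longrightarrow> a \<in> carrier R \<Longrightarrow> (\<lambda>x. a \<otimes>\<^bsub>R\<^esub> c x) \<in> finsupp R X"
    and "c \<in> finsupp R X \<Longrightarrow> (\<lambda>x. \<ominus>\<^bsub>R\<^esub> c x) \<in> finsupp R X"
    and "x \<in> X \<Longrightarrow> (\<lambda>y. if y = x then \<one>\<^bsub>R\<^esub> else \<zero>\<^bsub>R\<^esub>) \<in> finsupp R X"
proof -
  interpret cring R by fact
  show "(\<lambda>_. \<zero>\<^bsub>R\<^esub>) \<in> finsupp R X" by (simp add: finsupp_def)
  show "(\<lambda>x. c x \<oplus>\<^bsub>R\<^esub> c' x) \<in> finsupp R X" if "c \<in> finsupp R X" "c' \<in> finsupp R X"
  proof -
    have "{x. c x \<oplus>\<^bsub>R\<^esub> c' x \<noteq> \<zero>\<^bsub>R\<^esub>} \<subseteq> {x. c x \<noteq> \<zero>\<^bsub>R\<^esub>} \<union> {x. c' x \<noteq> \<zero>\<^bsub>R\<^esub>}" by auto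
    from finite_subset[OF this] show ?thesis using that by (auto simp: finsupp_def)
  qed
  show "(\<lambda>x. a \<otimes>\<^bsub>R\<^esub> c x) \<in> finsupp R X" if "c \<in> finsupp R X" "a \<in> carrier R"
  proof -
    have "{x. a \<otimes>\<^bsub>R\<^esub> c x \<noteq> \<zero>\<^bsub>R\<^esub>} \<subseteq> {x. c x \<noteq> \<zero>\<^bsub>R\<^esub>}" using that by auto
    from finite_subset[OF this] show ?thesis using that by (auto simp: finsupp_def)
  qed
  show "(\<lambda>x. \<ominus>\<^bsub>R\<^esub> c x) \<in> finsupp R X" if "c \<in> finsupp R X"
  proof -
    have "{x. \<ominus>\<^bsub>R\<^esub> c x \<noteq> \<zero>\<^bsub>R\<^esub>} \<subseteq> {x. c x \<noteq> \<zero>\<^bsub>R\<^esub>}" by auto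
    from finite_subset[OF this] show ?thesis using that by (auto simp: finsupp_def)
  qed
  show "(\<lambda>y. if y = x then \<one>\<^bsub>R\<^esub> else \<zero>\<^bsub>R\<^esub>) \<in> finsupp R X" if "x \<in> X"
    using that by (auto simp: finsupp_def intro: finite_subset[of _ "{x}"])
qed

lemma finsupp_module_module:
  assumes "cring R"
  shows "Module.module R (finsupp_module R X)"
proof -
  interpret cring R by fact
  note closed = finsupp_closed[OF assms]
  have cR: "c x \<in> carrier R" if "c \<in> finsupp R X" for c x using that by (simp add: finsupp_def)
  show ?thesis
  proof (rule moduleI[OF assms])
    show "abelian_group (finsupp_module R X)"
    proof (rule abelian_groupI)
      fix c assume "c \<in> carrier (finsupp_module R X)"
      then have c: "c \<in> finsupp R X" by (simp add: finsupp_module_def)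
      then show "\<exists>c'\<in>carrier (finsupp_module R X). c' \<oplus>\<^bsub>finsupp_module R X\<^esub> c = \<zero>\<^bsub>finsupp_module R X\<^esub>"
        by (intro bexI[of _ "\<lambda>x. \<ominus>\<^bsub>R\<^esub> c x"]) (auto simp: finsupp_module_def closed cR l_neg)
    qed (auto simp: finsupp_module_def closed cR a_ac)
  qed (auto simp: finsupp_module_def closed cR l_distr r_distr m_assoc)
qed

text \<open>The preimages of the unit vectors form the basis; \<open>nontriv\<close> keeps them
  distinct, so that coefficients indexed by basis elements match coordinates indexed by
  \<open>X\<close>.\<close>

lemma free_moduleI_coordinates:
  assumes F: "Module.module R F" and nontriv: "\<one>\<^bsub>R\<^esub> \<noteq> \<zero>\<^bsub>R\<^esub>"
    and co: "bij_betw co (carrier F) (finsupp R X)"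
    and add: "\<And>u v. u \<in> carrier F \<Longrightarrow> v \<in> carrier F \<Longrightarrow> co (u \<oplus>\<^bsub>F\<^esub> v) = (\<lambda>x. co u x \<oplus>\<^bsub>R\<^esub> co v x)"
    and smult: "\<And>a u. a \<in> carrier R \<Longrightarrow> u \<in> carrier F \<Longrightarrow> co (a \<odot>\<^bsub>F\<^esub> u) = (\<lambda>x. a \<otimes>\<^bsub>R\<^esub> co u x)"
  shows "free_module R F"
proof -
  interpret F: Module.module R F by fact
  have cR: "co u x \<in> carrier R" if "u \<in> carrier F" for u x
    using bij_betwE[OF co] that by (auto simp: finsupp_def)
  have c0: "co u x = \<zero>\<^bsub>R\<^esub>" if "u \<in> carrier F" "x \<notin> X" for u x
    using bij_betwE[OF co] that by (auto simp: finsupp_def)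
  have co_zero: "co \<zero>\<^bsub>F\<^esub> x = \<zero>\<^bsub>R\<^esub>" for x
    using smult[of "\<zero>\<^bsub>R\<^esub>" "\<zero>\<^bsub>F\<^esub>"] cR[of "\<zero>\<^bsub>F\<^esub>"] by simp
  define e where "e i = inv_into (carrier F) co (\<lambda>y. if y = i then \<one>\<^bsub>R\<^esub> else \<zero>\<^bsub>R\<^esub>)" for i
  have e: "e i \<in> carrier F" "co (e i) = (\<lambda>y. if y = i then \<one>\<^bsub>R\<^esub> else \<zero>\<^bsub>R\<^esub>)" if "i \<in> X" for i
    using finsupp_closed(5)[OF F.R.is_cring that] co unfolding e_def bij_betw_def
    by (auto simp: inv_into_into f_inv_into_f)
  have e_inj: "e i = e j \<longleftrightarrow> i = j" if "i \<in> X" "j \<in> X" for i j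
    using e(2)[OF that(1)] e(2)[OF that(2)] nontriv by metis
  let ?B = "e ` X"
  have co_sum: "co (\<Oplus>\<^bsub>F\<^esub>b\<in>S. c b \<odot>\<^bsub>F\<^esub> b) j = (if e j \<in> S then c (e j) else \<zero>\<^bsub>R\<^esub>)"
    if "finite S" "S \<subseteq> ?B" "\<And>b. b \<in> S \<Longrightarrow> c b \<in> carrier R" "j \<in> X" for S c j
    using that(1-3)
  proof (induction S)
    case empty then show ?case by (simp add: co_zero)
  next
    case (insert b S)
    then obtain i where i: "i \<in> X" "b = e i" by auto
    have SF: "S \<subseteq> carrier F" using insert e(1) by auto
    then have s: "(\<Oplus>\<^bsub>F\<^esub>b\<in>S. c b \<odot>\<^bsub>F\<^esub> b) \<in> carrier F" using insert by (intro F.M.finsum_closed) auto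
    have "(\<Oplus>\<^bsub>F\<^esub>b\<in>insert b S. c b \<odot>\<^bsub>F\<^esub> b) = c b \<odot>\<^bsub>F\<^esub> b \<oplus>\<^bsub>F\<^esub> (\<Oplus>\<^bsub>F\<^esub>b\<in>S. c b \<odot>\<^bsub>F\<^esub> b)"
      using insert SF e(1) i by (intro F.M.finsum_insert) auto
    then show ?case using insert s i e e_inj[OF that(4)] by (auto simp: add smult)
  qed
  have "module_basis R F ?B"
    unfolding module_basis_def
  proof (intro conjI ballI)
    show "?B \<subseteq> carrier F" using e(1) by auto
    fix x assume x: "x \<in> carrier F"
    show "\<exists>!c. (\<forall>b\<in>?B. c b \<in> carrier R) \<and> (\<forall>b. b \<notin> ?B \<longrightarrow> c b = \<zero>\<^bsub>R\<^esub>) \<and>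
        finite {b. c b \<noteq> \<zero>\<^bsub>R\<^esub>} \<and> x = (\<Oplus>\<^bsub>F\<^esub>b\<in>{b. c b \<noteq> \<zero>\<^bsub>R\<^esub>}. c b \<odot>\<^bsub>F\<^esub> b)"
    proof (rule ex1I)
      let ?c = "\<lambda>b. if b \<in> ?B then co x (inv_into X e b) else \<zero>\<^bsub>R\<^esub>"
      let ?S = "{b. ?c b \<noteq> \<zero>\<^bsub>R\<^esub>}"
      have inv: "inv_into X e (e i) = i" if "i \<in> X" for i
        using that e_inj by (intro inv_into_f_f) (auto simp: inj_on_def)
      have "?S \<subseteq> e ` {i. co x i \<noteq> \<zero>\<^bsub>R\<^esub>}" by (auto simp: inv split: if_splits)
      moreover have "finite {i. co x i \<noteq> \<zero>\<^bsub>R\<^esub>}" using bij_betwE[OF co] x by (auto simp: finsupp_def)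
      ultimately have fin: "finite ?S" using finite_surj by blast
      have SB: "?S \<subseteq> ?B" by auto
      have cc: "?c b \<in> carrier R" for b using cR[OF x] by auto
      have Sc: "(\<Oplus>\<^bsub>F\<^esub>b\<in>?S. ?c b \<odot>\<^bsub>F\<^esub> b) \<in> carrier F"
        using SB e(1) cc by (intro F.M.finsum_closed) blast
      have "co (\<Oplus>\<^bsub>F\<^esub>b\<in>?S. ?c b \<odot>\<^bsub>F\<^esub> b) = co x"
      proof
        fix j show "co (\<Oplus>\<^bsub>F\<^esub>b\<in>?S. ?c b \<odot>\<^bsub>F\<^esub> b) j = co x j"
        proof (cases "j \<in> X")
          case True
          then show ?thesis using co_sum[OF fin SB cc True] inv[OF True] by auto
        qed (use c0 x Sc in auto)
      qed
      then have "x = (\<Oplus>\<^bsub>F\<^esub>b\<in>?S. ?c b \<odot>\<^bsub>F\<^esub> b)"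
        by (rule inj_onD[OF bij_betw_imp_inj_on[OF co] _ Sc x, symmetric])
      then show "(\<forall>b\<in>?B. ?c b \<in> carrier R) \<and> (\<forall>b. b \<notin> ?B \<longrightarrow> ?c b = \<zero>\<^bsub>R\<^esub>) \<and>
        finite ?S \<and> x = (\<Oplus>\<^bsub>F\<^esub>b\<in>?S. ?c b \<odot>\<^bsub>F\<^esub> b)" using fin cR[OF x] by simp
      fix c assume c: "(\<forall>b\<in>?B. c b \<in> carrier R) \<and> (\<forall>b. b \<notin> ?B \<longrightarrow> c b = \<zero>\<^bsub>R\<^esub>) \<and>
        finite {b. c b \<noteq> \<zero>\<^bsub>R\<^esub>} \<and> x = (\<Oplus>\<^bsub>F\<^esub>b\<in>{b. c b \<noteq> \<zero>\<^bsub>R\<^esub>}. c b \<odot>\<^bsub>F\<^esub> b)"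
      have "co x j = c (e j)" if "j \<in> X" for j
      proof -
        have "co x j = co (\<Oplus>\<^bsub>F\<^esub>b\<in>{b. c b \<noteq> \<zero>\<^bsub>R\<^esub>}. c b \<odot>\<^bsub>F\<^esub> b) j" using c by metis
        also have "\<dots> = c (e j)" using c that by (subst co_sum) (blast, blast, blast, blast, simp)
        finally show ?thesis .
      qed
      then have "c b = ?c b" for b using c inv by (cases "b \<in> ?B") auto
      then show "c = ?c" by blast
    qed
  qed
  then show ?thesis using F unfolding free_module_def by blast
qed

text \<open>Every element of \<open>X\<close> serves as a generator, so unit vectors give
  surjectivity at once. \<open>enc\<close> moves the free module, whose elements are functions, into
  the element type of the resolution.\<close>

lemma free_cover:
  fixes N :: "('a, 'e, 'n) module_scheme" and enc :: "('e \<Rightarrow> 'a) \<Rightarrow> 'c"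
  assumes N: "Module.module R N" and nontriv: "\<one>\<^bsub>R\<^esub> \<noteq> \<zero>\<^bsub>R\<^esub>" and X: "X \<subseteq> carrier N"
    and enc: "inj_on enc (finsupp R X)"
    and X0: "\<zero>\<^bsub>N\<^esub> \<in> X" and Xadd: "\<And>x y. x \<in> X \<Longrightarrow> y \<in> X \<Longrightarrow> x \<oplus>\<^bsub>N\<^esub> y \<in> X"
    and Xsm: "\<And>a x. a \<in> carrier R \<Longrightarrow> x \<in> X \<Longrightarrow> a \<odot>\<^bsub>N\<^esub> x \<in> X"
  shows "\<exists>(F :: ('a, 'c) module) f. free_module R F \<and> lin R F N f \<and> f ` carrier F = X"
proof -
  interpret N: Module.module R N by fact
  note cr = N.R.is_cring
  note closed = finsupp_closed[OF cr]
  define dec where "dec = the_inv_into (finsupp R X) enc"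
  have dec: "dec (enc c) = c" if "c \<in> finsupp R X" for c
    unfolding dec_def by (rule the_inv_into_f_f[OF enc that])
  define F :: "('a, 'c) module" where "F = \<lparr>carrier = enc ` finsupp R X, monoid.mult = undefined, monoid.one = undefined,
     ring.zero = enc (\<lambda>_. \<zero>\<^bsub>R\<^esub>), ring.add = (\<lambda>u v. enc (\<lambda>x. dec u x \<oplus>\<^bsub>R\<^esub> dec v x)),
     smult = (\<lambda>a u. enc (\<lambda>x. a \<otimes>\<^bsub>R\<^esub> dec u x))\<rparr>"
  have F: "Module.module R F"
    by (rule module_image[where f = enc, OF finsupp_module_module[OF cr]])
      (auto simp: finsupp_module_def F_def dec intro!: linI)
  have decF: "dec u \<in> finsupp R X" if "u \<in> carrier F" for u using that by (auto simp: F_def dec)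
  have dec_add: "dec (u \<oplus>\<^bsub>F\<^esub> v) = (\<lambda>x. dec u x \<oplus>\<^bsub>R\<^esub> dec v x)" if "u \<in> carrier F" "v \<in> carrier F" for u v
    using closed(2)[OF decF[OF that(1)] decF[OF that(2)]] by (simp add: F_def dec)
  have dec_smult: "dec (a \<odot>\<^bsub>F\<^esub> u) = (\<lambda>x. a \<otimes>\<^bsub>R\<^esub> dec u x)" if "a \<in> carrier R" "u \<in> carrier F" for a u
    using closed(3)[OF decF[OF that(2)] that(1)] by (simp add: F_def dec)
  have "free_module R F"
  proof (rule free_moduleI_coordinates[OF F nontriv _ dec_add dec_smult])
    show "bij_betw dec (carrier F) (finsupp R X)"
      by (rule bij_betw_byWitness[of _ enc]) (auto simp: F_def dec)
  qed
  moreover define f where "f u = (\<Oplus>\<^bsub>N\<^esub>x\<in>{x. dec u x \<noteq> \<zero>\<^bsub>R\<^esub>}. dec u x \<odot>\<^bsub>N\<^esub> x)" for u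
  have supp: "finite {x. c x \<noteq> \<zero>\<^bsub>R\<^esub>}" "{x. c x \<noteq> \<zero>\<^bsub>R\<^esub>} \<subseteq> X" "c x \<in> carrier R" if "c \<in> finsupp R X" for c x
    using that by (auto simp: finsupp_def)
  have f_eq: "f u = (\<Oplus>\<^bsub>N\<^esub>x\<in>A. dec u x \<odot>\<^bsub>N\<^esub> x)"
    if "u \<in> carrier F" "finite A" "{x. dec u x \<noteq> \<zero>\<^bsub>R\<^esub>} \<subseteq> A" "A \<subseteq> X" for u A
    unfolding f_def by (rule finsum_superset[OF N that(2,3)]) (use that X supp[OF decF[OF that(1)]] in auto)
  have sumX: "(\<Oplus>\<^bsub>N\<^esub>x\<in>A. c x \<odot>\<^bsub>N\<^esub> x) \<in> X" if "finite A" "A \<subseteq> X" "\<And>x. c x \<in> carrier R" for A c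
    using that
  proof (induction A)
    case (insert a A)
    then have "(\<Oplus>\<^bsub>N\<^esub>x\<in>insert a A. c x \<odot>\<^bsub>N\<^esub> x) = c a \<odot>\<^bsub>N\<^esub> a \<oplus>\<^bsub>N\<^esub> (\<Oplus>\<^bsub>N\<^esub>x\<in>A. c x \<odot>\<^bsub>N\<^esub> x)"
      using X by (intro N.M.finsum_insert) auto
    then show ?case using insert by (simp add: Xadd Xsm)
  qed (simp add: X0)
  have fX: "f u \<in> X" if "u \<in> carrier F" for u
    unfolding f_def using supp[OF decF[OF that]] by (intro sumX) auto
  have "lin R F N f"
  proof (rule linI)
    fix u v assume uv: "u \<in> carrier F" "v \<in> carrier F"
    interpret F: Module.module R F by fact
    let ?A = "{x. dec u x \<noteq> \<zero>\<^bsub>R\<^esub>} \<union> {x. dec v x \<noteq> \<zero>\<^bsub>R\<^esub>}"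
    note su = supp[OF decF[OF uv(1)]] and sv = supp[OF decF[OF uv(2)]]
    have A: "finite ?A" "?A \<subseteq> X" using su sv by auto
    have "f (u \<oplus>\<^bsub>F\<^esub> v) = (\<Oplus>\<^bsub>N\<^esub>x\<in>?A. dec (u \<oplus>\<^bsub>F\<^esub> v) x \<odot>\<^bsub>N\<^esub> x)"
      using uv A by (intro f_eq) (auto simp: dec_add)
    also have "\<dots> = (\<Oplus>\<^bsub>N\<^esub>x\<in>?A. dec u x \<odot>\<^bsub>N\<^esub> x \<oplus>\<^bsub>N\<^esub> dec v x \<odot>\<^bsub>N\<^esub> x)"
      by (rule N.M.finsum_cong') (use A X su(3) sv(3) in \<open>auto simp: dec_add[OF uv] N.smult_l_distr subset_iff\<close>)
    also have "\<dots> = (\<Oplus>\<^bsub>N\<^esub>x\<in>?A. dec u x \<odot>\<^bsub>N\<^esub> x) \<oplus>\<^bsub>N\<^esub> (\<Oplus>\<^bsub>N\<^esub>x\<in>?A. dec v x \<odot>\<^bsub>N\<^esub> x)"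
      using A X su(3) sv(3) by (intro N.M.finsum_addf) (auto simp: subset_iff)
    also have "\<dots> = f u \<oplus>\<^bsub>N\<^esub> f v" using f_eq[OF uv(1) A(1) _ A(2)] f_eq[OF uv(2) A(1) _ A(2)] by simp
    finally show "f (u \<oplus>\<^bsub>F\<^esub> v) = f u \<oplus>\<^bsub>N\<^esub> f v" .
  next
    fix a u assume a: "a \<in> carrier R" and u: "u \<in> carrier F"
    interpret F: Module.module R F by fact
    let ?A = "{x. dec u x \<noteq> \<zero>\<^bsub>R\<^esub>}"
    note su = supp[OF decF[OF u]]
    have "f (a \<odot>\<^bsub>F\<^esub> u) = (\<Oplus>\<^bsub>N\<^esub>x\<in>?A. dec (a \<odot>\<^bsub>F\<^esub> u) x \<odot>\<^bsub>N\<^esub> x)"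
      using a u su by (intro f_eq) (auto simp: dec_smult)
    also have "\<dots> = (\<Oplus>\<^bsub>N\<^esub>x\<in>?A. a \<odot>\<^bsub>N\<^esub> (dec u x \<odot>\<^bsub>N\<^esub> x))"
      by (rule N.M.finsum_cong') (use X su a in \<open>auto simp: dec_smult[OF a u] N.smult_assoc1 subset_iff\<close>)
    also have "\<dots> = a \<odot>\<^bsub>N\<^esub> f u" unfolding f_def
      using a X su by (intro N.finsum_smult_ldistr[symmetric]) (auto simp: subset_iff)
    finally show "f (a \<odot>\<^bsub>F\<^esub> u) = a \<odot>\<^bsub>N\<^esub> f u" .
  qed (use fX X in blast)
  moreover have "f ` carrier F = X"
  proof (intro equalityI subsetI)
    fix x assume x: "x \<in> X"
    let ?c = "\<lambda>y. if y = x then \<one>\<^bsub>R\<^esub> else \<zero>\<^bsub>R\<^esub>"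
    have c: "?c \<in> finsupp R X" by (rule closed(5)[OF x])
    then have "enc ?c \<in> carrier F" by (simp add: F_def)
    moreover have "f (enc ?c) = (\<Oplus>\<^bsub>N\<^esub>y\<in>{x}. dec (enc ?c) y \<odot>\<^bsub>N\<^esub> y)"
      using calculation x by (intro f_eq) (auto simp: dec[OF c] split: if_splits)
    then have "f (enc ?c) = x" using x X by (auto simp: dec[OF c] subset_iff)
    ultimately show "x \<in> f ` carrier F" by force
  qed (use fX in auto)
  ultimately show ?thesis by blast
qed

text \<open>Each block announces the length of the code of x, so the concatenation can be parsed
  uniquely.\<close>

lemma concat_blocks_inj:
  assumes "inj i"
  shows "concat (map (\<lambda>(a, x). Inl (length (i x)) # Inr (Inl a) # i x) l) =
      concat (map (\<lambda>(a, x). Inl (length (i x)) # Inr (Inl a) # i x) l') \<Longrightarrow> l = l'"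
proof (induction l arbitrary: l')
  case Nil
  then show ?case by (cases l') auto
next
  case (Cons p l)
  then show ?case using injD[OF assms] by (cases p; cases l') auto
qed

text \<open>A finitely supported function is determined by its pairs of nonzero value and argument.
  Any list of these pairs, coded block by block, is an injective code because the blocks can be
  parsed.\<close>

lemma finsupp_encoding_exists:
  fixes i :: "'e \<Rightarrow> (nat + 'a + 'b) list"
  assumes "inj i"
  shows "\<exists>enc :: ('e \<Rightarrow> 'a) \<Rightarrow> (nat + 'a + 'b) list. inj_on enc (finsupp R X)"
proof -
  define L where "L c = (SOME l. set l = {(c x, x) | x. c x \<noteq> \<zero>\<^bsub>R\<^esub>})" for c :: "'e \<Rightarrow> 'a"
  have L: "set (L c) = {(c x, x) | x. c x \<noteq> \<zero>\<^bsub>R\<^esub>}" if "c \<in> finsupp R X" for c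
    unfolding L_def by (rule someI_ex, rule finite_list) (use that in \<open>simp add: finsupp_def\<close>)
  have "c = c'" if c: "c \<in> finsupp R X" "c' \<in> finsupp R X" and eq: "L c = L c'" for c c'
  proof
    fix x
    have "{(c x, x) | x. c x \<noteq> \<zero>\<^bsub>R\<^esub>} = {(c' x, x) | x. c' x \<noteq> \<zero>\<^bsub>R\<^esub>}" using L[OF c(1)] L[OF c(2)] eq by simp
    then have "(a, x) \<in> {(c x, x) | x. c x \<noteq> \<zero>\<^bsub>R\<^esub>} \<longleftrightarrow> (a, x) \<in> {(c' x, x) | x. c' x \<noteq> \<zero>\<^bsub>R\<^esub>}" for a by simp
    then have "a = c x \<and> c x \<noteq> \<zero>\<^bsub>R\<^esub> \<longleftrightarrow> a = c' x \<and> c' x \<noteq> \<zero>\<^bsub>R\<^esub>" for a by simp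
    then show "c x = c' x" by metis
  qed
  then have "inj_on (\<lambda>c. concat (map (\<lambda>(a, x). Inl (length (i x)) # Inr (Inl a) # i x) (L c))) (finsupp R X)"
    using concat_blocks_inj[OF assms] by (intro inj_onI) blast
  then show ?thesis by blast
qed

text \<open>Cover \<open>M\<close>, then each successive kernel, by a free module. All covers have
  to share one element type, which is possible because codes of finitely supported functions on
  \<open>res_elem\<close> are again in \<open>res_elem\<close>.\<close>

theorem free_resolution_exists:
  fixes M :: "('a, 'b, 'n) module_scheme"
  assumes M: "Module.module R M" and nontriv: "\<one>\<^bsub>R\<^esub> \<noteq> \<zero>\<^bsub>R\<^esub>"
  shows "\<exists>(P :: nat \<Rightarrow> ('a, ('a, 'b) res_elem) module) \<delta> \<epsilon>. free_resolution R M P \<delta> \<epsilon>"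
proof -
  define sub :: "('a, ('a, 'b) res_elem) module \<Rightarrow> ('a, 'b) res_elem set \<Rightarrow> bool" where
    "sub F X \<longleftrightarrow> X \<subseteq> carrier F \<and> \<zero>\<^bsub>F\<^esub> \<in> X \<and> (\<forall>x\<in>X. \<forall>y\<in>X. x \<oplus>\<^bsub>F\<^esub> y \<in> X) \<and> (\<forall>a\<in>carrier R. \<forall>x\<in>X. a \<odot>\<^bsub>F\<^esub> x \<in> X)" for F X
  have ker: "sub F {u \<in> carrier F. f u = \<zero>\<^bsub>N\<^esub>}" if "Module.module R F" "Module.module R N" "lin R F N f"
    for F f and N :: "('a, 'd, 'k) module_scheme"
  proof -
    interpret F: Module.module R F by fact
    interpret N: Module.module R N by fact
    show ?thesis unfolding sub_def using that(3) lin_zero[OF that] by (auto simp: lin_def)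
  qed
  obtain enc0 :: "('b \<Rightarrow> 'a) \<Rightarrow> ('a, 'b) res_elem" where enc0: "inj_on enc0 (finsupp R (carrier M))"
    using finsupp_encoding_exists[of "\<lambda>b. [Inr (Inr b)]"] by (auto simp: inj_def)
  have "\<exists>(F :: ('a, ('a, 'b) res_elem) module) f. free_module R F \<and> lin R F M f \<and> f ` carrier F = carrier M"
  proof -
    interpret Module.module R M by fact
    show ?thesis by (rule free_cover[OF M nontriv _ enc0]) auto
  qed
  then obtain F0 :: "('a, ('a, 'b) res_elem) module" and \<epsilon> where
    F0: "free_module R F0" "lin R F0 M \<epsilon>" "\<epsilon> ` carrier F0 = carrier M" by blast
  \<comment> \<open>A state is a free module with the submodule to be covered next. The differential
    joins two states, so it is hidden in the step relation and extracted afterwards by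
    \<open>choice\<close>.\<close>
  define Q where "Q s s' \<longleftrightarrow> (\<exists>f. lin R (fst s') (fst s) f \<and> f ` carrier (fst s') = snd s \<and>
     snd s' = {u \<in> carrier (fst s'). f u = \<zero>\<^bsub>fst s\<^esub>})" for s s' :: "('a, ('a, 'b) res_elem) module \<times> ('a, 'b) res_elem set"
  define A where "A n s \<longleftrightarrow> free_module R (fst s) \<and> sub (fst s) (snd s) \<and>
     (n = 0 \<longrightarrow> s = (F0, {u \<in> carrier F0. \<epsilon> u = \<zero>\<^bsub>M\<^esub>}))" for n :: nat and s
  have "\<exists>s. \<forall>n. A n (s n) \<and> Q (s n) (s (Suc n))"
  proof (rule dependent_nat_choice)
    show "\<exists>s. A 0 s" unfolding A_def using F0 ker[OF free_module_module[OF F0(1)] M F0(2)] by auto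
  next
    fix s n assume "A n s"
    then have s: "free_module R (fst s)" "sub (fst s) (snd s)" unfolding A_def by auto
    obtain enc :: "(('a, 'b) res_elem \<Rightarrow> 'a) \<Rightarrow> ('a, 'b) res_elem" where enc: "inj_on enc (finsupp R (snd s))"
      using finsupp_encoding_exists[of "\<lambda>x. x"] by auto
    have "\<exists>(F :: ('a, ('a, 'b) res_elem) module) f. free_module R F \<and> lin R F (fst s) f \<and> f ` carrier F = snd s"
      by (rule free_cover[OF free_module_module[OF s(1)] nontriv _ enc]) (use s(2) in \<open>auto simp: sub_def\<close>)
    then obtain F :: "('a, ('a, 'b) res_elem) module" and f where
      F: "free_module R F" "lin R F (fst s) f" "f ` carrier F = snd s" by blast
    have "A (Suc n) (F, {u \<in> carrier F. f u = \<zero>\<^bsub>fst s\<^esub>})"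
      unfolding A_def using F(1) ker[OF free_module_module[OF F(1)] free_module_module[OF s(1)] F(2)] by simp
    moreover have "Q s (F, {u \<in> carrier F. f u = \<zero>\<^bsub>fst s\<^esub>})" unfolding Q_def using F by auto
    ultimately show "\<exists>s'. A (Suc n) s' \<and> Q s s'" by blast
  qed
  then obtain s where s: "\<And>n. A n (s n)" "\<And>n. Q (s n) (s (Suc n))" by blast
  define P where "P n = fst (s n)" for n
  define Z where "Z n = snd (s n)" for n
  have free: "free_module R (P n)" for n using s(1)[of n] by (simp add: A_def P_def)
  note mod = free_module_module[OF free]
  have P0: "P 0 = F0" "Z 0 = {u \<in> carrier F0. \<epsilon> u = \<zero>\<^bsub>M\<^esub>}" using s(1)[of 0] by (auto simp: A_def P_def Z_def)
  have "\<forall>n. \<exists>f. lin R (P (Suc n)) (P n) f \<and> f ` carrier (P (Suc n)) = Z n \<and>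
     Z (Suc n) = {u \<in> carrier (P (Suc n)). f u = \<zero>\<^bsub>P n\<^esub>}"
    using s(2) by (simp add: Q_def P_def Z_def)
  from choice[OF this] obtain f where f: "\<And>n. lin R (P (Suc n)) (P n) (f n)" "\<And>n. f n ` carrier (P (Suc n)) = Z n"
     "\<And>n. Z (Suc n) = {u \<in> carrier (P (Suc n)). f n u = \<zero>\<^bsub>P n\<^esub>}" by blast
  have "free_resolution R M P (\<lambda>n. restrict (f n) (carrier (P (Suc n)))) (restrict \<epsilon> (carrier (P 0)))"
    unfolding free_resolution_def
  proof (intro conjI allI)
    show "free_module R (P n)" for n by (rule free)
    show "restrict (f n) (carrier (P (Suc n))) \<in> linear_maps R (P (Suc n)) (P n)" for n
      by (rule linear_maps_restrict[OF f(1) mod])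
    show "restrict \<epsilon> (carrier (P 0)) \<in> linear_maps R (P 0) M"
      using F0(2) mod[of 0] by (intro linear_maps_restrict) (simp_all add: P0)
    show "restrict \<epsilon> (carrier (P 0)) ` carrier (P 0) = carrier M" using F0(3) by (simp add: P0)
    show "restrict (f 0) (carrier (P (Suc 0))) ` carrier (P 1) =
        {x \<in> carrier (P 0). restrict \<epsilon> (carrier (P 0)) x = \<zero>\<^bsub>M\<^esub>}"
      using f(2)[of 0] P0 by auto
    show "restrict (f (Suc n)) (carrier (P (Suc (Suc n)))) ` carrier (P (Suc (Suc n))) =
        {x \<in> carrier (P (Suc n)). restrict (f n) (carrier (P (Suc n))) x = \<zero>\<^bsub>P n\<^esub>}" for n
      using f(2)[of "Suc n"] f(3)[of n] by auto
  qed
  then show ?thesis by blast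
qed

section \<open>Vanishing of Ext for quotients by a regular sequence\<close>

abbreviation quot :: "('a, 'm) ring_scheme \<Rightarrow> 'a set \<Rightarrow> ('a, 'a set) module" where
  "quot R I \<equiv> quotient_module (self_module R) I"

lemma self_module_simps [simp]:
  "carrier (self_module R) = carrier R" "\<zero>\<^bsub>self_module R\<^esub> = \<zero>\<^bsub>R\<^esub>"
  "x \<oplus>\<^bsub>self_module R\<^esub> y = x \<oplus>\<^bsub>R\<^esub> y" "a \<odot>\<^bsub>self_module R\<^esub> x = a \<otimes>\<^bsub>R\<^esub> x"
  by (simp_all add: self_module_def)

lemma self_module_module:
  assumes "cring R"
  shows "Module.module R (self_module R)"
proof -
  interpret cring R by fact
  show ?thesis
  proof (rule moduleI[OF assms])
    show "abelian_group (self_module R)"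
    proof (rule abelian_groupI)
      fix x assume "x \<in> carrier (self_module R)"
      then show "\<exists>y\<in>carrier (self_module R). y \<oplus>\<^bsub>self_module R\<^esub> x = \<zero>\<^bsub>self_module R\<^esub>"
        by (intro bexI[of _ "\<ominus>\<^bsub>R\<^esub> x"]) (auto simp: l_neg)
    qed (auto simp: a_ac)
  qed (auto simp: l_distr r_distr m_assoc)
qed

lemma quot_simps:
  "carrier (quot R I) = (\<lambda>r. I +>\<^bsub>R\<^esub> r) ` carrier R" "\<zero>\<^bsub>quot R I\<^esub> = I"
  "X \<oplus>\<^bsub>quot R I\<^esub> Y = X <+>\<^bsub>R\<^esub> Y" "a \<odot>\<^bsub>quot R I\<^esub> X = (\<Union>x\<in>X. I +>\<^bsub>R\<^esub> (a \<otimes>\<^bsub>R\<^esub> x))"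
  by (auto simp: quotient_module_def A_RCOSETS_def RCOSETS_def a_r_coset_def set_add_def r_coset_def
      set_mult_def)

lemma quot_coset_eq_iff:
  assumes "cring R" "ideal I R" "x \<in> carrier R" "y \<in> carrier R"
  shows "I +>\<^bsub>R\<^esub> x = I +>\<^bsub>R\<^esub> y \<longleftrightarrow> x \<ominus>\<^bsub>R\<^esub> y \<in> I"
  using ring.quotient_eq_iff_same_a_r_cos[OF cring.axioms(1)[OF assms(1)] assms(2-4)] by blast

lemma quot_coset_zero_iff:
  assumes "cring R" "ideal I R" "x \<in> carrier R"
  shows "I +>\<^bsub>R\<^esub> x = I \<longleftrightarrow> x \<in> I"
proof -
  interpret cring R by fact
  interpret I: ideal I R by fact
  have "I +>\<^bsub>R\<^esub> \<zero>\<^bsub>R\<^esub> = I" by (rule a_coset_add_zero[OF I.a_subset])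
  then show ?thesis using quot_coset_eq_iff[OF assms zero_closed] assms(3) by (simp add: a_minus_def)
qed

lemma quot_add:
  assumes "cring R" "ideal I R" "x \<in> carrier R" "y \<in> carrier R"
  shows "(I +>\<^bsub>R\<^esub> x) \<oplus>\<^bsub>quot R I\<^esub> (I +>\<^bsub>R\<^esub> y) = I +>\<^bsub>R\<^esub> (x \<oplus>\<^bsub>R\<^esub> y)"
proof -
  interpret I: ideal I R by fact
  show ?thesis using I.a_rcos_sum assms by (simp add: quot_simps)
qed

lemma quot_smult:
  assumes "cring R" "ideal I R" "a \<in> carrier R" "x \<in> carrier R"
  shows "a \<odot>\<^bsub>quot R I\<^esub> (I +>\<^bsub>R\<^esub> x) = I +>\<^bsub>R\<^esub> (a \<otimes>\<^bsub>R\<^esub> x)"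
proof -
  interpret cring R by fact
  interpret I: ideal I R by fact
  have "I +>\<^bsub>R\<^esub> (a \<otimes>\<^bsub>R\<^esub> y) = I +>\<^bsub>R\<^esub> (a \<otimes>\<^bsub>R\<^esub> x)" if y: "y \<in> I +>\<^bsub>R\<^esub> x" for y
  proof -
    obtain i where i: "i \<in> I" "y = i \<oplus>\<^bsub>R\<^esub> x" using y by (auto simp: a_r_coset_def r_coset_def)
    then have ic: "i \<in> carrier R" by (simp add: I.a_Hcarr)
    have "a \<otimes>\<^bsub>R\<^esub> y \<ominus>\<^bsub>R\<^esub> a \<otimes>\<^bsub>R\<^esub> x = a \<otimes>\<^bsub>R\<^esub> i" using assms(3,4) ic i
      by (simp add: r_distr a_minus_def a_assoc r_neg)
    then show ?thesis using quot_coset_eq_iff[OF assms(1,2), of "a \<otimes>\<^bsub>R\<^esub> y" "a \<otimes>\<^bsub>R\<^esub> x"] assms(3,4) i ic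
      by (simp add: I.I_l_closed)
  qed
  moreover have "x \<in> I +>\<^bsub>R\<^esub> x" using I.a_rcos_self assms(4) by simp
  ultimately show ?thesis unfolding quot_simps by blast
qed

lemma quot_proj:
  assumes "cring R" "ideal I R"
  shows "lin R (self_module R) (quot R I) (\<lambda>r. I +>\<^bsub>R\<^esub> r)"
  by (rule linI) (use assms in \<open>auto simp: quot_add quot_smult quot_simps(1)\<close>)

lemma quot_module:
  assumes "cring R" "ideal I R"
  shows "Module.module R (quot R I)"
proof -
  interpret cring R by fact
  show ?thesis
    by (rule module_image[OF self_module_module[OF assms(1)] quot_proj[OF assms]])
      (use quot_coset_zero_iff[OF assms zero_closed] additive_subgroup.zero_closed[OF ideal.axioms(1)[OF assms(2)]]
        in \<open>simp_all add: quot_simps(1,2)\<close>)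
qed

lemma quot_map_exists:
  assumes R: "cring R" and I: "ideal I R" and I': "ideal I' R" and "I \<subseteq> I'"
  shows "\<exists>\<pi>. lin R (quot R I) (quot R I') \<pi> \<and> (\<forall>r\<in>carrier R. \<pi> (I +>\<^bsub>R\<^esub> r) = I' +>\<^bsub>R\<^esub> r)"
proof -
  interpret cring R by fact
  define G where "G X Y \<longleftrightarrow> (\<exists>r\<in>carrier R. X = I +>\<^bsub>R\<^esub> r \<and> Y = I' +>\<^bsub>R\<^esub> r)" for X Y
  have "\<exists>\<pi>. lin R (quot R I) (quot R I') \<pi> \<and> (\<forall>X Y. G X Y \<longrightarrow> Y = \<pi> X)"
  proof (rule lin_of_relation[OF quot_module[OF R I] quot_module[OF R I']])
    fix X Y assume "G \<zero>\<^bsub>quot R I\<^esub> Y"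
    then show "Y = \<zero>\<^bsub>quot R I'\<^esub>"
      unfolding G_def quot_simps(2) using assms(4) quot_coset_zero_iff[OF R I] quot_coset_zero_iff[OF R I']
      by (metis subsetD)
  next
    fix X Y X' Y' assume "G X Y" "G X' Y'"
    then obtain r s where "r \<in> carrier R" "X = I +>\<^bsub>R\<^esub> r" "Y = I' +>\<^bsub>R\<^esub> r" "s \<in> carrier R"
      "X' = I +>\<^bsub>R\<^esub> s" "Y' = I' +>\<^bsub>R\<^esub> s" unfolding G_def by blast
    then show "G (X \<oplus>\<^bsub>quot R I\<^esub> X') (Y \<oplus>\<^bsub>quot R I'\<^esub> Y')"
      unfolding G_def by (intro bexI[of _ "r \<oplus>\<^bsub>R\<^esub> s"]) (simp_all add: quot_add R I I')
  next
    fix a X Y assume "a \<in> carrier R" "G X Y"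
    moreover from this obtain r where "r \<in> carrier R" "X = I +>\<^bsub>R\<^esub> r" "Y = I' +>\<^bsub>R\<^esub> r" unfolding G_def by blast
    ultimately show "G (a \<odot>\<^bsub>quot R I\<^esub> X) (a \<odot>\<^bsub>quot R I'\<^esub> Y)"
      unfolding G_def by (intro bexI[of _ "a \<otimes>\<^bsub>R\<^esub> r"]) (simp_all add: quot_smult R I I')
  qed (auto simp: G_def quot_simps(1))
  then obtain \<pi> where \<pi>: "lin R (quot R I) (quot R I') \<pi>" "\<And>X Y. G X Y \<Longrightarrow> Y = \<pi> X" by blast
  have "\<pi> (I +>\<^bsub>R\<^esub> r) = I' +>\<^bsub>R\<^esub> r" if "r \<in> carrier R" for r
    by (rule \<pi>(2)[symmetric]) (use that in \<open>auto simp: G_def\<close>)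
  with \<pi>(1) show ?thesis by blast
qed

text \<open>Coefficients may be replaced along an isomorphism, which freeness of the resolution
  inverts. It leads from R / 0, where the induction below ends, to R.\<close>

lemma vanishes_transfer:
  assumes P: "resolution R M P \<delta> \<epsilon>" and free: "\<And>n. free_module R (P n)"
    and N: "Module.module R N" and N': "Module.module R N'" and h: "lin R N N' h"
    and inj: "inj_on h (carrier N)" and surj: "h ` carrier N = carrier N'"
    and van: "vanishes R P \<delta> N' n"
  shows "vanishes R P \<delta> N n"
  unfolding vanishes_def
proof (intro allI impI)
  note D = resolutionD[OF P]
  fix f assume f: "lin R (P (Suc n)) N f" and fc: "\<forall>x\<in>carrier (P (Suc (Suc n))). f (\<delta> (Suc n) x) = \<zero>\<^bsub>N\<^esub>"
  have "h (f (\<delta> (Suc n) x)) = \<zero>\<^bsub>N'\<^esub>" if "x \<in> carrier (P (Suc (Suc n)))" for x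
    using fc that lin_zero[OF N N' h] by simp
  then obtain g' where g': "lin R (P n) N' g'" "\<And>x. x \<in> carrier (P (Suc n)) \<Longrightarrow> h (f x) = g' (\<delta> n x)"
    using van lin_comp[OF f h] unfolding vanishes_def by blast
  have "g' ` carrier (P n) \<subseteq> h ` carrier N" using surj lin_closed[OF g'(1)] by blast
  then obtain g where g: "lin R (P n) N g" "\<And>x. x \<in> carrier (P n) \<Longrightarrow> h (g x) = g' x"
    using free_module_lift[OF free N' N g'(1) h] by blast
  have "f x = g (\<delta> n x)" if x: "x \<in> carrier (P (Suc n))" for x
    by (rule inj_onD[OF inj _ lin_closed[OF f x] lin_closed[OF g(1) lin_closed[OF D(3) x]]])
      (simp add: g'(2)[OF x] g(2)[OF lin_closed[OF D(3) x]])
  with g(1) show "\<exists>g. lin R (P n) N g \<and> (\<forall>x\<in>carrier (P (Suc n)). f x = g (\<delta> n x))" by blast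
qed

text \<open>Here I j = (t, x_0, ..., x_{j-1}) and J j = (x_j, ..., x_{n-1}). By induction on j,
  Ext^{j+1}(R / I j, R / J j) = 0; each step moves x_j from J to I, and J n = 0 gives the claim.
  \<open>base\<close> starts the induction: whatever 0 : t multiplies into J 0 lies in t R + J
  0.\<close>

theorem Ext_quot_eq_zero:
  fixes R :: "('a, 'm) ring_scheme"
  assumes R: "cring R" and nontriv: "\<one>\<^bsub>R\<^esub> \<noteq> \<zero>\<^bsub>R\<^esub>"
    and t: "t \<in> carrier R" and x: "\<And>j. j < n \<Longrightarrow> x j \<in> carrier R"
    and I: "\<And>j. j \<le> n \<Longrightarrow> ideal (I j) R" and J: "\<And>j. j \<le> n \<Longrightarrow> ideal (J j) R"
    and I0: "I 0 = {u \<otimes>\<^bsub>R\<^esub> t | u. u \<in> carrier R}"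
    and IS: "\<And>j. j < n \<Longrightarrow> I (Suc j) = {a \<oplus>\<^bsub>R\<^esub> x j \<otimes>\<^bsub>R\<^esub> r | a r. a \<in> I j \<and> r \<in> carrier R}"
    and Ireg: "\<And>j r. j < n \<Longrightarrow> r \<in> carrier R \<Longrightarrow> x j \<otimes>\<^bsub>R\<^esub> r \<in> I j \<Longrightarrow> r \<in> I j"
    and Jn: "J n = {\<zero>\<^bsub>R\<^esub>}"
    and JS: "\<And>j. j < n \<Longrightarrow> J j = {a \<oplus>\<^bsub>R\<^esub> x j \<otimes>\<^bsub>R\<^esub> r | a r. a \<in> J (Suc j) \<and> r \<in> carrier R}"
    and Jreg: "\<And>j r. j < n \<Longrightarrow> r \<in> carrier R \<Longrightarrow> x j \<otimes>\<^bsub>R\<^esub> r \<in> J (Suc j) \<Longrightarrow> r \<in> J (Suc j)"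
    and base: "\<And>c. c \<in> carrier R \<Longrightarrow> (\<And>s. s \<in> carrier R \<Longrightarrow> s \<otimes>\<^bsub>R\<^esub> t = \<zero>\<^bsub>R\<^esub> \<Longrightarrow> s \<otimes>\<^bsub>R\<^esub> c \<in> J 0)
      \<Longrightarrow> \<exists>u\<in>carrier R. c \<ominus>\<^bsub>R\<^esub> t \<otimes>\<^bsub>R\<^esub> u \<in> J 0"
  shows "carrier (Ext R (Suc n) (quot R (I n)) (self_module R)) =
    {\<zero>\<^bsub>Ext R (Suc n) (quot R (I n)) (self_module R)\<^esub>}"
proof -
  interpret cring R by fact
  note mod = quot_module[OF R]
  have coset_diff: "(K +>\<^bsub>R\<^esub> a = K +>\<^bsub>R\<^esub> b) = (a \<ominus>\<^bsub>R\<^esub> b \<in> K)" if "ideal K R" "a \<in> carrier R" "b \<in> carrier R" for K a b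
    by (rule quot_coset_eq_iff[OF R that])
  \<comment> \<open>Both towers grow by one generator, K' = K + y R, and then the kernel of R / K ->
    R / K' is y (R / K), the form required by the lemmas on cones.\<close>
  have ker_iff: "(K' +>\<^bsub>R\<^esub> r = K') \<longleftrightarrow> (\<exists>m'\<in>carrier (quot R K). K +>\<^bsub>R\<^esub> r = y \<odot>\<^bsub>quot R K\<^esub> m')"
    if K: "ideal K R" and K': "ideal K' R" and y: "y \<in> carrier R"
      and K'_eq: "K' = {a \<oplus>\<^bsub>R\<^esub> y \<otimes>\<^bsub>R\<^esub> r | a r. a \<in> K \<and> r \<in> carrier R}" and r: "r \<in> carrier R" for K K' y r
  proof -
    interpret K: ideal K R by fact
    have "r \<in> K' \<longleftrightarrow> (\<exists>s\<in>carrier R. r \<ominus>\<^bsub>R\<^esub> y \<otimes>\<^bsub>R\<^esub> s \<in> K)"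
    proof
      assume "r \<in> K'"
      then obtain a s where a: "a \<in> K" "s \<in> carrier R" "r = a \<oplus>\<^bsub>R\<^esub> y \<otimes>\<^bsub>R\<^esub> s" unfolding K'_eq by blast
      then have "r \<ominus>\<^bsub>R\<^esub> y \<otimes>\<^bsub>R\<^esub> s = a" using y K.a_Hcarr[OF a(1)] by (simp add: a_minus_def a_assoc r_neg)
      then show "\<exists>s\<in>carrier R. r \<ominus>\<^bsub>R\<^esub> y \<otimes>\<^bsub>R\<^esub> s \<in> K" using a by metis
    next
      assume "\<exists>s\<in>carrier R. r \<ominus>\<^bsub>R\<^esub> y \<otimes>\<^bsub>R\<^esub> s \<in> K"
      then obtain s where s: "s \<in> carrier R" "r \<ominus>\<^bsub>R\<^esub> y \<otimes>\<^bsub>R\<^esub> s \<in> K" by blast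
      have "r = (r \<ominus>\<^bsub>R\<^esub> y \<otimes>\<^bsub>R\<^esub> s) \<oplus>\<^bsub>R\<^esub> y \<otimes>\<^bsub>R\<^esub> s" using r s y by (simp add: a_minus_def a_assoc l_neg)
      then show "r \<in> K'" unfolding K'_eq using s by blast
    qed
    then show ?thesis
      using y r by (auto simp: quot_coset_zero_iff[OF R K' r] quot_simps(1) quot_smult[OF R K] coset_diff[OF K])
  qed
  have reg: "m = \<zero>\<^bsub>quot R K\<^esub>" if K: "ideal K R" and y: "y \<in> carrier R"
      and yreg: "\<And>r. r \<in> carrier R \<Longrightarrow> y \<otimes>\<^bsub>R\<^esub> r \<in> K \<Longrightarrow> r \<in> K"
      and m: "m \<in> carrier (quot R K)" "y \<odot>\<^bsub>quot R K\<^esub> m = \<zero>\<^bsub>quot R K\<^esub>" for K y m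
  proof -
    obtain r where r: "r \<in> carrier R" "m = K +>\<^bsub>R\<^esub> r" using m(1) by (auto simp: quot_simps(1))
    then have "y \<otimes>\<^bsub>R\<^esub> r \<in> K" using m(2) y quot_coset_zero_iff[OF R K, of "y \<otimes>\<^bsub>R\<^esub> r"]
      by (simp add: quot_smult[OF R K] quot_simps(2))
    then show ?thesis using yreg r quot_coset_zero_iff[OF R K] by (simp add: quot_simps(2))
  qed
  have sub: "K \<subseteq> K'" if K: "ideal K R" and y: "y \<in> carrier R"
      and K'_eq: "K' = {a \<oplus>\<^bsub>R\<^esub> y \<otimes>\<^bsub>R\<^esub> r | a r. a \<in> K \<and> r \<in> carrier R}" for K K' y
  proof
    interpret K: ideal K R by fact
    fix a assume a: "a \<in> K"
    then have "a = a \<oplus>\<^bsub>R\<^esub> y \<otimes>\<^bsub>R\<^esub> \<zero>\<^bsub>R\<^esub>" using y K.a_Hcarr by simp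
    then show "a \<in> K'" unfolding K'_eq using a by blast
  qed
  \<comment> \<open>The claim covers all free resolutions at once: the induction hypothesis is
    applied to a freshly chosen \<open>F\<close>, whose cone is then compared with the given
    \<open>P\<close>.\<close>
  have van: "vanishes R P \<delta> (quot R (J j)) j" if "j \<le> n" "free_resolution R (quot R (I j)) P \<delta> \<epsilon>"
    for j and P :: "nat \<Rightarrow> ('a, ('a, 'a set) res_elem) module" and \<delta> \<epsilon>
    using that
  proof (induction j arbitrary: P \<delta> \<epsilon>)
    case 0
    then have "resolution R (quot R (I 0)) P \<delta> \<epsilon>" using free_resolution_iff[OF mod[OF I]] by blast
    note id0 = I[OF le0] J[OF le0]
    show ?case
    proof (rule vanishes_0_cyclic[OF \<open>resolution R (quot R (I 0)) P \<delta> \<epsilon>\<close> mod[OF id0(2)] t, of "I 0 +>\<^bsub>R\<^esub> \<one>\<^bsub>R\<^esub>"])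
      show "I 0 +>\<^bsub>R\<^esub> \<one>\<^bsub>R\<^esub> \<in> carrier (quot R (I 0))" by (simp add: quot_simps(1))
    next
      fix m assume "m \<in> carrier (quot R (I 0))"
      then show "\<exists>r\<in>carrier R. m = r \<odot>\<^bsub>quot R (I 0)\<^esub> (I 0 +>\<^bsub>R\<^esub> \<one>\<^bsub>R\<^esub>)"
        by (auto simp: quot_smult[OF R id0(1)] quot_simps(1))
    next
      fix r assume r: "r \<in> carrier R"
      show "(r \<odot>\<^bsub>quot R (I 0)\<^esub> (I 0 +>\<^bsub>R\<^esub> \<one>\<^bsub>R\<^esub>) = \<zero>\<^bsub>quot R (I 0)\<^esub>) = (\<exists>u\<in>carrier R. r = u \<otimes>\<^bsub>R\<^esub> t)"
        unfolding quot_smult[OF R id0(1) r one_closed] quot_simps(2) r_one[OF r] quot_coset_zero_iff[OF R id0(1) r]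
        unfolding I0 by blast
    next
      fix c assume c: "c \<in> carrier (quot R (J 0))"
        and cs: "\<And>s. s \<in> carrier R \<Longrightarrow> s \<otimes>\<^bsub>R\<^esub> t = \<zero>\<^bsub>R\<^esub> \<Longrightarrow> s \<odot>\<^bsub>quot R (J 0)\<^esub> c = \<zero>\<^bsub>quot R (J 0)\<^esub>"
      obtain r where r: "r \<in> carrier R" "c = J 0 +>\<^bsub>R\<^esub> r" using c by (auto simp: quot_simps(1))
      have "\<exists>u\<in>carrier R. r \<ominus>\<^bsub>R\<^esub> t \<otimes>\<^bsub>R\<^esub> u \<in> J 0"
      proof (rule base[OF r(1)])
        fix s assume s: "s \<in> carrier R" "s \<otimes>\<^bsub>R\<^esub> t = \<zero>\<^bsub>R\<^esub>"
        show "s \<otimes>\<^bsub>R\<^esub> r \<in> J 0" using cs[OF s] s r quot_coset_zero_iff[OF R id0(2), of "s \<otimes>\<^bsub>R\<^esub> r"]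
          by (simp add: quot_smult[OF R id0(2)] quot_simps(2))
      qed
      then show "\<exists>m\<in>carrier (quot R (J 0)). c = t \<odot>\<^bsub>quot R (J 0)\<^esub> m"
        using r t by (auto simp: quot_simps(1) quot_smult[OF R id0(2)] coset_diff[OF id0(2)])
    qed
  next
    case (Suc j)
    have jn: "j < n" "j \<le> n" "Suc j \<le> n" using Suc.prems(1) by auto
    note ids = I[OF jn(2)] I[OF jn(3)] J[OF jn(2)] J[OF jn(3)] and xj = x[OF jn(1)]
    have fr: "resolution R (quot R (I (Suc j))) P \<delta> \<epsilon>" "free_module R (P k)" for k
      using free_resolution_iff[OF mod[OF ids(2)]] Suc.prems(2) by blast+
    obtain F :: "nat \<Rightarrow> ('a, ('a, 'a set) res_elem) module" and \<eta> \<theta> where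
      F: "free_resolution R (quot R (I j)) F \<eta> \<theta>"
      using free_resolution_exists[OF mod[OF ids(1)] nontriv] by blast
    have Fr: "resolution R (quot R (I j)) F \<eta> \<theta>" "free_module R (F k)" for k
      using free_resolution_iff[OF mod[OF ids(1)]] F by blast+
    have vF: "vanishes R F \<eta> (quot R (J j)) j" using Suc.IH[OF jn(2) F] .
    obtain \<pi> where \<pi>: "lin R (quot R (I j)) (quot R (I (Suc j))) \<pi>"
        "\<And>r. r \<in> carrier R \<Longrightarrow> \<pi> (I j +>\<^bsub>R\<^esub> r) = I (Suc j) +>\<^bsub>R\<^esub> r"
      using quot_map_exists[OF R ids(1,2) sub[OF ids(1) xj IS[OF jn(1)]]] by blast
    obtain \<rho> where \<rho>: "lin R (quot R (J (Suc j))) (quot R (J j)) \<rho>"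
        "\<And>r. r \<in> carrier R \<Longrightarrow> \<rho> (J (Suc j) +>\<^bsub>R\<^esub> r) = J j +>\<^bsub>R\<^esub> r"
      using quot_map_exists[OF R ids(4,3) sub[OF ids(4) xj JS[OF jn(1)]]] by blast
    have C: "resolution R (quot R (I (Suc j))) (cone F) (cone_diff F \<eta> (x j)) (\<lambda>u. \<pi> (\<theta> (fst u)))"
    proof (rule cone_resolution[OF Fr(1) mod[OF ids(2)] xj _ \<pi>(1)])
      show "\<pi> ` carrier (quot R (I j)) = carrier (quot R (I (Suc j)))"
        by (auto simp: quot_simps(1) \<pi>(2) image_image)
      show "m = \<zero>\<^bsub>quot R (I j)\<^esub>" if "m \<in> carrier (quot R (I j))" "x j \<odot>\<^bsub>quot R (I j)\<^esub> m = \<zero>\<^bsub>quot R (I j)\<^esub>" for m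
        using reg[OF ids(1) xj Ireg[OF jn(1)] that] .
      fix m assume "m \<in> carrier (quot R (I j))"
      then obtain r where r: "r \<in> carrier R" "m = I j +>\<^bsub>R\<^esub> r" by (auto simp: quot_simps(1))
      show "(\<pi> m = \<zero>\<^bsub>quot R (I (Suc j))\<^esub>) = (\<exists>m'\<in>carrier (quot R (I j)). m = x j \<odot>\<^bsub>quot R (I j)\<^esub> m')"
        using ker_iff[OF ids(1,2) xj IS[OF jn(1)] r(1)] by (simp add: r \<pi>(2) quot_simps(2))
    qed
    have "vanishes R (cone F) (cone_diff F \<eta> (x j)) (quot R (J (Suc j))) (Suc j)"
    proof (rule cone_vanishes[OF Fr(1,2) mod[OF ids(4)] mod[OF ids(3)] xj _ \<rho>(1) _ _ vF])
      show "\<rho> ` carrier (quot R (J (Suc j))) = carrier (quot R (J j))"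
        by (auto simp: quot_simps(1) \<rho>(2) image_image)
      show "m = \<zero>\<^bsub>quot R (J (Suc j))\<^esub>"
        if "m \<in> carrier (quot R (J (Suc j)))" "x j \<odot>\<^bsub>quot R (J (Suc j))\<^esub> m = \<zero>\<^bsub>quot R (J (Suc j))\<^esub>" for m
        using reg[OF ids(4) xj Jreg[OF jn(1)] that] .
      fix m assume "m \<in> carrier (quot R (J (Suc j)))"
      then obtain r where r: "r \<in> carrier R" "m = J (Suc j) +>\<^bsub>R\<^esub> r" by (auto simp: quot_simps(1))
      show "(\<rho> m = \<zero>\<^bsub>quot R (J j)\<^esub>) = (\<exists>m'\<in>carrier (quot R (J (Suc j))). m = x j \<odot>\<^bsub>quot R (J (Suc j))\<^esub> m')"
        using ker_iff[OF ids(4,3) xj JS[OF jn(1)] r(1)] by (simp add: r \<rho>(2) quot_simps(2))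
    qed
    then show ?case
      by (rule vanishes_comparison[OF fr C lifts_cone[OF Fr(2) resolutionD(1,2)[OF fr(1)]]
          lifts_cone[OF Fr(2) resolutionD(2,2)[OF fr(1)]] mod[OF ids(4)]])
  qed
  show ?thesis
  proof (rule Ext_zero[OF mod[OF I] self_module_module[OF R] free_resolution_exists[OF mod[OF I] nontriv]])
    fix P :: "nat \<Rightarrow> ('a, ('a, 'a set) res_elem) module" and \<delta> \<epsilon>
    assume F: "free_resolution R (quot R (I n)) P \<delta> \<epsilon>"
    have fr: "resolution R (quot R (I n)) P \<delta> \<epsilon>" "free_module R (P k)" for k
      using free_resolution_iff[OF mod[OF I]] F by blast+
    show "vanishes R P \<delta> (self_module R) n"
    proof (rule vanishes_transfer[OF fr self_module_module[OF R] mod[OF J[OF le_refl]] quot_proj[OF R J[OF le_refl]] _ _ van[OF le_refl F]])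
      show "inj_on (\<lambda>r. J n +>\<^bsub>R\<^esub> r) (carrier (self_module R))"
      proof (rule inj_onI)
        fix a b assume "a \<in> carrier (self_module R)" "b \<in> carrier (self_module R)" and eq: "J n +>\<^bsub>R\<^esub> a = J n +>\<^bsub>R\<^esub> b"
        then have ab: "a \<in> carrier R" "b \<in> carrier R" by simp_all
        then have "a \<ominus>\<^bsub>R\<^esub> b \<in> J n" using eq coset_diff[OF J[OF le_refl]] by blast
        then show "a = b" using ab by (simp add: Jn minus_eq_zero_iff)
      qed
      show "(\<lambda>r. J n +>\<^bsub>R\<^esub> r) ` carrier (self_module R) = carrier (quot R (J n))" by (simp add: quot_simps(1))
    qed
  qed simp_all
qed

section \<open>Polynomials and their localisation at the origin\<close>

type_synonym mpol = "(nat \<Rightarrow>\<^sub>0 nat) \<Rightarrow>\<^sub>0 complex"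
type_synonym ratfun = "mpol fract"

lemma mpol_expand: "f = (\<Sum>m\<in>Poly_Mapping.keys f. Poly_Mapping.single m (Poly_Mapping.lookup f m))" for f :: "'a \<Rightarrow>\<^sub>0 'b::comm_monoid_add"
proof (rule poly_mapping_eqI)
  fix k
  show "Poly_Mapping.lookup f k = Poly_Mapping.lookup (\<Sum>m\<in>Poly_Mapping.keys f. Poly_Mapping.single m (Poly_Mapping.lookup f m)) k"
    by (cases "k \<in> Poly_Mapping.keys f")
      (simp_all add: lookup_sum lookup_single when_def in_keys_iff)
qed

lemma keys_plus_nat: "Poly_Mapping.keys (a + b) = Poly_Mapping.keys a \<union> Poly_Mapping.keys b"
  for a b :: "nat \<Rightarrow>\<^sub>0 nat"
  by (auto simp: in_keys_iff lookup_add)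

text \<open>\<open>Pol S\<close> consists of the polynomials in the variables with index in \<open>S\<close>, and \<open>kill S\<close> substitutes
  0 for these variables.\<close>

definition Pol :: "nat set \<Rightarrow> mpol set" where
  "Pol S = {f. \<forall>m\<in>Poly_Mapping.keys f. Poly_Mapping.keys m \<subseteq> S}"

definition Xv :: "nat \<Rightarrow> mpol" where
  "Xv j = Poly_Mapping.single (Poly_Mapping.single j 1) 1"

lift_definition kill :: "nat set \<Rightarrow> mpol \<Rightarrow> mpol" is
  "\<lambda>S f m. if Poly_Mapping.keys m \<inter> S = {} then f m else 0"
  by (rule finite_subset) auto

abbreviation const0 :: "mpol \<Rightarrow> complex" where "const0 f \<equiv> Poly_Mapping.lookup f 0"

lemma lookup_kill: "Poly_Mapping.lookup (kill S f) m = (if Poly_Mapping.keys m \<inter> S = {} then Poly_Mapping.lookup f m else 0)"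
  by transfer simp

lemma keys_kill: "m \<in> Poly_Mapping.keys (kill S f) \<longleftrightarrow> m \<in> Poly_Mapping.keys f \<and> Poly_Mapping.keys m \<inter> S = {}"
  by (auto simp: in_keys_iff lookup_kill)

lemma kill_0 [simp]: "kill S 0 = 0"
  by (rule poly_mapping_eqI) (simp add: lookup_kill)

lemma kill_add: "kill S (f + g) = kill S f + kill S g"
  by (rule poly_mapping_eqI) (simp add: lookup_kill lookup_add)

lemma kill_diff: "kill S (f - g) = kill S f - kill S g"
  by (rule poly_mapping_eqI) (simp add: lookup_kill lookup_minus)

lemma kill_sum: "kill S (sum f A) = (\<Sum>a\<in>A. kill S (f a))"
  by (induction A rule: infinite_finite_induct) (simp_all add: kill_add)

lemma kill_single: "kill S (Poly_Mapping.single m a) = (if Poly_Mapping.keys m \<inter> S = {} then Poly_Mapping.single m a else 0)"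
  by (rule poly_mapping_eqI) (auto simp: lookup_kill lookup_single when_def)

text \<open>Exponents are natural numbers and cannot cancel, so a product of monomials avoids S
  exactly if both factors do; bilinearity extends this to polynomials.\<close>

lemma kill_mult: "kill S (f * g) = kill S f * kill S g"
proof -
  have s: "kill S (Poly_Mapping.single m a * Poly_Mapping.single n b) =
      kill S (Poly_Mapping.single m a) * kill S (Poly_Mapping.single n b)" for m n a b
    by (auto simp: mult_single kill_single keys_plus_nat)
  have "kill S ((\<Sum>m\<in>A. Poly_Mapping.single m (a m)) * (\<Sum>n\<in>B. Poly_Mapping.single n (b n))) =
     kill S (\<Sum>m\<in>A. Poly_Mapping.single m (a m)) * kill S (\<Sum>n\<in>B. Poly_Mapping.single n (b n))" for A B a b
    by (simp add: sum_product kill_sum s)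
  from this[where A = "Poly_Mapping.keys f" and B = "Poly_Mapping.keys g" and a = "Poly_Mapping.lookup f" and b = "Poly_Mapping.lookup g"]
  show ?thesis by (simp only: mpol_expand[symmetric])
qed

lemma kill_1 [simp]: "kill S 1 = 1"
  using kill_single[of S 0 1] by simp

lemma kill_kill: "kill S (kill T f) = kill (S \<union> T) f"
  by (rule poly_mapping_eqI) (auto simp: lookup_kill)

lemma kill_Xv: "kill S (Xv j) = (if j \<in> S then 0 else Xv j)"
  by (simp add: Xv_def kill_single)

lemma const0_kill [simp]: "const0 (kill S f) = const0 f"
  by (simp add: lookup_kill)

lemma kill_UNIV: "kill UNIV f = Poly_Mapping.single 0 (const0 f)"
proof (rule poly_mapping_eqI)
  fix m :: "nat \<Rightarrow>\<^sub>0 nat"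
  have "Poly_Mapping.keys m = {} \<longleftrightarrow> m = 0" using poly_mapping_eqI[of m 0] by (auto simp: in_keys_iff)
  then show "Poly_Mapping.lookup (kill UNIV f) m = Poly_Mapping.lookup (Poly_Mapping.single 0 (const0 f)) m"
    by (auto simp: lookup_kill lookup_single when_def)
qed

lemma const0_mult: "const0 (f * g) = const0 f * const0 g"
proof -
  have "Poly_Mapping.single 0 (const0 (f * g)) = Poly_Mapping.single (0 :: nat \<Rightarrow>\<^sub>0 nat) (const0 f * const0 g)"
    using kill_mult[of UNIV f g] by (simp add: kill_UNIV mult_single)
  then show ?thesis by (metis lookup_single_eq)
qed

lemma const0_nz:
  assumes "const0 f \<noteq> 0"
  shows "f \<noteq> 0" "kill S f \<noteq> 0"
  using assms by (metis lookup_zero, metis const0_kill lookup_zero)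

lemma Pol_closed:
  "0 \<in> Pol S" "1 \<in> Pol S" "f \<in> Pol S \<Longrightarrow> g \<in> Pol S \<Longrightarrow> f + g \<in> Pol S"
  "f \<in> Pol S \<Longrightarrow> g \<in> Pol S \<Longrightarrow> f * g \<in> Pol S" "f \<in> Pol S \<Longrightarrow> - f \<in> Pol S"
  "f \<in> Pol S \<Longrightarrow> g \<in> Pol S \<Longrightarrow> f - g \<in> Pol S" "f \<in> Pol S \<Longrightarrow> kill T f \<in> Pol (S - T)"
  "j \<in> S \<Longrightarrow> Xv j \<in> Pol S" "Poly_Mapping.single 0 c \<in> Pol S"
proof -
  show "0 \<in> Pol S" "1 \<in> Pol S" "f \<in> Pol S \<Longrightarrow> - f \<in> Pol S" "j \<in> S \<Longrightarrow> Xv j \<in> Pol S"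
    "Poly_Mapping.single 0 c \<in> Pol S"
    by (auto simp: Pol_def Xv_def)
  show "f \<in> Pol S \<Longrightarrow> kill T f \<in> Pol (S - T)" by (auto simp: Pol_def keys_kill)
  show add: "f \<in> Pol S \<Longrightarrow> g \<in> Pol S \<Longrightarrow> f + g \<in> Pol S" for f g
    unfolding Pol_def using Poly_Mapping.keys_add[of f g] by blast
  show "f \<in> Pol S \<Longrightarrow> g \<in> Pol S \<Longrightarrow> f - g \<in> Pol S"
    using add[of f "- g"] by (auto simp: Pol_def)
  show "f \<in> Pol S \<Longrightarrow> g \<in> Pol S \<Longrightarrow> f * g \<in> Pol S"
    unfolding Pol_def using keys_mult[of f g] by (fastforce simp: keys_plus_nat)
qed

lemma Pol_sum: "(\<And>a. a \<in> A \<Longrightarrow> f a \<in> Pol S) \<Longrightarrow> sum f A \<in> Pol S"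
  by (induction A rule: infinite_finite_induct) (auto simp: Pol_closed)

lemma Pol_mono: "S \<subseteq> T \<Longrightarrow> Pol S \<subseteq> Pol T"
  by (auto simp: Pol_def)

lemma kill_id: "f \<in> Pol S \<Longrightarrow> S \<inter> T = {} \<Longrightarrow> kill T f = f"
proof (rule poly_mapping_eqI)
  fix m assume "f \<in> Pol S" "S \<inter> T = {}"
  then show "Poly_Mapping.lookup (kill T f) m = Poly_Mapping.lookup f m"
    unfolding lookup_kill Pol_def mem_Collect_eq using in_keys_iff[of m f] by (metis inf.orderE inf_assoc inf_bot_right)
qed

text \<open>If no monomial survives the substitution x_j = 0, each contains x_j and its exponent
  there can be lowered by one; truncated subtraction is exact on such monomials.\<close>

lemma Xv_dvd:
  assumes f: "f \<in> Pol S" and k: "kill {j} f = 0"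
  shows "\<exists>g\<in>Pol S. f = Xv j * g"
proof -
  let ?e = "Poly_Mapping.single j (1::nat)"
  let ?g = "\<Sum>m\<in>Poly_Mapping.keys f. Poly_Mapping.single (m - ?e) (Poly_Mapping.lookup f m)"
  have j: "j \<in> Poly_Mapping.keys m" if "m \<in> Poly_Mapping.keys f" for m
  proof (rule ccontr)
    assume "j \<notin> Poly_Mapping.keys m"
    then have "m \<in> Poly_Mapping.keys (kill {j} f)" using that by (simp add: keys_kill)
    then show False using k by simp
  qed
  have e: "?e + (m - ?e) = m" if "m \<in> Poly_Mapping.keys f" for m
    using j[OF that] by (intro poly_mapping_eqI) (auto simp: lookup_add lookup_minus lookup_single when_def in_keys_iff)
  have "Poly_Mapping.keys (m - ?e) \<subseteq> S" if "m \<in> Poly_Mapping.keys f" for m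
  proof -
    have "Poly_Mapping.keys (m - ?e) \<subseteq> Poly_Mapping.keys m" by (auto simp: in_keys_iff lookup_minus)
    then show ?thesis using f that by (auto simp: Pol_def)
  qed
  then have "?g \<in> Pol S" by (intro Pol_sum) (auto simp: Pol_def)
  moreover have "Xv j * ?g = (\<Sum>m\<in>Poly_Mapping.keys f. Poly_Mapping.single m (Poly_Mapping.lookup f m))"
    unfolding Xv_def sum_distrib_left by (rule sum.cong) (simp_all only: mult_single e mult_1)
  then have "f = Xv j * ?g" using mpol_expand[of f] by simp
  ultimately show ?thesis by blast
qed

section \<open>Rational functions regular at the origin\<close>

definition em :: "mpol \<Rightarrow> ratfun" where "em f = Fraction_Field.Fract f 1"

lemma em_simps [simp]: "em 0 = 0" "em 1 = 1" "em (f + g) = em f + em g" "em (f * g) = em f * em g"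
  "em (- f) = - em f" "em (f - g) = em f - em g"
  by (simp_all add: em_def Zero_fract_def One_fract_def)

lemma em_eq_iff [simp]: "em f = em g \<longleftrightarrow> f = g"
  by (simp add: em_def eq_fract)

lemma em_eq_0_iff [simp]: "em f = 0 \<longleftrightarrow> f = 0"
  using em_eq_iff[of f 0] by (simp del: em_eq_iff)

lemma em_power [simp]: "em (f ^ n) = em f ^ n"
  by (induction n) simp_all

lemma ratfun_eq_quotient: "\<exists>f g. g \<noteq> 0 \<and> b = em f / em g"
  by (cases b) (auto simp: em_def)

text \<open>The localisation of \<open>Pol S\<close> at the origin, with the extension of \<open>kill S\<close> to it. The
  condition in \<open>lkill\<close> is vacuous, and the value junk, for fractions all of whose denominators vanish
  at the origin.\<close>

definition Loc :: "nat set \<Rightarrow> ratfun set" where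
  "Loc S = {em f / em g | f g. f \<in> Pol S \<and> g \<in> Pol S \<and> const0 g \<noteq> 0}"

definition lkill :: "nat set \<Rightarrow> ratfun \<Rightarrow> ratfun" where
  "lkill S b = (THE c. \<forall>f g. const0 g \<noteq> 0 \<longrightarrow> b = em f / em g \<longrightarrow> c = em (kill S f) / em (kill S g))"

definition xv :: "nat \<Rightarrow> ratfun" where "xv j = em (Xv j)"

lemma LocI: "f \<in> Pol S \<Longrightarrow> g \<in> Pol S \<Longrightarrow> const0 g \<noteq> 0 \<Longrightarrow> em f / em g \<in> Loc S"
  by (auto simp: Loc_def)

lemma LocE:
  assumes "b \<in> Loc S"
  obtains f g where "f \<in> Pol S" "g \<in> Pol S" "const0 g \<noteq> 0" "g \<noteq> 0" "b = em f / em g"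
  using assms const0_nz(1) unfolding Loc_def by auto

lemma Loc_em: "f \<in> Pol S \<Longrightarrow> em f \<in> Loc S"
  using LocI[of f S 1] by (simp add: Pol_closed)

lemma Loc_mono: "S \<subseteq> T \<Longrightarrow> Loc S \<subseteq> Loc T"
  using Pol_mono[of S T] unfolding Loc_def by blast

lemma Loc_closed:
  "0 \<in> Loc S" "1 \<in> Loc S" "a \<in> Loc S \<Longrightarrow> b \<in> Loc S \<Longrightarrow> a + b \<in> Loc S"
  "a \<in> Loc S \<Longrightarrow> b \<in> Loc S \<Longrightarrow> a * b \<in> Loc S" "a \<in> Loc S \<Longrightarrow> - a \<in> Loc S"
  "a \<in> Loc S \<Longrightarrow> b \<in> Loc S \<Longrightarrow> a - b \<in> Loc S" "j \<in> S \<Longrightarrow> xv j \<in> Loc S"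
proof -
  show "0 \<in> Loc S" "1 \<in> Loc S" "j \<in> S \<Longrightarrow> xv j \<in> Loc S"
    using Loc_em[of 0 S] Loc_em[of 1 S] Loc_em[of "Xv j" S] by (auto simp: Pol_closed xv_def)
  show add: "a + b \<in> Loc S" if ab: "a \<in> Loc S" "b \<in> Loc S" for a b
  proof -
    from ab obtain f g f' g' where *: "f \<in> Pol S" "g \<in> Pol S" "const0 g \<noteq> 0" "g \<noteq> 0" "a = em f / em g"
      "f' \<in> Pol S" "g' \<in> Pol S" "const0 g' \<noteq> 0" "g' \<noteq> 0" "b = em f' / em g'"
      by (metis LocE)
    then have "a + b = em (f * g' + f' * g) / em (g * g')" by (simp add: field_simps)
    then show ?thesis using * LocI[of "f * g' + f' * g" S "g * g'"] by (simp add: Pol_closed const0_mult)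
  qed
  show neg: "- a \<in> Loc S" if "a \<in> Loc S" for a
    using that by (elim LocE) (metis LocI Pol_closed(5) em_simps(5) minus_divide_left)
  show "a - b \<in> Loc S" if "a \<in> Loc S" "b \<in> Loc S" using add[OF that(1) neg[OF that(2)]] by simp
  show "a * b \<in> Loc S" if ab: "a \<in> Loc S" "b \<in> Loc S"
  proof -
    from ab obtain f g f' g' where *: "f \<in> Pol S" "g \<in> Pol S" "const0 g \<noteq> 0" "g \<noteq> 0" "a = em f / em g"
      "f' \<in> Pol S" "g' \<in> Pol S" "const0 g' \<noteq> 0" "g' \<noteq> 0" "b = em f' / em g'"
      by (metis LocE)
    then have "a * b = em (f * f') / em (g * g')" by simp
    then show ?thesis using * LocI[of "f * f'" S "g * g'"] by (simp add: Pol_closed const0_mult)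
  qed
qed

text \<open>Cross-multiplying two representations and applying \<open>kill\<close> shows
  independence of the fraction chosen. Denominators stay nonzero because \<open>kill\<close>
  preserves the constant term.\<close>

lemma lkill_eq:
  assumes "const0 g \<noteq> 0"
  shows "lkill S (em f / em g) = em (kill S f) / em (kill S g)"
proof -
  have "em (kill S f) / em (kill S g) = em (kill S f') / em (kill S g')"
    if "const0 g' \<noteq> 0" "em f / em g = em f' / em g'" for f' g'
  proof -
    note nz = const0_nz(1)[OF assms] const0_nz(2)[OF assms, of S] const0_nz(1)[OF that(1)] const0_nz(2)[OF that(1), of S]
    have "em (f * g') = em (f' * g)" using that(2) nz by (simp add: field_simps)
    then have "kill S (f * g') = kill S (f' * g)" by (simp only: em_eq_iff)
    then have "em (kill S f * kill S g') = em (kill S f' * kill S g)" by (simp only: kill_mult)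
    then show ?thesis using nz by (simp add: field_simps)
  qed
  then show ?thesis unfolding lkill_def using assms by (intro the_equality) metis+
qed

lemma lkill_em: "lkill S (em f) = em (kill S f)"
  using lkill_eq[of 1 S f] by simp

lemma lkill_xv: "lkill S (xv j) = (if j \<in> S then 0 else xv j)"
  by (simp add: xv_def lkill_em kill_Xv)

lemma lkill_0 [simp]: "lkill S 0 = 0" and lkill_1 [simp]: "lkill S 1 = 1"
  using lkill_em[of S 0] lkill_em[of S 1] by simp_all

lemma
  assumes "a \<in> Loc U" "b \<in> Loc U"
  shows lkill_add: "lkill S (a + b) = lkill S a + lkill S b"
    and lkill_mult: "lkill S (a * b) = lkill S a * lkill S b"
    and lkill_diff: "lkill S (a - b) = lkill S a - lkill S b"
proof -
  from assms obtain f g f' g' where *: "const0 g \<noteq> 0" "g \<noteq> 0" "a = em f / em g"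
      "const0 g' \<noteq> 0" "g' \<noteq> 0" "b = em f' / em g'"
    by (metis LocE)
  note nz = const0_nz(1)[OF *(1)] const0_nz(2)[OF *(1), of S] const0_nz(1)[OF *(4)] const0_nz(2)[OF *(4), of S]
  have c: "const0 (g * g') \<noteq> 0" using * by (simp add: const0_mult)
  have "a + b = em (f * g' + f' * g) / em (g * g')" unfolding *(3,6) using *(2,5) by (simp add: field_simps)
  then show "lkill S (a + b) = lkill S a + lkill S b"
    using nz unfolding *(3,6) lkill_eq[OF *(1)] lkill_eq[OF *(4)]
    by (simp only: lkill_eq[OF c]) (simp add: kill_add kill_mult field_simps)
  have "a - b = em (f * g' - f' * g) / em (g * g')" unfolding *(3,6) using *(2,5) by (simp add: field_simps)
  then show "lkill S (a - b) = lkill S a - lkill S b"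
    using nz unfolding *(3,6) lkill_eq[OF *(1)] lkill_eq[OF *(4)]
    by (simp only: lkill_eq[OF c]) (simp add: kill_diff kill_mult field_simps)
  have "a * b = em (f * f') / em (g * g')" using * by simp
  then show "lkill S (a * b) = lkill S a * lkill S b"
    using nz unfolding *(3,6) lkill_eq[OF *(1)] lkill_eq[OF *(4)]
    by (simp only: lkill_eq[OF c]) (simp add: kill_mult field_simps)
qed

lemma lkill_Loc: "b \<in> Loc U \<Longrightarrow> lkill S b \<in> Loc (U - S)"
  by (elim LocE) (simp add: lkill_eq LocI Pol_closed)

lemma lkill_Loc': "b \<in> Loc U \<Longrightarrow> lkill S b \<in> Loc U"
  using lkill_Loc Loc_mono[of "U - S" U] by blast

lemma lkill_id: "b \<in> Loc U \<Longrightarrow> U \<inter> S = {} \<Longrightarrow> lkill S b = b"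
  by (elim LocE) (simp add: lkill_eq kill_id)

lemma lkill_lkill: "b \<in> Loc U \<Longrightarrow> lkill S (lkill T b) = lkill (S \<union> T) b"
  by (elim LocE) (simp add: lkill_eq kill_kill)

lemma lkill_eq_0_dvd:
  assumes b: "b \<in> Loc U" and k: "lkill {j} b = 0"
  shows "\<exists>c\<in>Loc U. b = xv j * c"
proof -
  obtain f g where *: "f \<in> Pol U" "g \<in> Pol U" "const0 g \<noteq> 0" "g \<noteq> 0" "b = em f / em g"
    using b by (rule LocE)
  then have "kill {j} f = 0" using k const0_nz(2)[OF *(3)] by (simp add: lkill_eq)
  then obtain h where h: "h \<in> Pol U" "f = Xv j * h" using Xv_dvd *(1) by blast
  then show ?thesis using * by (intro bexI[of _ "em h / em g"]) (auto simp: xv_def LocI)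
qed

text \<open>Substituting 0 for all variables leaves the constant term, so the hypothesis allows
  numerator and denominator to change places.\<close>

lemma Loc_inverse:
  assumes b: "b \<in> Loc U" and k: "lkill UNIV b \<noteq> 0"
  shows "inverse b \<in> Loc U"
proof -
  obtain f g where *: "f \<in> Pol U" "g \<in> Pol U" "const0 g \<noteq> 0" "g \<noteq> 0" "b = em f / em g"
    using b by (rule LocE)
  then have "const0 f \<noteq> 0" using k by (auto simp: lkill_eq kill_UNIV)
  then show ?thesis using * LocI[of g U f] by simp
qed

lemma xv_nonzero [simp]: "xv j \<noteq> 0"
proof -
  have "Poly_Mapping.lookup (Xv j) (Poly_Mapping.single j 1) \<noteq> Poly_Mapping.lookup 0 (Poly_Mapping.single j 1)"
    by (simp add: Xv_def)
  then have "Xv j \<noteq> 0" by metis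
  then show ?thesis by (simp add: xv_def)
qed

section \<open>Noetherianness\<close>

text \<open>Subrings of a type of class \<open>comm_ring_1\<close> are treated as sets; ideals and prime ideals are
  relative to such a subring \<open>A\<close>.\<close>

definition sideal :: "'r::comm_ring_1 set \<Rightarrow> 'r set \<Rightarrow> bool" where
  "sideal A I \<longleftrightarrow> I \<subseteq> A \<and> 0 \<in> I \<and> (\<forall>x\<in>I. \<forall>y\<in>I. x + y \<in> I) \<and> (\<forall>a\<in>A. \<forall>x\<in>I. a * x \<in> I)"

definition generates :: "'r::comm_ring_1 set \<Rightarrow> 'r set \<Rightarrow> 'r set \<Rightarrow> bool" where
  "generates A F I \<longleftrightarrow> F \<subseteq> I \<and> (\<forall>J. sideal A J \<longrightarrow> F \<subseteq> J \<longrightarrow> I \<subseteq> J)"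

definition noeth :: "'r::comm_ring_1 set \<Rightarrow> bool" where
  "noeth A \<longleftrightarrow> (\<forall>I. sideal A I \<longrightarrow> (\<exists>F. finite F \<and> generates A F I))"

lemma sidealD:
  assumes "sideal A I"
  shows "I \<subseteq> A" "0 \<in> I" "x \<in> I \<Longrightarrow> y \<in> I \<Longrightarrow> x + y \<in> I" "a \<in> A \<Longrightarrow> x \<in> I \<Longrightarrow> a * x \<in> I"
  using assms by (auto simp: sideal_def)

section \<open>Dickson's lemma and the monomial order\<close>

lemma nat_seq_mono_subseq:
  fixes s :: "nat \<Rightarrow> nat"
  shows "\<exists>r :: nat \<Rightarrow> nat. strict_mono r \<and> incseq (\<lambda>i. s (r i))"
proof -
  obtain r :: "nat \<Rightarrow> nat" where r: "strict_mono r" "monoseq (\<lambda>n. s (r n))" using seq_monosub by blast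
  show ?thesis
  proof (cases "incseq (\<lambda>n. s (r n))")
    case False
    then have dec: "decseq (\<lambda>n. s (r n))" using r(2) monoseq_iff by blast
    \<comment> \<open>A decreasing sequence of natural numbers is constant from its minimum on, and
      a constant tail is increasing.\<close>
    define N where "N = (ARG_MIN (\<lambda>n. s (r n)) n. True)"
    have "s (r N) \<le> s (r n)" for n unfolding N_def by (rule arg_min_nat_le) simp
    then have eq: "s (r (N + n)) = s (r N)" for n using decseqD[OF dec, of N "N + n"] by (simp add: antisym)
    have "strict_mono (\<lambda>n. r (N + n))" using r(1) by (simp add: strict_mono_def)
    moreover have "incseq (\<lambda>n. s (r (N + n)))" by (simp add: eq)
    ultimately show ?thesis by blast
  qed (use r in blast)
qed

lemma dickson_subseq:
  fixes s :: "nat \<Rightarrow> 'b \<Rightarrow> nat"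
  assumes "finite S"
  shows "\<exists>r :: nat \<Rightarrow> nat. strict_mono r \<and> (\<forall>x\<in>S. incseq (\<lambda>i. s (r i) x))"
  using assms
proof (induction S)
  case empty
  show ?case by (intro exI[of _ "\<lambda>i. i"]) (simp add: strict_mono_def)
next
  case (insert a S)
  then obtain r :: "nat \<Rightarrow> nat" where r: "strict_mono r" "\<forall>x\<in>S. incseq (\<lambda>i. s (r i) x)" by blast
  obtain q :: "nat \<Rightarrow> nat" where q: "strict_mono q" "incseq (\<lambda>i. s (r (q i)) a)"
    using nat_seq_mono_subseq[of "\<lambda>i. s (r i) a"] by blast
  have "strict_mono (\<lambda>i. r (q i))" using r(1) q(1) by (simp add: strict_mono_def)
  moreover have "incseq (\<lambda>i. s (r (q i)) x)" if "x \<in> insert a S" for x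
  proof (cases "x = a")
    case False
    then have "incseq (\<lambda>i. s (r i) x)" using r that by simp
    then show ?thesis using strict_mono_mono[OF q(1)] by (auto simp: incseq_def mono_def)
  qed (use q in simp)
  ultimately show ?case by blast
qed

text \<open>Dickson's lemma: among the monomials of a sequence one divides a later one. Two terms of
  a subsequence increasing in every coordinate suffice.\<close>

lemma dickson:
  fixes m :: "nat \<Rightarrow> (nat \<Rightarrow>\<^sub>0 nat)"
  assumes "finite S" "\<And>i. Poly_Mapping.keys (m i) \<subseteq> S"
  shows "\<exists>i j. i < j \<and> (\<exists>n. m j = m i + n \<and> Poly_Mapping.keys n \<subseteq> S)"
proof -
  obtain r :: "nat \<Rightarrow> nat" where r: "strict_mono r" "\<And>x. x \<in> S \<Longrightarrow> incseq (\<lambda>i. Poly_Mapping.lookup (m (r i)) x)"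
    using dickson_subseq[OF assms(1), of "\<lambda>i. Poly_Mapping.lookup (m i)"] by blast
  have le: "Poly_Mapping.lookup (m (r 0)) x \<le> Poly_Mapping.lookup (m (r 1)) x" for x
  proof (cases "x \<in> S")
    case False
    then have "x \<notin> Poly_Mapping.keys (m (r 0))" using assms(2) by blast
    then show ?thesis by (simp add: in_keys_iff)
  qed (use r(2)[of x] in \<open>simp add: incseq_def\<close>)
  have "m (r 1) = m (r 0) + (m (r 1) - m (r 0))"
    by (rule poly_mapping_eqI) (simp only: lookup_add lookup_minus le_add_diff_inverse[OF le])
  moreover have "Poly_Mapping.keys (m (r 1) - m (r 0)) \<subseteq> Poly_Mapping.keys (m (r 1))"
    by (auto simp: in_keys_iff lookup_minus)
  moreover have "r 0 < r 1" using r(1) by (simp add: strict_mono_def)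
  ultimately show ?thesis using assms(2) by blast
qed

text \<open>The order compares two exponent vectors at the first index where they differ, so a
  nonzero vector lies above 0. With compatibility with addition this makes it a monomial
  order.\<close>

lemma monomial_nonneg: "0 \<le> (m :: nat \<Rightarrow>\<^sub>0 nat)"
proof (cases "m = 0")
  case False
  then have ne: "Poly_Mapping.keys m \<noteq> {}" using poly_mapping_eqI[of m 0] by (auto simp: in_keys_iff)
  let ?k = "Min (Poly_Mapping.keys m)"
  have "?k \<in> Poly_Mapping.keys m" using ne by simp
  moreover have "Poly_Mapping.lookup m k' = 0" if "k' < ?k" for k'
    using that ne by (metis Min_le finite_keys in_keys_iff leD)
  ultimately have "less_fun (Poly_Mapping.lookup 0) (Poly_Mapping.lookup m)"
    unfolding less_fun_def by (intro exI[of _ ?k]) (auto simp: in_keys_iff)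
  then show ?thesis by (simp add: less_eq_poly_mapping.rep_eq)
qed simp

text \<open>By Dickson's lemma a descending chain would contain a monomial dividing a later one, but
  a multiple is never smaller.\<close>

lemma wf_monomials:
  assumes "finite S"
  shows "wf {(m, m'). Poly_Mapping.keys m \<subseteq> S \<and> Poly_Mapping.keys m' \<subseteq> S \<and> m < (m' :: nat \<Rightarrow>\<^sub>0 nat)}"
  unfolding wf_iff_no_infinite_down_chain
proof
  assume "\<exists>f. \<forall>i. (f (Suc i), f i) \<in> {(m, m'). Poly_Mapping.keys m \<subseteq> S \<and> Poly_Mapping.keys m' \<subseteq> S \<and> m < (m' :: nat \<Rightarrow>\<^sub>0 nat)}"
  then obtain f :: "nat \<Rightarrow> (nat \<Rightarrow>\<^sub>0 nat)" where f: "\<And>i. Poly_Mapping.keys (f i) \<subseteq> S" "\<And>i. f (Suc i) < f i" by auto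
  obtain i j n where "i < j" "f j = f i + n" using dickson[OF assms f(1)] by blast
  moreover have "f j < f i" using \<open>i < j\<close>
    by (induct i j rule: less_Suc_induct) (auto intro: f(2) less_trans)
  ultimately show False using add_left_mono[OF monomial_nonneg[of n], of "f i"] by simp
qed

lemma lookup_single_mult:
  fixes g :: mpol
  shows "Poly_Mapping.lookup (Poly_Mapping.single n c * g) (n + k) = c * Poly_Mapping.lookup g k"
proof -
  have "Poly_Mapping.single n c * g = Poly_Mapping.single n c * (\<Sum>m\<in>Poly_Mapping.keys g. Poly_Mapping.single m (Poly_Mapping.lookup g m))"
    using mpol_expand[of g] by simp
  also have "\<dots> = (\<Sum>m\<in>Poly_Mapping.keys g. Poly_Mapping.single (n + m) (c * Poly_Mapping.lookup g m))"
    by (simp only: sum_distrib_left mult_single)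
  finally show ?thesis
    by (cases "k \<in> Poly_Mapping.keys g") (simp_all add: lookup_sum lookup_single when_def in_keys_iff)
qed

section \<open>Leading monomials and Hilbert's basis theorem\<close>

definition lm :: "mpol \<Rightarrow> (nat \<Rightarrow>\<^sub>0 nat)" where
  "lm f = Max (Poly_Mapping.keys f)"

lemma keys_nonempty: "f \<noteq> 0 \<Longrightarrow> Poly_Mapping.keys f \<noteq> {}"
  using poly_mapping_eqI[of f 0] by (auto simp: in_keys_iff)

lemma lm_in_keys: "f \<noteq> 0 \<Longrightarrow> lm f \<in> Poly_Mapping.keys f"
  unfolding lm_def using keys_nonempty by simp

lemma le_lm: "m \<in> Poly_Mapping.keys f \<Longrightarrow> m \<le> lm f"
  unfolding lm_def by simp

text \<open>One division step: subtract the monomial multiple of g that cancels the leading term of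
  f. Multiplication by a monomial respects the order, so nothing larger appears.\<close>

lemma leading_term_reduction:
  assumes f: "f \<in> Pol S" "f \<noteq> 0" and g: "g \<in> Pol S" "g \<noteq> 0"
    and n: "lm f = lm g + n" "Poly_Mapping.keys n \<subseteq> S"
  shows "\<exists>q\<in>Pol S. f - q * g = 0 \<or> lm (f - q * g) < lm f"
proof -
  define c where "c = Poly_Mapping.lookup f (lm f) / Poly_Mapping.lookup g (lm g)"
  let ?q = "Poly_Mapping.single n c" and ?h = "f - Poly_Mapping.single n c * g"
  have q: "?q \<in> Pol S" using n(2) by (auto simp: Pol_def)
  have "Poly_Mapping.lookup g (lm g) \<noteq> 0" using lm_in_keys[OF g(2)] by (simp add: in_keys_iff)
  then have "Poly_Mapping.lookup ?h (lm f) = 0"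
    using lookup_single_mult[of n c g "lm g"] by (simp add: lookup_minus n(1) add.commute c_def)
  moreover have "m \<le> lm f" if "m \<in> Poly_Mapping.keys ?h" for m
  proof -
    have "m \<in> Poly_Mapping.keys f \<or> m \<in> Poly_Mapping.keys (?q * g)"
      using that by (auto simp: in_keys_iff lookup_minus)
    then show ?thesis
    proof
      assume "m \<in> Poly_Mapping.keys (?q * g)"
      then obtain a where "m = n + a" "a \<in> Poly_Mapping.keys g"
        using keys_mult[of ?q g] by (auto split: if_splits)
      then show ?thesis using add_left_mono[OF le_lm, of a g n] n(1) by (simp add: add.commute)
    qed (rule le_lm)
  qed
  ultimately have "?h = 0 \<or> lm ?h < lm f"
    using lm_in_keys[of ?h] by (metis in_keys_iff order_le_less)
  then show ?thesis using q by blast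
qed

text \<open>If I had no finite generating set, one could forever pick an element of I outside the
  ideal of the earlier picks, each time with minimal leading monomial. Dickson's lemma finds a pick
  whose leading monomial divides that of a later one, and a division step contradicts
  minimality.\<close>

lemma noeth_Pol:
  assumes "finite S"
  shows "noeth (Pol S)"
  unfolding noeth_def
proof (intro allI impI, rule ccontr)
  fix I assume I: "sideal (Pol S) I" and nf: "\<nexists>F. finite F \<and> generates (Pol S) F I"
  define G where "G F = \<Inter>{J. sideal (Pol S) J \<and> F \<subseteq> J}" for F
  have IP: "sideal (Pol S) (Pol S)" by (auto simp: sideal_def Pol_closed)
  have ne: "I - G F \<noteq> {}" if "finite F" "F \<subseteq> I" for F
    using nf that unfolding generates_def G_def by blast
  let ?r = "{(m, m'). Poly_Mapping.keys m \<subseteq> S \<and> Poly_Mapping.keys m' \<subseteq> S \<and> m < (m' :: nat \<Rightarrow>\<^sub>0 nat)}"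
  have minex: "\<exists>f\<in>I - G F. \<forall>h\<in>I - G F. (lm h, lm f) \<notin> ?r" if F: "finite F" "F \<subseteq> I" for F
  proof -
    obtain x where "x \<in> I - G F" using ne[OF F] by blast
    then show ?thesis
    proof (rule wfE_min[OF wf_inv_image[OF wf_monomials[OF assms], of lm]])
      fix z assume z: "z \<in> I - G F" "\<And>y. (y, z) \<in> inv_image ?r lm \<Longrightarrow> y \<notin> I - G F"
      show ?thesis
      proof (rule bexI[OF _ z(1)], rule ballI, rule notI)
        fix h assume "h \<in> I - G F" "(lm h, lm z) \<in> ?r"
        then show False using z(2)[of h] unfolding in_inv_image by (rule_tac notE)
      qed
    qed
  qed
  define pick where "pick F = (SOME f. f \<in> I - G F \<and> (\<forall>h\<in>I - G F. (lm h, lm f) \<notin> ?r))" for F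
  have pick: "pick F \<in> I" "pick F \<notin> G F" "\<And>h. h \<in> I - G F \<Longrightarrow> (lm h, lm (pick F)) \<notin> ?r"
    if F: "finite F" "F \<subseteq> I" for F
  proof -
    have "pick F \<in> I - G F \<and> (\<forall>h\<in>I - G F. (lm h, lm (pick F)) \<notin> ?r)"
      unfolding pick_def by (rule someI_ex) (use minex[OF F] in blast)
    then show "pick F \<in> I" "pick F \<notin> G F" "\<And>h. h \<in> I - G F \<Longrightarrow> (lm h, lm (pick F)) \<notin> ?r" by blast+
  qed
  define FF where "FF = rec_nat {} (\<lambda>_ F. insert (pick F) F)"
  have FF: "FF 0 = {}" "FF (Suc k) = insert (pick (FF k)) (FF k)" for k by (simp_all add: FF_def)
  have FFI: "finite (FF k) \<and> FF k \<subseteq> I" for k by (induction k) (auto simp: FF pick)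
  have FFmono: "FF i \<subseteq> FF j" if "i \<le> j" for i j using that by (rule lift_Suc_mono_le[rotated]) (auto simp: FF)
  define f where "f k = pick (FF k)" for k
  have f: "f k \<in> I" "f k \<notin> G (FF k)" "\<And>h. h \<in> I - G (FF k) \<Longrightarrow> (lm h, lm (f k)) \<notin> ?r" for k
  proof -
    have F: "finite (FF k)" "FF k \<subseteq> I" using FFI by auto
    show "f k \<in> I" "f k \<notin> G (FF k)" "\<And>h. h \<in> I - G (FF k) \<Longrightarrow> (lm h, lm (f k)) \<notin> ?r"
      unfolding f_def by (rule pick[OF F], rule pick[OF F], rule pick(3)[OF F])
  qed
  have G: "0 \<in> G F" "x \<in> G F \<Longrightarrow> y \<in> G F \<Longrightarrow> x + y \<in> G F" "q \<in> Pol S \<Longrightarrow> x \<in> G F \<Longrightarrow> q * x \<in> G F" "F \<subseteq> G F" for F x y q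
    unfolding G_def by (auto simp: sideal_def)
  have fP: "f k \<in> Pol S" "f k \<noteq> 0" for k
    using subsetD[OF sidealD(1)[OF I] f(1)[of k]] f(2)[of k] G(1)[of "FF k"] by auto
  have kP: "Poly_Mapping.keys (lm h) \<subseteq> S" if "h \<in> Pol S" "h \<noteq> 0" for h
    using that lm_in_keys unfolding Pol_def by blast
  obtain i j n where ij: "i < j" "lm (f j) = lm (f i) + n" "Poly_Mapping.keys n \<subseteq> S"
    using dickson[OF assms, of "\<lambda>k. lm (f k)"] kP[OF fP] by blast
  obtain q where q: "q \<in> Pol S" "f j - q * f i = 0 \<or> lm (f j - q * f i) < lm (f j)"
    using leading_term_reduction[OF fP fP ij(2,3)] by blast
  have "f i \<in> FF (Suc i)" by (simp add: FF f_def)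
  then have "f i \<in> G (FF j)" using FFmono[of "Suc i" j] ij(1) G(4) by (meson Suc_leI subset_iff)
  then have qf: "q * f i \<in> G (FF j)" using G(3) q(1) by blast
  \<comment> \<open>The subtracted multiple lies in the ideal of the earlier picks, so the remainder
    stays outside it and was a competitor when \<open>f j\<close> was picked.\<close>
  have h: "f j - q * f i \<notin> G (FF j)"
  proof
    assume "f j - q * f i \<in> G (FF j)"
    then have "(f j - q * f i) + q * f i \<in> G (FF j)" using G(2) qf by blast
    then show False using f(2)[of j] by simp
  qed
  have "- q \<in> Pol S" using q(1) by (rule Pol_closed)
  then have "f j + (- q) * f i \<in> I" using sidealD[OF I] f(1) by blast
  then have hI: "f j - q * f i \<in> I - G (FF j)" using h by simp
  have h0: "f j - q * f i \<noteq> 0" "f j - q * f i \<in> Pol S"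
    using h G(1)[of "FF j"] subsetD[OF sidealD(1)[OF I]] hI by auto
  then have "lm (f j - q * f i) < lm (f j)" using q(2) by blast
  then show False using f(3)[OF hI] kP[OF h0(2,1)] kP[OF fP] by simp
qed

text \<open>A fraction is its numerator times a unit, so an ideal of the localisation is generated
  by its polynomials, hence by generators of its contraction.\<close>

lemma noeth_Loc:
  assumes "finite S"
  shows "noeth (Loc S)"
  unfolding noeth_def
proof (intro allI impI)
  fix I assume I: "sideal (Loc S) I"
  have contract: "sideal (Pol S) {f \<in> Pol S. em f \<in> J}" if "sideal (Loc S) J" for J
    using sidealD[OF that] Loc_em by (auto simp: sideal_def Pol_closed)
  obtain F where F: "finite F" "generates (Pol S) F {f \<in> Pol S. em f \<in> I}"
    using noeth_Pol[OF assms] contract[OF I] unfolding noeth_def by blast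
  have "generates (Loc S) (em ` F) I"
    unfolding generates_def
  proof (intro conjI allI impI subsetI)
    fix x assume "x \<in> em ` F" then show "x \<in> I" using F(2) by (auto simp: generates_def)
  next
    fix J b assume J: "sideal (Loc S) J" "em ` F \<subseteq> J" and b: "b \<in> I"
    then obtain f g where *: "f \<in> Pol S" "g \<in> Pol S" "const0 g \<noteq> 0" "g \<noteq> 0" "b = em f / em g"
      using sidealD(1)[OF I] by (metis LocE subsetD)
    have "em f = em g * b" using * by simp
    then have "em f \<in> I" using sidealD(4)[OF I Loc_em[OF *(2)] b] by simp
    moreover have "F \<subseteq> {f \<in> Pol S. em f \<in> J}" using J(2) F(2) unfolding generates_def by auto
    ultimately have "f \<in> {f \<in> Pol S. em f \<in> J}"
      using F(2) contract[OF J(1)] *(1) unfolding generates_def by blast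
    moreover have "1 / em g \<in> Loc S" using LocI[OF Pol_closed(2) *(2,3)] by simp
    ultimately have "1 / em g * em f \<in> J" using sidealD(4)[OF J(1)] by blast
    then show "b \<in> J" using * by simp
  qed
  then show "\<exists>F. finite F \<and> generates (Loc S) F I" using F(1) by blast
qed

section \<open>Dimension\<close>

definition mon :: "'r::comm_ring_1 list \<Rightarrow> nat list \<Rightarrow> 'r" where
  "mon fs \<alpha> = prod_list (map2 (^) fs \<alpha>)"

lemma mon_simps [simp]: "mon [] \<alpha> = 1" "mon (f # fs) (k # \<alpha>) = f ^ k * mon fs \<alpha>"
  by (simp_all add: mon_def)

definition sprime :: "'r::comm_ring_1 set \<Rightarrow> 'r set \<Rightarrow> bool" where
  "sprime A p \<longleftrightarrow> sideal A p \<and> 1 \<notin> p \<and> (\<forall>a\<in>A. \<forall>b\<in>A. a * b \<in> p \<longrightarrow> a \<in> p \<or> b \<in> p)"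

definition subring_set :: "'r::comm_ring_1 set \<Rightarrow> bool" where
  "subring_set A \<longleftrightarrow> 0 \<in> A \<and> 1 \<in> A \<and> (\<forall>x\<in>A. \<forall>y\<in>A. x + y \<in> A \<and> x - y \<in> A \<and> x * y \<in> A)"

lemma subring_setD:
  assumes "subring_set A"
  shows "0 \<in> A" "1 \<in> A" "x \<in> A \<Longrightarrow> y \<in> A \<Longrightarrow> x + y \<in> A" "x \<in> A \<Longrightarrow> y \<in> A \<Longrightarrow> x - y \<in> A"
    "x \<in> A \<Longrightarrow> y \<in> A \<Longrightarrow> x * y \<in> A" "x \<in> A \<Longrightarrow> x ^ n \<in> A" "(\<And>i. i \<in> S \<Longrightarrow> g i \<in> A) \<Longrightarrow> sum g S \<in> A"
proof -
  show c: "0 \<in> A" "1 \<in> A" "x \<in> A \<Longrightarrow> y \<in> A \<Longrightarrow> x + y \<in> A" "x \<in> A \<Longrightarrow> y \<in> A \<Longrightarrow> x - y \<in> A"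
    "x \<in> A \<Longrightarrow> y \<in> A \<Longrightarrow> x * y \<in> A" for x y
    using assms by (auto simp: subring_set_def)
  show "x \<in> A \<Longrightarrow> x ^ n \<in> A" by (induction n) (auto simp: c)
  show "(\<And>i. i \<in> S \<Longrightarrow> g i \<in> A) \<Longrightarrow> sum g S \<in> A" by (induction S rule: infinite_finite_induct) (auto simp: c)
qed

lemma mon_closed:
  assumes "subring_set A"
  shows "set fs \<subseteq> A \<Longrightarrow> mon fs \<alpha> \<in> A"
proof (induction fs arbitrary: \<alpha>)
  case (Cons f fs)
  then show ?case by (cases \<alpha>) (auto simp: mon_def subring_setD[OF assms])
qed (simp add: subring_setD[OF assms])

text \<open>If \<open>f\<^sub>0\<^sup>k\<close> is the least power of \<open>f\<^sub>0\<close> that occurs, the relation reads \<open>f\<^sub>0\<^sup>k (S + f\<^sub>0 T) \<in> p\<^sub>0\<close>, so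
  \<open>S \<in> p\<^sub>1\<close> is a relation between the remaining elements along the remaining chain.\<close>

lemma no_relation_along_prime_chain:
  assumes A: "subring_set A"
  shows "length fs = n \<Longrightarrow> (\<And>i. i \<le> n \<Longrightarrow> sprime A (p i)) \<Longrightarrow> (\<And>i. i < n \<Longrightarrow> p i \<subseteq> p (Suc i)) \<Longrightarrow>
    (\<And>i. i < n \<Longrightarrow> fs ! i \<in> p (Suc i) - p i) \<Longrightarrow> finite E \<Longrightarrow> E \<noteq> {} \<Longrightarrow> (\<And>\<alpha>. \<alpha> \<in> E \<Longrightarrow> length \<alpha> = n) \<Longrightarrow>
    (\<And>\<alpha>. \<alpha> \<in> E \<Longrightarrow> u \<alpha> \<in> A) \<Longrightarrow> (\<And>\<alpha> i. \<alpha> \<in> E \<Longrightarrow> i \<le> n \<Longrightarrow> u \<alpha> \<notin> p i) \<Longrightarrow> (\<Sum>\<alpha>\<in>E. u \<alpha> * mon fs \<alpha>) \<notin> p 0"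
proof (induction n arbitrary: fs p E u)
  case 0
  then have "E = {[]}" by auto
  then show ?case using 0 by simp
next
  case (Suc n)
  note c = subring_setD[OF A]
  obtain f fs' where fs: "fs = f # fs'" "length fs' = n" using Suc.prems(1) by (cases fs) auto
  have p: "sideal A (p i)" if "i \<le> Suc n" for i using Suc.prems(2)[OF that] by (simp add: sprime_def)
  have f: "f \<in> p (Suc 0)" "f \<notin> p 0" using Suc.prems(4)[of 0] fs by auto
  then have fA: "f \<in> A" using sidealD(1)[OF p, of "Suc 0"] by auto
  have fs'A: "set fs' \<subseteq> A"
  proof
    fix g assume "g \<in> set fs'"
    then obtain i where "i < n" "g = fs ! Suc i" using fs by (auto simp: in_set_conv_nth)
    then show "g \<in> A" using Suc.prems(4)[of "Suc i"] sidealD(1)[OF p, of "Suc (Suc i)"] by auto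
  qed
  define k where "k = Min (hd ` E)"
  have hdk: "k \<le> hd \<alpha>" if "\<alpha> \<in> E" for \<alpha> unfolding k_def using Suc.prems(5) that by simp
  have "k \<in> hd ` E" unfolding k_def using Suc.prems(5,6) by (intro Min_in) auto
  define E1 where "E1 = {\<alpha> \<in> E. hd \<alpha> = k}"
  have E1: "E1 \<noteq> {}" "E1 \<subseteq> E" "finite E1" using \<open>k \<in> hd ` E\<close> Suc.prems(5) by (auto simp: E1_def)
  have cons: "\<alpha> = hd \<alpha> # tl \<alpha>" "length (tl \<alpha>) = n" if "\<alpha> \<in> E" for \<alpha>
    using Suc.prems(7)[OF that] by (cases \<alpha>; simp)+
  define T where "T = (\<Sum>\<alpha>\<in>E - E1. u \<alpha> * f ^ (hd \<alpha> - Suc k) * mon fs' (tl \<alpha>))"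
  define S where "S = (\<Sum>\<alpha>\<in>E1. u \<alpha> * mon fs' (tl \<alpha>))"
  have TA: "T \<in> A" unfolding T_def
    by (intro c(7) c(5) c(6) fA mon_closed[OF A fs'A] Suc.prems(8)) auto
  have SA: "S \<in> A" unfolding S_def
    by (intro c(7) c(5) mon_closed[OF A fs'A] Suc.prems(8)) (use E1 in auto)
  have "(\<Sum>\<alpha>\<in>E. u \<alpha> * mon fs \<alpha>) = (\<Sum>\<alpha>\<in>E1. u \<alpha> * mon fs \<alpha>) + (\<Sum>\<alpha>\<in>E - E1. u \<alpha> * mon fs \<alpha>)"
    using Suc.prems(5) E1(2) by (simp add: sum.subset_diff add.commute)
  also have "(\<Sum>\<alpha>\<in>E1. u \<alpha> * mon fs \<alpha>) = f ^ k * S"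
    unfolding S_def sum_distrib_left
  proof (rule sum.cong)
    fix \<alpha> assume "\<alpha> \<in> E1"
    then have "mon fs \<alpha> = f ^ k * mon fs' (tl \<alpha>)" using cons(1)[of \<alpha>] mon_simps(2)[of f fs' "hd \<alpha>" "tl \<alpha>"] fs by (simp add: E1_def)
    then show "u \<alpha> * mon fs \<alpha> = f ^ k * (u \<alpha> * mon fs' (tl \<alpha>))" by (simp add: mult_ac)
  qed simp
  also have "(\<Sum>\<alpha>\<in>E - E1. u \<alpha> * mon fs \<alpha>) = f ^ k * (f * T)"
    unfolding T_def sum_distrib_left
  proof (rule sum.cong)
    fix \<alpha> assume a: "\<alpha> \<in> E - E1"
    then have "hd \<alpha> = k + Suc (hd \<alpha> - Suc k)" using hdk[of \<alpha>] by (auto simp: E1_def)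
    then have "f ^ hd \<alpha> = f ^ k * (f * f ^ (hd \<alpha> - Suc k))" by (metis power_add power_Suc)
    moreover have "mon fs \<alpha> = f ^ hd \<alpha> * mon fs' (tl \<alpha>)"
      using cons(1)[of \<alpha>] mon_simps(2)[of f fs' "hd \<alpha>" "tl \<alpha>"] fs a by (metis DiffD1)
    ultimately have "mon fs \<alpha> = f ^ k * (f * f ^ (hd \<alpha> - Suc k)) * mon fs' (tl \<alpha>)" by metis
    then show "u \<alpha> * mon fs \<alpha> = f ^ k * (f * (u \<alpha> * f ^ (hd \<alpha> - Suc k) * mon fs' (tl \<alpha>)))"
      by (simp add: mult_ac)
  qed simp
  finally have eq: "(\<Sum>\<alpha>\<in>E. u \<alpha> * mon fs \<alpha>) = f ^ k * (S + f * T)" by (simp add: distrib_left)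
  show ?case
  proof
    assume "(\<Sum>\<alpha>\<in>E. u \<alpha> * mon fs \<alpha>) \<in> p 0"
    moreover have STA: "S + f * T \<in> A" by (intro c SA TA fA)
    moreover have sp1: "sideal A (p (Suc 0))" using p by simp
    moreover have prime0: "sprime A (p 0)" using Suc.prems(2) by simp
    moreover have "f ^ k \<notin> p 0"
      using f(2) prime0 fA by (induction k) (auto simp: sprime_def c)
    ultimately have "S + f * T \<in> p 0" unfolding eq sprime_def using c(6)[OF fA] by blast
    then have "S + f * T \<in> p (Suc 0)" using Suc.prems(3)[of 0] by auto
    moreover have "(- T) * f \<in> p (Suc 0)"
      using sidealD(4)[OF p _ f(1), of "- T"] c(4)[OF c(1) TA] by simp
    ultimately have "S + f * T + (- T) * f \<in> p (Suc 0)" by (rule sidealD(3)[OF sp1])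
    moreover have "S + f * T + (- T) * f = S" by simp
    ultimately have "S \<in> p (Suc 0)" by simp
    \<comment> \<open>Stripping the common first exponent k is injective, so S is a relation indexed
      by vectors of length n, the shape needed for the induction hypothesis.\<close>
    moreover have "S = (\<Sum>\<beta>\<in>tl ` E1. u (k # \<beta>) * mon fs' \<beta>)"
    proof -
      have "inj_on tl E1" using cons(1) E1(2) by (auto simp: inj_on_def E1_def) (metis)
      then have "(\<Sum>\<beta>\<in>tl ` E1. u (k # \<beta>) * mon fs' \<beta>) = (\<Sum>\<alpha>\<in>E1. u (k # tl \<alpha>) * mon fs' (tl \<alpha>))"
        by (simp add: sum.reindex)
      also have "\<dots> = S" unfolding S_def
      proof (rule sum.cong)
        fix \<alpha> assume "\<alpha> \<in> E1"
        then have "k # tl \<alpha> = \<alpha>" using cons(1)[of \<alpha>] by (simp add: E1_def)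
        then show "u (k # tl \<alpha>) * mon fs' (tl \<alpha>) = u \<alpha> * mon fs' (tl \<alpha>)" by simp
      qed simp
      finally show ?thesis by simp
    qed
    moreover have "(\<Sum>\<beta>\<in>tl ` E1. u (k # \<beta>) * mon fs' \<beta>) \<notin> p (Suc 0)"
    proof (rule Suc.IH[of fs' "\<lambda>i. p (Suc i)"])
      have k\<beta>: "k # \<beta> \<in> E \<and> length \<beta> = n" if \<beta>: "\<beta> \<in> tl ` E1" for \<beta>
      proof -
        obtain \<alpha> where a: "\<alpha> \<in> E1" "\<beta> = tl \<alpha>" using \<beta> by blast
        then have "k # \<beta> = \<alpha>" using cons(1)[of \<alpha>] by (simp add: E1_def)
        then show ?thesis using a E1(2) cons(2)[of \<alpha>] by auto
      qed
      show "u (k # \<beta>) \<in> A" "length \<beta> = n" if "\<beta> \<in> tl ` E1" for \<beta>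
        using k\<beta>[OF that] Suc.prems(8) by auto
      show "u (k # \<beta>) \<notin> p (Suc i)" if "\<beta> \<in> tl ` E1" "i \<le> n" for \<beta> i
        using k\<beta>[OF that(1)] Suc.prems(9)[of "k # \<beta>" "Suc i"] that(2) by auto
      show "fs' ! i \<in> p (Suc (Suc i)) - p (Suc i)" if "i < n" for i using Suc.prems(4)[of "Suc i"] that fs by simp
    qed (use fs Suc.prems(2,3) E1 in auto)
    ultimately show False by simp
  qed
qed

section \<open>Algebraic dependence by counting monomials\<close>

definition scaleC :: "complex \<Rightarrow> mpol \<Rightarrow> mpol" where
  "scaleC c f = Poly_Mapping.single 0 c * f"

interpretation mpol_vs: vector_space scaleC
  by standard (simp_all add: scaleC_def algebra_simps mult_single single_add flip: mult.assoc)

lemma mpol_in_span: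
  assumes "\<And>m. m \<in> Poly_Mapping.keys f \<Longrightarrow> m \<in> M"
  shows "f \<in> mpol_vs.span ((\<lambda>m. Poly_Mapping.single m 1) ` M)"
proof -
  have "(\<Sum>m\<in>Poly_Mapping.keys f. Poly_Mapping.single m (Poly_Mapping.lookup f m)) \<in> mpol_vs.span ((\<lambda>m. Poly_Mapping.single m 1) ` M)"
  proof (rule mpol_vs.span_sum)
    fix m assume m: "m \<in> Poly_Mapping.keys f"
    have "scaleC (Poly_Mapping.lookup f m) (Poly_Mapping.single m 1) \<in> mpol_vs.span ((\<lambda>m. Poly_Mapping.single m 1) ` M)"
      by (intro mpol_vs.span_scale mpol_vs.span_base imageI assms m)
    then show "Poly_Mapping.single m (Poly_Mapping.lookup f m) \<in> mpol_vs.span ((\<lambda>m. Poly_Mapping.single m 1) ` M)"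
      by (simp add: scaleC_def mult_single)
  qed
  then show ?thesis using mpol_expand[of f] by simp
qed

definition box :: "nat \<Rightarrow> nat \<Rightarrow> (nat \<Rightarrow>\<^sub>0 nat) set" where
  "box n D = {m. Poly_Mapping.keys m \<subseteq> {..<n} \<and> (\<forall>x. Poly_Mapping.lookup m x < D)}"

lemma card_box:
  assumes "D > 0"
  shows "finite (box n D)" "card (box n D) \<le> D ^ n"
proof -
  let ?L = "{\<alpha>. set \<alpha> \<subseteq> {..<D} \<and> length \<alpha> = n}"
  let ?h = "\<lambda>m. map (Poly_Mapping.lookup m) [0..<n]"
  have "inj_on ?h (box n D)"
  proof (rule inj_onI, rule poly_mapping_eqI)
    fix m m' k assume m: "m \<in> box n D" "m' \<in> box n D" "?h m = ?h m'"
    show "Poly_Mapping.lookup m k = Poly_Mapping.lookup m' k"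
    proof (cases "k < n")
      case True
      then show ?thesis using arg_cong[OF m(3), of "\<lambda>l. l ! k"] by simp
    next
      case False
      then have "k \<notin> Poly_Mapping.keys m" "k \<notin> Poly_Mapping.keys m'" using m by (auto simp: box_def)
      then show ?thesis by (simp add: in_keys_iff)
    qed
  qed
  moreover have "?h ` box n D \<subseteq> ?L" by (auto simp: box_def)
  moreover have "finite ?L" "card ?L = D ^ n" using finite_lists_length_eq[of "{..<D}" n] card_lists_length_eq[of "{..<D}" n] by auto
  ultimately show "finite (box n D)" "card (box n D) \<le> D ^ n"
    using card_inj_on_le[of ?h "box n D" ?L] inj_on_finite[of ?h "box n D" ?L] by auto
qed

text \<open>The degree is bounded in each variable separately instead of in total, so that the
  admissible monomials fill a box and are easy to count.\<close>

definition bounded_exp :: "nat \<Rightarrow> nat \<Rightarrow> mpol \<Rightarrow> bool" where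
  "bounded_exp n D f \<longleftrightarrow> (\<forall>m\<in>Poly_Mapping.keys f. Poly_Mapping.keys m \<subseteq> {..<n} \<and> (\<forall>x. Poly_Mapping.lookup m x \<le> D))"

lemma bounded_exp_mult:
  assumes "bounded_exp n D f" "bounded_exp n D' g"
  shows "bounded_exp n (D + D') (f * g)"
  unfolding bounded_exp_def
proof
  fix m assume "m \<in> Poly_Mapping.keys (f * g)"
  then obtain a b where "m = a + b" "a \<in> Poly_Mapping.keys f" "b \<in> Poly_Mapping.keys g" using keys_mult by blast
  then show "Poly_Mapping.keys m \<subseteq> {..<n} \<and> (\<forall>x. Poly_Mapping.lookup m x \<le> D + D')"
    using assms unfolding bounded_exp_def by (auto simp: keys_plus_nat lookup_add add_mono)
qed

lemma bounded_exp_power: "bounded_exp n D f \<Longrightarrow> bounded_exp n (k * D) (f ^ k)"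
proof (induction k)
  case 0 show ?case by (simp add: bounded_exp_def)
next
  case (Suc k) then show ?case using bounded_exp_mult[of n D f "k * D" "f ^ k"] by simp
qed

lemma bounded_exp_mon:
  "length \<alpha> = length fs \<Longrightarrow> (\<And>f. f \<in> set fs \<Longrightarrow> bounded_exp n e f) \<Longrightarrow> bounded_exp n (sum_list \<alpha> * e) (mon fs \<alpha>)"
proof (induction fs arbitrary: \<alpha>)
  case Nil then show ?case by (simp add: bounded_exp_def)
next
  case (Cons f fs)
  then obtain k \<beta> where a: "\<alpha> = k # \<beta>" "length \<beta> = length fs" by (cases \<alpha>) auto
  have "bounded_exp n (k * e + sum_list \<beta> * e) (f ^ k * mon fs \<beta>)"
    using Cons a by (intro bounded_exp_mult bounded_exp_power) auto
  then show ?case by (simp add: a distrib_right)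
qed

lemma bounded_exp_exists:
  assumes "set fs \<subseteq> Pol {..<n}"
  shows "\<exists>e. \<forall>f\<in>set fs. bounded_exp n e f"
proof -
  let ?V = "(\<Union>f\<in>set fs. \<Union>m\<in>Poly_Mapping.keys f. Poly_Mapping.lookup m ` Poly_Mapping.keys m)"
  define B where "B = Max (insert 0 ?V)"
  have fin: "finite (insert 0 ?V)" by auto
  have "Poly_Mapping.lookup m x \<le> B" if "f \<in> set fs" "m \<in> Poly_Mapping.keys f" for f m x
  proof (cases "x \<in> Poly_Mapping.keys m")
    case True
    then have "Poly_Mapping.lookup m x \<in> insert 0 ?V" using that by blast
    then show ?thesis unfolding B_def by (rule Max_ge[OF fin])
  qed (simp add: in_keys_iff)
  then show ?thesis using assms unfolding bounded_exp_def Pol_def by blast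
qed

lemma algebraic_dependence:
  assumes len: "length fs = Suc n" and fs: "set fs \<subseteq> Pol {..<n}"
  shows "\<exists>E c. finite E \<and> E \<noteq> {} \<and> (\<forall>\<alpha>\<in>E. length \<alpha> = Suc n \<and> c \<alpha> \<noteq> (0::complex)) \<and>
    (\<Sum>\<alpha>\<in>E. Poly_Mapping.single 0 (c \<alpha>) * mon fs \<alpha>) = 0"
proof -
  obtain e where e: "\<And>f. f \<in> set fs \<Longrightarrow> bounded_exp n e f" using bounded_exp_exists[OF fs] by blast
  \<comment> \<open>There are \<open>N\<^sup>n\<^sup>+\<^sup>1\<close> monomials in \<open>fs\<close> with exponents below \<open>N\<close>, and they lie in a space of dimension
    at most \<open>D\<^sup>n\<close>, where \<open>D\<close> is linear in \<open>N\<close>.\<close>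
  define N where "N = Suc ((Suc (Suc n * e)) ^ n)"
  define D where "D = Suc (Suc n * e * N)"
  define L where "L = {\<alpha>. set \<alpha> \<subseteq> {..<N} \<and> length \<alpha> = Suc n}"
  have L: "finite L" "card L = N ^ Suc n"
    using finite_lists_length_eq[of "{..<N}" "Suc n"] card_lists_length_eq[of "{..<N}" "Suc n"] by (auto simp: L_def)
  have Dpos: "D > 0" by (simp add: D_def)
  have "D \<le> Suc (Suc n * e) * N" unfolding D_def N_def by simp
  then have "D ^ n \<le> (Suc (Suc n * e) * N) ^ n" by (rule power_mono) simp
  also have "\<dots> = (Suc (Suc n * e)) ^ n * N ^ n" by (rule power_mult_distrib)
  also have "\<dots> < N * N ^ n" unfolding N_def by (intro mult_strict_right_mono) auto
  finally have small: "D ^ n < card L" by (simp add: L)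
  let ?B = "(\<lambda>m. Poly_Mapping.single m (1::complex)) ` box n D"
  have span: "mon fs \<alpha> \<in> mpol_vs.span ?B" if a: "\<alpha> \<in> L" for \<alpha>
  proof (rule mpol_in_span)
    fix m assume m: "m \<in> Poly_Mapping.keys (mon fs \<alpha>)"
    have "length \<alpha> = length fs" using a len by (simp add: L_def)
    then have b: "bounded_exp n (sum_list \<alpha> * e) (mon fs \<alpha>)" using bounded_exp_mon e by blast
    have "set \<alpha> \<subseteq> {..<N} \<Longrightarrow> sum_list \<alpha> \<le> length \<alpha> * N" by (induction \<alpha>) auto
    then have "sum_list \<alpha> \<le> length \<alpha> * N" using a by (simp add: L_def)
    then have "sum_list \<alpha> * e \<le> length \<alpha> * N * e" by (rule mult_right_mono) simp
    moreover have "length \<alpha> * N * e = Suc n * e * N" using a by (simp add: L_def algebra_simps)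
    ultimately have "sum_list \<alpha> * e < D" unfolding D_def by linarith
    then show "m \<in> box n D" using b m unfolding bounded_exp_def box_def by (auto intro: le_less_trans)
  qed
  have "\<exists>c. (\<exists>\<alpha>\<in>L. c \<alpha> \<noteq> 0) \<and> (\<Sum>\<alpha>\<in>L. scaleC (c \<alpha>) (mon fs \<alpha>)) = 0"
  proof (cases "inj_on (mon fs) L")
    case True
    have "\<not> mpol_vs.independent (mon fs ` L)"
    proof
      assume "mpol_vs.independent (mon fs ` L)"
      then have "card (mon fs ` L) \<le> card ?B"
        using mpol_vs.independent_span_bound[of ?B "mon fs ` L"] span card_box[OF Dpos] by blast
      also have "\<dots> \<le> D ^ n" using card_image_le[of "box n D"] card_box[OF Dpos, of n] by (meson le_trans)
      finally show False using small card_image[OF True] by simp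
    qed
    then obtain u where u: "\<exists>v\<in>mon fs ` L. u v \<noteq> 0" "(\<Sum>v\<in>mon fs ` L. scaleC (u v) v) = 0"
      using mpol_vs.dependent_finite[of "mon fs ` L"] L(1) by blast
    then show ?thesis using sum.reindex[OF True, of "\<lambda>v. scaleC (u v) v"]
      by (intro exI[of _ "\<lambda>\<alpha>. u (mon fs \<alpha>)"]) auto
  next
    case False
    then obtain \<alpha> \<beta> where ab: "\<alpha> \<in> L" "\<beta> \<in> L" "\<alpha> \<noteq> \<beta>" "mon fs \<alpha> = mon fs \<beta>" by (auto simp: inj_on_def)
    \<comment> \<open>Two exponent lists with the same product give a relation at once. Linear
      dependence of the set of products would not see such a coincidence.\<close>
    let ?c = "\<lambda>\<gamma>. if \<gamma> = \<alpha> then 1 else if \<gamma> = \<beta> then - 1 else (0::complex)"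
    have "(\<Sum>\<gamma>\<in>L. scaleC (?c \<gamma>) (mon fs \<gamma>)) = (\<Sum>\<gamma>\<in>{\<alpha>, \<beta>}. scaleC (?c \<gamma>) (mon fs \<gamma>))"
      by (rule sum.mono_neutral_right) (use L ab in auto)
    also have "\<dots> = 0" using ab by simp
    finally show ?thesis using ab(1) by (intro exI[of _ ?c]) auto
  qed
  then obtain c where c: "\<exists>\<alpha>\<in>L. c \<alpha> \<noteq> 0" "(\<Sum>\<alpha>\<in>L. scaleC (c \<alpha>) (mon fs \<alpha>)) = 0" by blast
  define E where "E = {\<alpha>\<in>L. c \<alpha> \<noteq> 0}"
  have "(\<Sum>\<alpha>\<in>E. scaleC (c \<alpha>) (mon fs \<alpha>)) = 0"
    unfolding c(2)[symmetric] E_def by (rule sum.mono_neutral_left) (use L in auto)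
  then have rel: "(\<Sum>\<alpha>\<in>E. Poly_Mapping.single 0 (c \<alpha>) * mon fs \<alpha>) = 0" by (simp only: scaleC_def)
  have "finite E" unfolding E_def using L(1) by (rule rev_finite_subset) blast
  moreover have "E \<noteq> {}" "\<forall>\<alpha>\<in>E. length \<alpha> = Suc n \<and> c \<alpha> \<noteq> 0"
    using c(1) by (auto simp: E_def L_def)
  ultimately show ?thesis using rel by (intro exI[of _ E] exI[of _ c] conjI)
qed

section \<open>Chains of primes in the localised polynomial ring\<close>

lemma Loc_subring: "subring_set (Loc S)"
  by (auto simp: subring_set_def Loc_closed)

lemma em_mon: "em (mon fs \<alpha>) = mon (map em fs) \<alpha>"
proof (induction fs arbitrary: \<alpha>)
  case (Cons f fs)
  then show ?case by (cases \<alpha>) (simp_all add: mon_def)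
qed simp

lemma em_sum: "em (sum f A) = (\<Sum>a\<in>A. em (f a))"
  by (induction A rule: infinite_finite_induct) simp_all

text \<open>From each difference of consecutive primes pick an element; clearing a unit denominator
  makes it a polynomial. The first d + 1 of them satisfy a relation whose coefficients are nonzero
  constants, hence units lying in no prime, which \<open>no_relation_along_prime_chain\<close>
  excludes.\<close>

lemma Loc_prime_chain_bound:
  assumes p: "\<And>i. i \<le> n \<Longrightarrow> sprime (Loc {..<d}) (p i)" and chain: "\<And>i. i < n \<Longrightarrow> p i \<subset> p (Suc i)"
  shows "n \<le> d"
proof (rule ccontr)
  let ?A = "Loc {..<d}"
  assume "\<not> n \<le> d"
  then have dn: "Suc d \<le> n" by simp
  have si: "sideal ?A (p i)" if "i \<le> n" for i using p[OF that] by (simp add: sprime_def)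
  have "\<forall>i. \<exists>f. i < n \<longrightarrow> f \<in> Pol {..<d} \<and> em f \<in> p (Suc i) - p i"
  proof
    fix i
    show "\<exists>f. i < n \<longrightarrow> f \<in> Pol {..<d} \<and> em f \<in> p (Suc i) - p i"
    proof (cases "i < n")
      case True
      then obtain b where b: "b \<in> p (Suc i)" "b \<notin> p i" using chain by blast
      then have "b \<in> ?A" using sidealD(1)[OF si, of "Suc i"] True by auto
      then obtain f g where *: "f \<in> Pol {..<d}" "g \<in> Pol {..<d}" "const0 g \<noteq> 0" "g \<noteq> 0" "b = em f / em g"
        by (rule LocE)
      have 1: "em f = em g * b" using * by simp
      have "em f \<in> p (Suc i)" unfolding 1 using sidealD(4)[OF si Loc_em[OF *(2)] b(1)] True by simp
      moreover have "em f \<notin> p i"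
      proof
        assume "em f \<in> p i"
        moreover have "1 / em g \<in> ?A" using LocI[OF Pol_closed(2) *(2,3)] by simp
        ultimately have "1 / em g * em f \<in> p i" using sidealD(4)[OF si[OF less_imp_le[OF True]]] by blast
        then show False using b(2) * by simp
      qed
      ultimately show ?thesis using *(1) by blast
    qed simp
  qed
  from choice[OF this] obtain f where f: "\<And>i. i < n \<Longrightarrow> f i \<in> Pol {..<d}" "\<And>i. i < n \<Longrightarrow> em (f i) \<in> p (Suc i) - p i"
    by blast
  let ?fs = "map f [0..<Suc d]"
  have "set ?fs \<subseteq> Pol {..<d}" using f(1) dn by auto
  then obtain E c where E: "finite E" "E \<noteq> {}" "\<And>\<alpha>. \<alpha> \<in> E \<Longrightarrow> length \<alpha> = Suc d" "\<And>\<alpha>. \<alpha> \<in> E \<Longrightarrow> c \<alpha> \<noteq> (0::complex)"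
    "(\<Sum>\<alpha>\<in>E. Poly_Mapping.single 0 (c \<alpha>) * mon ?fs \<alpha>) = 0"
    using algebraic_dependence[of ?fs d] by (metis (no_types, lifting) diff_zero length_map length_upt)
  let ?u = "\<lambda>\<alpha>. em (Poly_Mapping.single 0 (c \<alpha>))"
  have uA: "em (Poly_Mapping.single 0 z) \<in> ?A" for z by (rule Loc_em) (rule Pol_closed)
  have "(\<Sum>\<alpha>\<in>E. ?u \<alpha> * mon (map em ?fs) \<alpha>) \<notin> p 0"
  proof (rule no_relation_along_prime_chain[OF Loc_subring, where n = "Suc d"])
    show "?u \<alpha> \<notin> p i" if "\<alpha> \<in> E" "i \<le> Suc d" for \<alpha> i
    proof
      assume a: "?u \<alpha> \<in> p i"
      have "em (Poly_Mapping.single 0 (1 / c \<alpha>)) * ?u \<alpha> \<in> p i"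
        using sidealD(4)[OF si uA a] that dn by simp
      moreover have "em (Poly_Mapping.single 0 (1 / c \<alpha>)) * ?u \<alpha> = 1"
        using E(4)[OF that(1)] by (simp add: mult_single flip: em_simps)
      ultimately show False using p[of i] that dn by (auto simp: sprime_def)
    qed
    show "map em ?fs ! i \<in> p (Suc i) - p i" if "i < Suc d" for i
      using that f(2)[of i] dn by (simp del: upt_Suc)
  qed (use E uA p dn chain in \<open>auto simp: psubset_imp_subset\<close>)
  moreover have "(\<Sum>\<alpha>\<in>E. ?u \<alpha> * mon (map em ?fs) \<alpha>) = em (\<Sum>\<alpha>\<in>E. Poly_Mapping.single 0 (c \<alpha>) * mon ?fs \<alpha>)"
    by (simp add: em_sum em_mon)
  ultimately show False using E(5) sidealD(2)[OF si, of 0] by simp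
qed

section \<open>The ring\<close>

text \<open>Besides an element \<open>bb\<close> of the localised polynomial ring there are the coordinates with respect
  to \<open>1, t, y\<^sub>1, y\<^sub>2, z\<^sub>1, z\<^sub>2, f\<^sub>1, f\<^sub>2\<close> in an algebra in which \<open>t\<^sup>2 = 0\<close>. In the ring \<open>R0\<close> below, \<open>e0\<close> and \<open>e1\<close>
  are the first two coefficients of \<open>bb\<close> as a polynomial in \<open>t\<close>.\<close>

datatype elt = Elt (bb: ratfun) (e0: ratfun) (e1: ratfun) (y1: ratfun) (y2: ratfun)
  (z1: ratfun) (z2: ratfun) (f1: ratfun) (f2: ratfun)

lemma elt_eq_iff: "r = s \<longleftrightarrow> bb r = bb s \<and> e0 r = e0 s \<and> e1 r = e1 s \<and> y1 r = y1 s \<and> y2 r = y2 s \<and>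
   z1 r = z1 s \<and> z2 r = z2 s \<and> f1 r = f1 s \<and> f2 r = f2 s"
  by (cases r; cases s) simp

instantiation elt :: comm_ring_1
begin

definition "0 = Elt 0 0 0 0 0 0 0 0 0"
definition "1 = Elt 1 1 0 0 0 0 0 0 0"
definition "r + s = Elt (bb r + bb s) (e0 r + e0 s) (e1 r + e1 s) (y1 r + y1 s) (y2 r + y2 s)
  (z1 r + z1 s) (z2 r + z2 s) (f1 r + f1 s) (f2 r + f2 s)"
definition "- r = Elt (- bb r) (- e0 r) (- e1 r) (- y1 r) (- y2 r) (- z1 r) (- z2 r) (- f1 r) (- f2 r)"
definition "r - (s :: elt) = r + - s"
text \<open>The structure constants can be read off: f_1 arises from t z_1, y_1^2 and z_1 y_2, and
  f_2 from t z_2, y_2^2 and z_2 y_1; a term with both \<open>e1\<close> is absent as t^2 = 0.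
  Associativity holds because products of three of t, y_i, z_i vanish in this algebra. The component
  \<open>bb\<close> multiplies on its own.\<close>

definition "r * s = Elt (bb r * bb s) (e0 r * e0 s) (e0 r * e1 s + e1 r * e0 s)
  (e0 r * y1 s + y1 r * e0 s) (e0 r * y2 s + y2 r * e0 s)
  (e0 r * z1 s + z1 r * e0 s) (e0 r * z2 s + z2 r * e0 s)
  (e0 r * f1 s + f1 r * e0 s + e1 r * z1 s + z1 r * e1 s + y1 r * y1 s + z1 r * y2 s + y2 r * z1 s)
  (e0 r * f2 s + f2 r * e0 s + e1 r * z2 s + z2 r * e1 s + y2 r * y2 s + z2 r * y1 s + y1 r * z2 s)"

instance
  by standard (simp_all add: elt_eq_iff zero_elt_def one_elt_def plus_elt_def uminus_elt_def minus_elt_def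
      times_elt_def algebra_simps)

end

lemma elt_sel [simp]:
  "bb 0 = 0" "e0 0 = 0" "e1 0 = 0" "y1 0 = 0" "y2 0 = 0" "z1 0 = 0" "z2 0 = 0" "f1 0 = 0" "f2 0 = 0"
  "bb 1 = 1" "e0 1 = 1" "e1 1 = 0" "y1 1 = 0" "y2 1 = 0" "z1 1 = 0" "z2 1 = 0" "f1 1 = 0" "f2 1 = 0"
  "bb (r + s) = bb r + bb s" "e0 (r + s) = e0 r + e0 s" "e1 (r + s) = e1 r + e1 s"
  "y1 (r + s) = y1 r + y1 s" "y2 (r + s) = y2 r + y2 s" "z1 (r + s) = z1 r + z1 s"
  "z2 (r + s) = z2 r + z2 s" "f1 (r + s) = f1 r + f1 s" "f2 (r + s) = f2 r + f2 s"
  "bb (r - s) = bb r - bb s" "e0 (r - s) = e0 r - e0 s" "e1 (r - s) = e1 r - e1 s"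
  "y1 (r - s) = y1 r - y1 s" "y2 (r - s) = y2 r - y2 s" "z1 (r - s) = z1 r - z1 s"
  "z2 (r - s) = z2 r - z2 s" "f1 (r - s) = f1 r - f1 s" "f2 (r - s) = f2 r - f2 s"
  "bb (- r) = - bb r" "e0 (- r) = - e0 r" "e1 (- r) = - e1 r"
  "y1 (- r) = - y1 r" "y2 (- r) = - y2 r" "z1 (- r) = - z1 r"
  "z2 (- r) = - z2 r" "f1 (- r) = - f1 r" "f2 (- r) = - f2 r"
  by (simp_all add: zero_elt_def one_elt_def plus_elt_def minus_elt_def uminus_elt_def)

lemma elt_mult [simp]:
  "bb (r * s) = bb r * bb s" "e0 (r * s) = e0 r * e0 s" "e1 (r * s) = e0 r * e1 s + e1 r * e0 s"
  "y1 (r * s) = e0 r * y1 s + y1 r * e0 s" "y2 (r * s) = e0 r * y2 s + y2 r * e0 s"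
  "z1 (r * s) = e0 r * z1 s + z1 r * e0 s" "z2 (r * s) = e0 r * z2 s + z2 r * e0 s"
  "f1 (r * s) = e0 r * f1 s + f1 r * e0 s + e1 r * z1 s + z1 r * e1 s + y1 r * y1 s + z1 r * y2 s + y2 r * z1 s"
  "f2 (r * s) = e0 r * f2 s + f2 r * e0 s + e1 r * z2 s + z2 r * e1 s + y2 r * y2 s + z2 r * y1 s + y1 r * z2 s"
  by (simp_all add: times_elt_def)

text \<open>The variable with index 0 is \<open>t\<close>; \<open>CC d\<close> is the subring of \<open>BB d\<close> without \<open>t\<close>.\<close>

definition BB :: "nat \<Rightarrow> ratfun set" where "BB d = Loc {..<d}"
definition CC :: "nat \<Rightarrow> ratfun set" where "CC d = Loc {1..<d}"
abbreviation tt :: ratfun where "tt \<equiv> xv 0"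

lemma BB_closed:
  "0 \<in> BB d" "1 \<in> BB d" "a \<in> BB d \<Longrightarrow> b \<in> BB d \<Longrightarrow> a + b \<in> BB d" "a \<in> BB d \<Longrightarrow> b \<in> BB d \<Longrightarrow> a * b \<in> BB d"
  "a \<in> BB d \<Longrightarrow> - a \<in> BB d" "a \<in> BB d \<Longrightarrow> b \<in> BB d \<Longrightarrow> a - b \<in> BB d" "j < d \<Longrightarrow> xv j \<in> BB d"
  by (auto simp: BB_def Loc_closed)

lemma CC_closed:
  "0 \<in> CC d" "1 \<in> CC d" "a \<in> CC d \<Longrightarrow> b \<in> CC d \<Longrightarrow> a + b \<in> CC d" "a \<in> CC d \<Longrightarrow> b \<in> CC d \<Longrightarrow> a * b \<in> CC d"
  "a \<in> CC d \<Longrightarrow> - a \<in> CC d" "a \<in> CC d \<Longrightarrow> b \<in> CC d \<Longrightarrow> a - b \<in> CC d" "j \<in> {1..<d} \<Longrightarrow> xv j \<in> CC d"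
  by (auto simp: CC_def Loc_closed)

lemma CC_BB: "c \<in> CC d \<Longrightarrow> c \<in> BB d"
  unfolding BB_def CC_def by (rule subsetD[OF Loc_mono]) auto

text \<open>The summand without t is the value at t = 0; the difference is killed by that
  substitution and hence divisible by t.\<close>

lemma BB_split:
  assumes "d > 0" "b \<in> BB d"
  shows "\<exists>c\<in>CC d. \<exists>b'\<in>BB d. b = c + tt * b'"
proof -
  have b: "b \<in> Loc {..<d}" using assms by (simp add: BB_def)
  have kb: "lkill {0} b \<in> Loc {..<d}" using lkill_Loc'[OF b] .
  have "lkill {0} (b - lkill {0} b) = 0" by (simp add: lkill_diff[OF b kb] lkill_lkill[OF b])
  then obtain b' where "b' \<in> Loc {..<d}" "b - lkill {0} b = tt * b'"
    using lkill_eq_0_dvd[of "b - lkill {0} b" "{..<d}" 0] Loc_closed(6)[OF b kb] assms(1) by blast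
  moreover have "{..<d} - {0} = {1..<d}" by auto
  then have "lkill {0} b \<in> CC d" using lkill_Loc[OF b, of "{0}"] by (simp add: CC_def)
  ultimately show ?thesis by (intro bexI[of _ "lkill {0} b"] bexI[of _ b']) (auto simp: BB_def algebra_simps)
qed

lemma CC_kill0: "c \<in> CC d \<Longrightarrow> lkill {0} c = c"
  by (auto simp: CC_def intro: lkill_id)

lemma BB_kill_t: "d > 0 \<Longrightarrow> b \<in> BB d \<Longrightarrow> lkill {0} (tt * b) = 0"
  unfolding BB_def by (subst lkill_mult[of _ "{..<d}"]) (auto simp: Loc_closed lkill_xv)

lemma CC_t_BB: "d > 0 \<Longrightarrow> c \<in> CC d \<Longrightarrow> b \<in> BB d \<Longrightarrow> c = tt * b \<Longrightarrow> c = 0"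
  using CC_kill0 BB_kill_t by metis

text \<open>A fibre product: \<open>bb\<close> is the image in the local polynomial ring, the other
  coordinates form an algebra over \<open>CC d\<close>, and the two are glued along the expansion
  modulo t^2. This is possible because t^2 annihilates the nilpotent part, on which
  \<open>bb\<close> therefore acts through \<open>e0\<close> and \<open>e1\<close>.\<close>

definition R0 :: "nat \<Rightarrow> elt set" where
  "R0 d = {r. bb r \<in> BB d \<and> e0 r \<in> CC d \<and> e1 r \<in> CC d \<and> y1 r \<in> CC d \<and> y2 r \<in> CC d \<and> z1 r \<in> CC d \<and>
    z2 r \<in> CC d \<and> f1 r \<in> CC d \<and> f2 r \<in> CC d \<and> (\<exists>u\<in>BB d. bb r = e0 r + e1 r * tt + tt * tt * u)}"

lemma R0D:
  assumes "r \<in> R0 d"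
  shows "bb r \<in> BB d" "e0 r \<in> CC d" "e1 r \<in> CC d" "y1 r \<in> CC d" "y2 r \<in> CC d" "z1 r \<in> CC d"
    "z2 r \<in> CC d" "f1 r \<in> CC d" "f2 r \<in> CC d" "\<exists>u\<in>BB d. bb r = e0 r + e1 r * tt + tt * tt * u"
  using assms by (auto simp: R0_def)

lemma R0I:
  assumes "bb r \<in> BB d" "e0 r \<in> CC d" "e1 r \<in> CC d" "y1 r \<in> CC d" "y2 r \<in> CC d" "z1 r \<in> CC d"
    "z2 r \<in> CC d" "f1 r \<in> CC d" "f2 r \<in> CC d" "u \<in> BB d" "bb r = e0 r + e1 r * tt + tt * tt * u"
  shows "r \<in> R0 d"
  using assms unfolding R0_def by blast

lemma R0_subring: "d > 0 \<Longrightarrow> subring_set (R0 d)"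
  unfolding subring_set_def
proof (intro conjI ballI)
  assume d: "d > 0"
  note t = BB_closed(7)[OF d]
  show "0 \<in> R0 d" "1 \<in> R0 d" by (rule R0I[of _ _ 0]; simp add: BB_closed CC_closed)+
  fix r s assume rs: "r \<in> R0 d" "s \<in> R0 d"
  obtain u v where u: "u \<in> BB d" "bb r = e0 r + e1 r * tt + tt * tt * u"
    and v: "v \<in> BB d" "bb s = e0 s + e1 s * tt + tt * tt * v" using R0D(10)[OF rs(1)] R0D(10)[OF rs(2)] by blast
  note D = R0D(1-9)[OF rs(1)] R0D(1-9)[OF rs(2)]
  have e: "bb (r + s) = e0 (r + s) + e1 (r + s) * tt + tt * tt * (u + v)"
    "bb (r - s) = e0 (r - s) + e1 (r - s) * tt + tt * tt * (u - v)"
    by (simp_all add: u(2) v(2) algebra_simps)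
  show "r + s \<in> R0 d" by (rule R0I[OF _ _ _ _ _ _ _ _ _ _ e(1)]; simp add: D BB_closed CC_closed u(1) v(1))
  show "r - s \<in> R0 d" by (rule R0I[OF _ _ _ _ _ _ _ _ _ _ e(2)]; simp add: D BB_closed CC_closed u(1) v(1))
  have rB: "e0 r \<in> BB d" "e1 r \<in> BB d" "e0 s \<in> BB d" "e1 s \<in> BB d" using D by (auto intro: CC_BB)
  \<comment> \<open>The cofactor of t^2 when the two expansions are multiplied out.\<close>
  let ?w = "e1 r * e1 s + u * (e0 s + e1 s * tt) + v * (e0 r + e1 r * tt) + u * v * tt * tt"
  have "?w \<in> BB d" using rB u(1) v(1) t by (simp add: BB_closed(3-6))
  moreover have "bb (r * s) = e0 (r * s) + e1 (r * s) * tt + tt * tt * ?w"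
    by (simp add: u(2) v(2) algebra_simps)
  ultimately show "r * s \<in> R0 d"
    by (rule R0I[rotated 9]) (simp_all add: D BB_closed CC_closed)
qed

text \<open>Splitting off t twice supplies the matching \<open>e0\<close> and \<open>e1\<close>; the
  nilpotent coordinates are set to 0.\<close>

lemma R0_bb_surj:
  assumes "d > 0" "b \<in> BB d"
  shows "\<exists>r\<in>R0 d. bb r = b"
proof -
  obtain c b' where c: "c \<in> CC d" "b' \<in> BB d" "b = c + tt * b'" using BB_split[OF assms] by blast
  obtain c' b'' where c': "c' \<in> CC d" "b'' \<in> BB d" "b' = c' + tt * b''" using BB_split[OF assms(1) c(2)] by blast
  have "Elt b c c' 0 0 0 0 0 0 \<in> R0 d"
    using c c' assms by (auto simp: R0_def CC_closed algebra_simps intro!: bexI[of _ b''])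
  then show ?thesis by force
qed

definition Cel :: "ratfun \<Rightarrow> elt" where "Cel c = Elt c c 0 0 0 0 0 0 0"

lemma Cel_sel [simp]: "bb (Cel c) = c" "e0 (Cel c) = c" "e1 (Cel c) = 0" "y1 (Cel c) = 0" "y2 (Cel c) = 0"
  "z1 (Cel c) = 0" "z2 (Cel c) = 0" "f1 (Cel c) = 0" "f2 (Cel c) = 0"
  by (simp_all add: Cel_def)

lemma Cel_R0: "c \<in> CC d \<Longrightarrow> Cel c \<in> R0 d"
  by (auto simp: R0_def CC_closed CC_BB BB_closed intro!: bexI[of _ 0])

text \<open>Comparing the coefficients of 1 and t in the gluing condition makes \<open>e0\<close>
  and \<open>e1\<close> vanish. The square of what remains lies in the span of f_1, f_2, which the
  nilpotent part annihilates.\<close>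

lemma R0_nil:
  assumes "d > 0" "r \<in> R0 d" "bb r = 0"
  shows "e0 r = 0" "e1 r = 0" "r * r * r = 0"
proof -
  obtain u where u: "u \<in> BB d" "0 = e0 r + e1 r * tt + tt * tt * u" using R0D(10)[OF assms(2)] assms(3) by auto
  note t = BB_closed(7)[OF assms(1)]
  have e: "e0 r \<in> CC d" "e1 r \<in> CC d" using assms(2) by (auto simp: R0_def)
  have "e0 r = tt * - (e1 r + tt * u)" using u(2) by (simp add: algebra_simps eq_neg_iff_add_eq_0)
  moreover have "- (e1 r + tt * u) \<in> BB d" using e[THEN CC_BB] u(1) t by (simp add: BB_closed(3-6))
  ultimately show e0: "e0 r = 0" using CC_t_BB[OF assms(1) e(1)] by blast
  have "tt * (e1 r + tt * u) = 0" using u(2) e0 by (simp add: algebra_simps)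
  then have "e1 r = tt * - u" by (simp add: eq_neg_iff_add_eq_0)
  then show e1: "e1 r = 0" using CC_t_BB[OF assms(1) e(2)] BB_closed(5)[OF u(1)] by blast
  show "r * r * r = 0" using e0 e1 assms(3) by (simp add: elt_eq_iff)
qed

section \<open>Noetherianness by filtering the nilpotent ideal\<close>

definition noeth_below :: "'r::comm_ring_1 set \<Rightarrow> 'r set \<Rightarrow> bool" where
  "noeth_below A W \<longleftrightarrow> (\<forall>I. sideal A I \<longrightarrow> I \<subseteq> W \<longrightarrow> (\<exists>F. finite F \<and> generates A F I))"

text \<open>The extension argument for Noetherian modules, with W / W' embedded into D by \<phi>. By
  \<open>lift\<close>, multiplication by D on values of \<phi> is induced from A, so images of
  ideals are ideals of D. Lifted generators of \<phi>(I) and generators of I \<inter> W' together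
  generate I.\<close>

lemma noeth_step:
  fixes \<phi> :: "'r::comm_ring_1 \<Rightarrow> 'k::comm_ring_1"
  assumes A: "subring_set A" and D: "noeth D" and W': "sideal A W'"
    and W'_eq: "W' = {w \<in> W. \<phi> w = 0}"
    and add: "\<And>x y. x \<in> W \<Longrightarrow> y \<in> W \<Longrightarrow> \<phi> (x + y) = \<phi> x + \<phi> y"
    and W: "sideal A W" and \<phi>D: "\<And>w. w \<in> W \<Longrightarrow> \<phi> w \<in> D"
    and lift: "\<And>c. c \<in> D \<Longrightarrow> \<exists>a\<in>A. \<forall>w\<in>W. \<phi> (a * w) = c * \<phi> w"
    and IH: "noeth_below A W'"
  shows "noeth_below A W"
  unfolding noeth_below_def
proof (intro allI impI)
  fix I assume I: "sideal A I" "I \<subseteq> W"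
  note c = subring_setD[OF A]
  have neg: "- x \<in> K" if "sideal A K" "x \<in> K" for x K
    using sidealD(4)[OF that(1) _ that(2), of "0 - 1"] c(4)[OF c(1,2)] by simp
  have \<phi>0: "\<phi> 0 = 0" using add[of 0 0] sidealD(2)[OF W] by simp
  have \<phi>neg: "\<phi> (- x) = - \<phi> x" if "x \<in> W" for x
    using add[OF that neg[OF W that]] \<phi>0 by (simp add: eq_neg_iff_add_eq_0 add.commute)
  have img: "sideal D (\<phi> ` K)" if K: "sideal A K" "K \<subseteq> W" for K
    unfolding sideal_def
  proof (intro conjI ballI)
    show "\<phi> ` K \<subseteq> D" using K \<phi>D by blast
    show "0 \<in> \<phi> ` K" using \<phi>0 sidealD(2)[OF K(1)] by (metis imageI)
  next
    fix x y assume "x \<in> \<phi> ` K" "y \<in> \<phi> ` K"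
    then obtain a b where ab: "a \<in> K" "b \<in> K" "x = \<phi> a" "y = \<phi> b" by blast
    then have "x + y = \<phi> (a + b)" using add[OF subsetD[OF K(2)] subsetD[OF K(2)]] by simp
    then show "x + y \<in> \<phi> ` K" using ab sidealD(3)[OF K(1)] by blast
  next
    fix k x assume "k \<in> D" "x \<in> \<phi> ` K"
    then obtain a w where "a \<in> A" "\<forall>w\<in>W. \<phi> (a * w) = k * \<phi> w" "w \<in> K" "x = \<phi> w" using lift by blast
    then have "k * x = \<phi> (a * w)" "a * w \<in> K" using K sidealD(4)[OF K(1)] by auto
    then show "k * x \<in> \<phi> ` K" by blast
  qed
  have int: "sideal A (K \<inter> L)" if "sideal A K" "sideal A L" for K L
    using that by (auto simp: sideal_def)
  obtain FD where FD: "finite FD" "generates D FD (\<phi> ` I)" using D img[OF I] unfolding noeth_def by blast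
  then have "FD \<subseteq> \<phi> ` I" by (simp add: generates_def)
  then obtain G where G: "G \<subseteq> I" "finite G" "FD = \<phi> ` G" using FD(1) finite_subset_image by metis
  obtain F' where F': "finite F'" "generates A F' (I \<inter> W')" using IH int[OF I(1) W'] unfolding noeth_below_def by blast
  have "generates A (G \<union> F') I"
    unfolding generates_def
  proof (intro conjI allI impI)
    show "G \<union> F' \<subseteq> I" using G F' by (auto simp: generates_def)
    fix J assume J: "sideal A J" "G \<union> F' \<subseteq> J"
    have "FD \<subseteq> \<phi> ` (J \<inter> I)" using G J(2) by blast
    then have sub: "\<phi> ` I \<subseteq> \<phi> ` (J \<inter> I)"
      using FD(2) img[OF int[OF J(1) I(1)]] I(2) unfolding generates_def by blast
    show "I \<subseteq> J"
    proof
      fix x assume x: "x \<in> I"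
      then obtain j where j: "j \<in> J" "j \<in> I" "\<phi> x = \<phi> j" using sub by blast
      have xj: "x + - j \<in> I" using sidealD(3)[OF I(1) x neg[OF I(1) j(2)]] .
      moreover have "\<phi> (x + - j) = 0"        using add[OF subsetD[OF I(2) x] subsetD[OF I(2) neg[OF I(1) j(2)]]] j(3) \<phi>neg[OF subsetD[OF I(2) j(2)]] by simp
      ultimately have "x + - j \<in> I \<inter> W'" using I(2) W'_eq by blast
      then have "x + - j \<in> J" using F'(2) J unfolding generates_def by blast
      then have "x + - j + j \<in> J" using sidealD(3)[OF J(1)] j(1) by blast
      then show "x \<in> J" by simp
    qed
  qed
  then show "\<exists>F. finite F \<and> generates A F I" using G(2) F'(1) by blast
qed

lemma Loc_noeth: "noeth (BB d)" "noeth (CC d)"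
  by (auto simp: BB_def CC_def intro: noeth_Loc)

lemma R0_noeth:
  assumes d: "d > 0"
  shows "noeth (R0 d)"
proof -
  note sr = R0_subring[OF d] and nil = R0_nil(1,2)[OF d]
  note c = subring_setD[OF sr]
  define W1 where "W1 = {r \<in> R0 d. bb r = 0}"
  define W2 where "W2 = {r \<in> W1. y1 r = 0}"
  define W3 where "W3 = {r \<in> W2. y2 r = 0}"
  define W4 where "W4 = {r \<in> W3. z1 r = 0}"
  define W5 where "W5 = {r \<in> W4. z2 r = 0}"
  \<comment> \<open>The f coordinates come last: multiplication by t, y_i and z_i feeds the y and z
    coordinates into them, so their vanishing defines an ideal only after those coordinates are
    zero.\<close>
  define W6 where "W6 = {r \<in> W5. f1 r = 0}"
  define W7 where "W7 = {r \<in> W6. f2 r = 0}"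
  have z: "e0 r = 0" "e1 r = 0" "r \<in> R0 d" "bb r = 0" if "r \<in> W1" for r using that nil by (auto simp: W1_def)
  have s0: "sideal (R0 d) (R0 d)" using c by (auto simp: sideal_def)
  have s1: "sideal (R0 d) W1" unfolding sideal_def using c by (auto simp: W1_def)
  have s2: "sideal (R0 d) W2" unfolding sideal_def using sidealD[OF s1] z by (auto simp: W2_def)
  have s3: "sideal (R0 d) W3" unfolding sideal_def using sidealD[OF s2] z by (auto simp: W3_def W2_def)
  have s4: "sideal (R0 d) W4" unfolding sideal_def using sidealD[OF s3] z by (auto simp: W4_def W3_def W2_def)
  have s5: "sideal (R0 d) W5" unfolding sideal_def using sidealD[OF s4] z by (auto simp: W5_def W4_def W3_def W2_def)
  have s6: "sideal (R0 d) W6" unfolding sideal_def using sidealD[OF s5] z by (auto simp: W6_def W5_def W4_def W3_def W2_def)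
  have s7: "sideal (R0 d) W7" unfolding sideal_def using sidealD[OF s6] z by (auto simp: W7_def W6_def W5_def W4_def W3_def W2_def)
  have W7: "W7 \<subseteq> {0}" using z by (auto simp: W7_def W6_def W5_def W4_def W3_def W2_def elt_eq_iff)
  \<comment> \<open>\<open>Cel k\<close> multiplies every coordinate by k and so realises the action
    of \<open>CC d\<close> on each successive quotient.\<close>
  have CC: "\<exists>a\<in>R0 d. \<forall>w\<in>W. \<phi> (a * w) = k * \<phi> w" if "\<And>w. w \<in> W \<Longrightarrow> \<phi> (Cel k * w) = k * \<phi> w" "k \<in> CC d"
    for W \<phi> k using that Cel_R0[OF that(2)] by blast
  have n7: "noeth_below (R0 d) W7"
    unfolding noeth_below_def generates_def
    using W7 sidealD(2) by (intro allI impI exI[of _ "{}"]) blast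
  have n6: "noeth_below (R0 d) W6"
    by (rule noeth_step[OF sr Loc_noeth(2)[of d] s7 W7_def _ s6 _ _ n7]; (rule CC)?)
      (use z in \<open>auto simp: W6_def W5_def W4_def W3_def W2_def R0D\<close>)
  have n5: "noeth_below (R0 d) W5"
    by (rule noeth_step[OF sr Loc_noeth(2)[of d] s6 W6_def _ s5 _ _ n6]; (rule CC)?)
      (use z in \<open>auto simp: W5_def W4_def W3_def W2_def R0D\<close>)
  have n4: "noeth_below (R0 d) W4"
    by (rule noeth_step[OF sr Loc_noeth(2)[of d] s5 W5_def _ s4 _ _ n5]; (rule CC)?)
      (use z in \<open>auto simp: W4_def W3_def W2_def R0D\<close>)
  have n3: "noeth_below (R0 d) W3"
    by (rule noeth_step[OF sr Loc_noeth(2)[of d] s4 W4_def _ s3 _ _ n4]; (rule CC)?)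
      (use z in \<open>auto simp: W3_def W2_def R0D\<close>)
  have n2: "noeth_below (R0 d) W2"
    by (rule noeth_step[OF sr Loc_noeth(2)[of d] s3 W3_def _ s2 _ _ n3]; (rule CC)?)
      (use z in \<open>auto simp: W2_def R0D\<close>)
  have n1: "noeth_below (R0 d) W1"
    by (rule noeth_step[OF sr Loc_noeth(2)[of d] s2 W2_def _ s1 _ _ n2]; (rule CC)?)
      (use z in \<open>auto simp: R0D\<close>)
  have "noeth_below (R0 d) (R0 d)"
  proof (rule noeth_step[OF sr Loc_noeth(1)[of d] s1 W1_def _ s0 _ _ n1])
    fix k assume "k \<in> BB d"
    then obtain r where "r \<in> R0 d" "bb r = k" using R0_bb_surj[OF d] by blast
    then show "\<exists>a\<in>R0 d. \<forall>w\<in>R0 d. bb (a * w) = k * bb w" by auto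
  qed (auto simp: R0D)
  then show ?thesis using sidealD(1) unfolding noeth_def noeth_below_def by blast
qed

section \<open>Prime ideals, the maximal ideal and units\<close>

lemma sprime_bb_image:
  assumes d: "d > 0" and p: "sprime (R0 d) p"
  shows "sprime (BB d) (bb ` p)" "r \<in> R0 d \<Longrightarrow> bb r \<in> bb ` p \<Longrightarrow> r \<in> p"
proof -
  note c = subring_setD[OF R0_subring[OF d]]
  have P: "sideal (R0 d) p" "1 \<notin> p" "\<And>a b. a \<in> R0 d \<Longrightarrow> b \<in> R0 d \<Longrightarrow> a * b \<in> p \<Longrightarrow> a \<in> p \<or> b \<in> p"
    using p by (auto simp: sprime_def)
  show mem: "r \<in> p" if r: "r \<in> R0 d" "bb r \<in> bb ` p" for r
  proof -
    obtain s where s: "s \<in> p" "bb r = bb s" using r(2) by blast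
    then have sR: "s \<in> R0 d" using sidealD(1)[OF P(1)] by blast
    have n: "r - s \<in> R0 d" by (rule c(4)[OF r(1) sR])
    \<comment> \<open>The kernel of \<open>bb\<close> consists of elements of cube zero and hence
      lies in every prime, so membership in p depends on \<open>bb\<close> alone.\<close>
    have "(r - s) * (r - s) * (r - s) = 0" by (rule R0_nil(3)[OF d n]) (simp add: s)
    then have "(r - s) * (r - s) * (r - s) \<in> p" using sidealD(2)[OF P(1)] by metis
    then have "r - s \<in> p" using P(3) n c(5)[OF n n] by blast
    then have "r - s + s \<in> p" using sidealD(3)[OF P(1)] s(1) by blast
    then show ?thesis by simp
  qed
  have pR: "p \<subseteq> R0 d" using sidealD(1)[OF P(1)] .
  have "sideal (BB d) (bb ` p)"
    unfolding sideal_def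
  proof (intro conjI ballI)
    show "bb ` p \<subseteq> BB d" using pR R0D(1) by blast
    show "0 \<in> bb ` p" using sidealD(2)[OF P(1)] by (metis elt_sel(1) imageI)
  next
    fix x y assume "x \<in> bb ` p" "y \<in> bb ` p"
    then obtain a b where "a \<in> p" "b \<in> p" "x = bb a" "y = bb b" by blast
    then have "a + b \<in> p" "x + y = bb (a + b)" using sidealD(3)[OF P(1)] by auto
    then show "x + y \<in> bb ` p" by blast
  next
    fix k x assume "k \<in> BB d" "x \<in> bb ` p"
    then obtain a w where "a \<in> R0 d" "bb a = k" "w \<in> p" "x = bb w" using R0_bb_surj[OF d] by blast
    then have "k * x = bb (a * w)" "a * w \<in> p" using sidealD(4)[OF P(1)] by auto
    then show "k * x \<in> bb ` p" by blast
  qed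
  moreover have "1 \<notin> bb ` p" using mem[of 1] c(2) P(2) by auto
  moreover have "x \<in> bb ` p \<or> y \<in> bb ` p" if xy: "x \<in> BB d" "y \<in> BB d" "x * y \<in> bb ` p" for x y
  proof -
    obtain r s where rs: "r \<in> R0 d" "bb r = x" "s \<in> R0 d" "bb s = y" using R0_bb_surj[OF d] xy by metis
    then have "r * s \<in> p" using mem[of "r * s"] c(5) xy(3) by simp
    then show ?thesis using P(3) rs by blast
  qed
  ultimately show "sprime (BB d) (bb ` p)" unfolding sprime_def by blast
qed

lemma R0_prime_chain_bound:
  assumes d: "d > 0" and p: "\<And>i. i \<le> n \<Longrightarrow> sprime (R0 d) (p i)" and chain: "\<And>i. i < n \<Longrightarrow> p i \<subset> p (Suc i)"
  shows "n \<le> d"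
proof (rule Loc_prime_chain_bound[of n d "\<lambda>i. bb ` p i"])
  show "sprime (Loc {..<d}) (bb ` p i)" if "i \<le> n" for i
    using sprime_bb_image(1)[OF d p[OF that]] by (simp add: BB_def)
  show "bb ` p i \<subset> bb ` p (Suc i)" if i: "i < n" for i
  proof -
    obtain r where r: "r \<in> p (Suc i)" "r \<notin> p i" using chain[OF i] by blast
    have "sideal (R0 d) (p (Suc i))" using p[of "Suc i"] i by (simp add: sprime_def)
    then have "r \<in> R0 d" using sidealD(1) r(1) by blast
    then have "bb r \<notin> bb ` p i" using sprime_bb_image(2)[OF d p[of i]] i r(2) by auto
    then show ?thesis using chain[OF i] r(1) by blast
  qed
qed

text \<open>The preimages under \<open>bb\<close> of the primes generated by the first i variables,
  t included; they form a chain of length d.\<close>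

definition prime_chain :: "nat \<Rightarrow> nat \<Rightarrow> elt set" where
  "prime_chain d i = {r \<in> R0 d. lkill {..<i} (bb r) = 0}"

lemma lkill_BB:
  assumes "a \<in> BB d" "b \<in> BB d"
  shows "lkill S (a + b) = lkill S a + lkill S b" "lkill S (a * b) = lkill S a * lkill S b"
    "lkill S (a - b) = lkill S a - lkill S b"
  using assms lkill_add lkill_mult lkill_diff unfolding BB_def by blast+

lemma prime_chain_sprime:
  assumes d: "d > 0"
  shows "sprime (R0 d) (prime_chain d i)"
proof -
  note c = subring_setD[OF R0_subring[OF d]]
  show ?thesis
    unfolding sprime_def sideal_def prime_chain_def
    using c(1,2,3,5) by (auto simp: lkill_BB[OF R0D(1) R0D(1)])
qed

lemma prime_chain_strict:
  assumes d: "d > 0" and i: "i < d"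
  shows "prime_chain d i \<subset> prime_chain d (Suc i)"
proof
  show "prime_chain d i \<subseteq> prime_chain d (Suc i)"
  proof
    fix r assume r: "r \<in> prime_chain d i"
    then have "bb r \<in> Loc {..<d}" using R0D(1) by (auto simp: prime_chain_def BB_def)
    then have "lkill {..<Suc i} (bb r) = lkill {i} (lkill {..<i} (bb r))"
      by (subst lkill_lkill) (auto simp: lessThan_Suc)
    then show "r \<in> prime_chain d (Suc i)" using r by (simp add: prime_chain_def)
  qed
  obtain r where r: "r \<in> R0 d" "bb r = xv i" using R0_bb_surj[OF d BB_closed(7)[OF i]] by blast
  then have "r \<in> prime_chain d (Suc i)" "r \<notin> prime_chain d i" by (auto simp: prime_chain_def lkill_xv)
  then show "prime_chain d i \<noteq> prime_chain d (Suc i)" by blast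
qed

definition max0 :: "nat \<Rightarrow> elt set" where
  "max0 d = {r \<in> R0 d. lkill UNIV (bb r) = 0}"

lemma max0_sideal:
  assumes d: "d > 0"
  shows "sideal (R0 d) (max0 d)" "1 \<notin> max0 d"
  unfolding sideal_def max0_def using subring_setD(1,2,3,5)[OF R0_subring[OF d]]
  by (auto simp: lkill_BB[OF R0D(1) R0D(1)])

text \<open>Units lift modulo the nilpotent kernel of \<open>bb\<close>: inverting
  \<open>bb r\<close> gives r s = 1 + n with n^3 = 0, and (1 + n)(1 - n + n^2) = 1 + n^3.\<close>

lemma R0_unit:
  assumes d: "d > 0" and r: "r \<in> R0 d" "r \<notin> max0 d"
  shows "\<exists>s\<in>R0 d. r * s = 1"
proof -
  note c = subring_setD[OF R0_subring[OF d]]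
  have "bb r \<in> Loc {..<d}" "lkill UNIV (bb r) \<noteq> 0" using r R0D(1) by (auto simp: max0_def BB_def)
  then have "inverse (bb r) \<in> BB d" "bb r \<noteq> 0" using Loc_inverse by (auto simp: BB_def)
  then obtain s where s: "s \<in> R0 d" "bb s = inverse (bb r)" using R0_bb_surj[OF d] by metis
  define n where "n = r * s - 1"
  have nR: "n \<in> R0 d" unfolding n_def by (rule c(4)[OF c(5)[OF r(1) s(1)] c(2)])
  have "bb n = 0" unfolding n_def using s(2) \<open>bb r \<noteq> 0\<close> by simp
  then have n3: "n * n * n = 0" by (rule R0_nil(3)[OF d nR])
  have "r * (s * (1 - n + n * n)) = (1 + n) * (1 - n + n * n)" unfolding n_def by (simp add: mult.assoc)
  also have "\<dots> = 1 + n * n * n" by (simp add: algebra_simps)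
  finally have "r * (s * (1 - n + n * n)) = 1" using n3 by simp
  moreover have "s * (1 - n + n * n) \<in> R0 d"
    by (rule c(5)[OF s(1) c(3)[OF c(4)[OF c(2) nR] c(5)[OF nR nR]]])
  ultimately show ?thesis by blast
qed

section \<open>The ideals of the ring\<close>

text \<open>Substitution of 0 for the variables in S. If S does not contain the index 0 of t, this
  is an idempotent ring endomorphism of \<open>R0 d\<close> that fixes the other variables; the
  ideals below and divisibility by variables are read off from it.\<close>

definition ek :: "nat set \<Rightarrow> elt \<Rightarrow> elt" where
  "ek S r = Elt (lkill S (bb r)) (lkill S (e0 r)) (lkill S (e1 r)) (lkill S (y1 r)) (lkill S (y2 r))
     (lkill S (z1 r)) (lkill S (z2 r)) (lkill S (f1 r)) (lkill S (f2 r))"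

lemma ek_sel [simp]: "bb (ek S r) = lkill S (bb r)" "e0 (ek S r) = lkill S (e0 r)" "e1 (ek S r) = lkill S (e1 r)"
  "y1 (ek S r) = lkill S (y1 r)" "y2 (ek S r) = lkill S (y2 r)" "z1 (ek S r) = lkill S (z1 r)"
  "z2 (ek S r) = lkill S (z2 r)" "f1 (ek S r) = lkill S (f1 r)" "f2 (ek S r) = lkill S (f2 r)"
  by (simp_all add: ek_def)

definition Xel :: "nat \<Rightarrow> elt" where "Xel s = Cel (xv s)"
definition Tel :: elt where "Tel = Elt tt 0 1 0 0 0 0 0 0"

text \<open>\<open>JJ d S\<close> and \<open>II d S\<close> are the ideals generated by the \<open>Xel s\<close> with \<open>s \<in> S\<close>, the latter together
  with \<open>Tel\<close>. The coordinates \<open>e1\<close>, \<open>f1\<close>, \<open>f2\<close> are free in \<open>II d S\<close> because \<open>t\<close> and \<open>f\<^sub>i = t z\<^sub>i\<close> are multiples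
  of \<open>t\<close>.\<close>

definition JJ :: "nat \<Rightarrow> nat set \<Rightarrow> elt set" where
  "JJ d S = {r \<in> R0 d. ek S r = 0}"

definition II :: "nat \<Rightarrow> nat set \<Rightarrow> elt set" where
  "II d S = {r \<in> R0 d. lkill S (e0 r) = 0 \<and> lkill S (y1 r) = 0 \<and> lkill S (y2 r) = 0 \<and>
     lkill S (z1 r) = 0 \<and> lkill S (z2 r) = 0}"

lemma lkill_CC:
  assumes "a \<in> CC d" "b \<in> CC d"
  shows "lkill S (a + b) = lkill S a + lkill S b" "lkill S (a * b) = lkill S a * lkill S b"
    "lkill S (a - b) = lkill S a - lkill S b"
  using assms lkill_add lkill_mult lkill_diff unfolding CC_def by blast+

lemma lkill_mem: "b \<in> BB d \<Longrightarrow> lkill S b \<in> BB d" "c \<in> CC d \<Longrightarrow> lkill S c \<in> CC d"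
  by (simp_all add: BB_def CC_def lkill_Loc')

lemma lkill_comp: "b \<in> BB d \<Longrightarrow> lkill S (lkill T b) = lkill (S \<union> T) b"
  "c \<in> CC d \<Longrightarrow> lkill S (lkill T c) = lkill (S \<union> T) c"
  by (auto simp: BB_def CC_def intro: lkill_lkill)

lemma ek_R0:
  assumes d: "d > 0" and S: "0 \<notin> S" and r: "r \<in> R0 d"
  shows "ek S r \<in> R0 d"
proof -
  note D = R0D(1-9)[OF r] and t = BB_closed(7)[OF d]
  obtain u where u: "u \<in> BB d" "bb r = e0 r + e1 r * tt + tt * tt * u" using R0D(10)[OF r] by blast
  have eq: "lkill S (bb r) = lkill S (e0 r) + lkill S (e1 r) * tt + tt * tt * lkill S u"
    unfolding u(2) using D(2,3)[THEN CC_BB] u(1) t S by (simp add: lkill_BB[of _ d] BB_closed lkill_xv)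
  show ?thesis
    by (rule R0I[of _ _ "lkill S u"]) (simp_all only: ek_sel lkill_mem D u(1) eq[symmetric])
qed

lemma ek_add: "r \<in> R0 d \<Longrightarrow> s \<in> R0 d \<Longrightarrow> ek S (r + s) = ek S r + ek S s"
  by (simp add: elt_eq_iff lkill_BB[OF R0D(1) R0D(1)] lkill_CC[of _ d] R0D(2-9))

lemma ek_diff: "r \<in> R0 d \<Longrightarrow> s \<in> R0 d \<Longrightarrow> ek S (r - s) = ek S r - ek S s"
  by (simp add: elt_eq_iff lkill_BB[OF R0D(1) R0D(1)] lkill_CC[of _ d] R0D(2-9))

lemma ek_mult: "r \<in> R0 d \<Longrightarrow> s \<in> R0 d \<Longrightarrow> ek S (r * s) = ek S r * ek S s"
  by (simp add: elt_eq_iff lkill_BB[OF R0D(1) R0D(1)] lkill_CC[of _ d] R0D(2-9) CC_closed)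

lemma ek_ek: "r \<in> R0 d \<Longrightarrow> ek S (ek T r) = ek (S \<union> T) r"
  by (simp add: elt_eq_iff lkill_comp(1)[OF R0D(1)] lkill_comp(2)[OF R0D(2)] lkill_comp(2)[OF R0D(3)]
    lkill_comp(2)[OF R0D(4)] lkill_comp(2)[OF R0D(5)] lkill_comp(2)[OF R0D(6)] lkill_comp(2)[OF R0D(7)]
    lkill_comp(2)[OF R0D(8)] lkill_comp(2)[OF R0D(9)])

lemma II_iff: "r \<in> II d S \<longleftrightarrow> r \<in> R0 d \<and> e0 (ek S r) = 0 \<and> y1 (ek S r) = 0 \<and> y2 (ek S r) = 0 \<and>
    z1 (ek S r) = 0 \<and> z2 (ek S r) = 0"
  by (simp add: II_def)

lemma ek_0: "ek S 0 = 0"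
  by (simp add: elt_eq_iff)

lemma II_sideal: "d > 0 \<Longrightarrow> sideal (R0 d) (II d S)"
  unfolding sideal_def II_iff subset_eq Ball_def
  using subring_setD(1,3,5)[OF R0_subring[of d]]
  by (auto simp: ek_add ek_mult ek_0 simp del: ek_sel)

lemma JJ_sideal: "d > 0 \<Longrightarrow> sideal (R0 d) (JJ d S)"
  unfolding sideal_def JJ_def
  using subring_setD(1,3,5)[OF R0_subring[of d]]
  by (auto simp: ek_add ek_mult ek_0)

lemma Xel_R0: "s \<in> {1..<d} \<Longrightarrow> Xel s \<in> R0 d"
  unfolding Xel_def by (rule Cel_R0) (rule CC_closed)

lemma Tel_R0: "d > 0 \<Longrightarrow> Tel \<in> R0 d"
  by (rule R0I[of _ _ 0]) (simp_all add: Tel_def BB_closed CC_closed)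

lemma ek_Xel: "ek S (Xel s) = (if s \<in> S then 0 else Xel s)"
  by (auto simp: elt_eq_iff Xel_def lkill_xv)

lemma CC_dvd: "s \<in> {1..<d} \<Longrightarrow> c \<in> CC d \<Longrightarrow> lkill {s} c = 0 \<Longrightarrow> \<exists>c'\<in>CC d. c = xv s * c'"
  unfolding CC_def by (rule lkill_eq_0_dvd)

lemma BB_dvd: "b \<in> BB d \<Longrightarrow> lkill {s} b = 0 \<Longrightarrow> \<exists>b'\<in>BB d. b = xv s * b'"
  unfolding BB_def by (rule lkill_eq_0_dvd)

text \<open>Each coordinate can be divided by x_s. The quotients still have to satisfy the gluing
  condition; its remainder u is divisible too because x_s is a variable different from t.\<close>

lemma ek_eq_0_dvd:
  assumes d: "d > 0" and s: "s \<in> {1..<d}" and r: "r \<in> R0 d" and k: "ek {s} r = 0"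
  shows "\<exists>r'\<in>R0 d. r = Xel s * r'"
proof -
  note D = R0D(1-9)[OF r]
  have k': "lkill {s} (bb r) = 0" "lkill {s} (e0 r) = 0" "lkill {s} (e1 r) = 0" "lkill {s} (y1 r) = 0"
    "lkill {s} (y2 r) = 0" "lkill {s} (z1 r) = 0" "lkill {s} (z2 r) = 0" "lkill {s} (f1 r) = 0" "lkill {s} (f2 r) = 0"
    using k by (simp_all add: elt_eq_iff)
  obtain b where b: "b \<in> BB d" "bb r = xv s * b" using BB_dvd D k' by blast
  obtain a0 where a0: "a0 \<in> CC d" "e0 r = xv s * a0" using CC_dvd[OF s] D k' by blast
  obtain a1 where a1: "a1 \<in> CC d" "e1 r = xv s * a1" using CC_dvd[OF s] D k' by blast
  obtain a2 where a2: "a2 \<in> CC d" "y1 r = xv s * a2" using CC_dvd[OF s] D k' by blast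
  obtain a3 where a3: "a3 \<in> CC d" "y2 r = xv s * a3" using CC_dvd[OF s] D k' by blast
  obtain a4 where a4: "a4 \<in> CC d" "z1 r = xv s * a4" using CC_dvd[OF s] D k' by blast
  obtain a5 where a5: "a5 \<in> CC d" "z2 r = xv s * a5" using CC_dvd[OF s] D k' by blast
  obtain a6 where a6: "a6 \<in> CC d" "f1 r = xv s * a6" using CC_dvd[OF s] D k' by blast
  obtain a7 where a7: "a7 \<in> CC d" "f2 r = xv s * a7" using CC_dvd[OF s] D k' by blast
  obtain u where u: "u \<in> BB d" "bb r = e0 r + e1 r * tt + tt * tt * u" using R0D(10)[OF r] by blast
  have t: "tt \<in> BB d" by (rule BB_closed(7)[OF d])
  have ttu: "tt * tt * u = bb r - e0 r - e1 r * tt" using u(2) by simp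
  have "lkill {s} (tt * tt * u) = 0"
    unfolding ttu using D(1-3) k' t by (simp add: lkill_BB[of _ d] BB_closed CC_BB)
  then have "tt * tt * lkill {s} u = 0" using s u(1) t by (simp add: lkill_BB[of _ d] BB_closed lkill_xv)
  then have "lkill {s} u = 0" by simp
  then obtain v where v: "v \<in> BB d" "u = xv s * v" using BB_dvd u(1) by blast
  have "xv s * b = xv s * (a0 + a1 * tt + tt * tt * v)"
    using u(2) unfolding b(2) a0(2) a1(2) v(2) by (simp add: algebra_simps)
  then have eq: "b = a0 + a1 * tt + tt * tt * v" by simp
  let ?r' = "Elt b a0 a1 a2 a3 a4 a5 a6 a7"
  have "?r' \<in> R0 d" by (rule R0I[of _ _ v]) (simp_all add: b a0 a1 a2 a3 a4 a5 a6 a7 v(1), simp add: eq)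
  moreover have "r = Xel s * ?r'"
    by (simp add: elt_eq_iff Xel_def b(2) a0(2) a1(2) a2(2) a3(2) a4(2) a5(2) a6(2) a7(2))
  ultimately show ?thesis by blast
qed

lemma decompose:
  assumes d: "d > 0" and s: "s \<in> {1..<d}" and r: "r \<in> R0 d"
  shows "\<exists>q\<in>R0 d. r = ek {s} r + Xel s * q"
proof -
  have er: "ek {s} r \<in> R0 d" using ek_R0[OF d _ r] s by auto
  have "r - ek {s} r \<in> R0 d" using subring_setD(4)[OF R0_subring[OF d]] r er by blast
  moreover have "ek {s} (r - ek {s} r) = 0" by (simp only: ek_diff[OF r er] ek_ek[OF r]) simp
  ultimately obtain q where "q \<in> R0 d" "r - ek {s} r = Xel s * q" using ek_eq_0_dvd[OF d s] by blast
  then show ?thesis by (intro bexI[of _ q]) (auto simp: algebra_simps)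
qed

text \<open>Serves \<open>II\<close> and \<open>JJ\<close> together: both impose a condition P on
  the image under \<open>ek S\<close>. Killing one more variable adds the multiples of
  \<open>Xel s\<close>, by \<open>decompose\<close>.\<close>

lemma substitution_ideal_insert:
  assumes d: "d > 0" and s: "s \<in> {1..<d}"
    and K: "\<And>S. K S = {r \<in> R0 d. P (ek S r)}" and P: "\<And>r. P r \<Longrightarrow> P (ek {s} r)"
  shows "K (insert s S) = {a + Xel s * r | a r. a \<in> K S \<and> r \<in> R0 d}"
proof (intro equalityI subsetI)
  fix r assume r: "r \<in> K (insert s S)"
  then have rR: "r \<in> R0 d" by (simp add: K)
  then obtain q where q: "q \<in> R0 d" "r = ek {s} r + Xel s * q" using decompose[OF d s] by blast
  have "ek {s} r \<in> R0 d" using ek_R0[OF d _ rR] s by auto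
  moreover have "ek S (ek {s} r) = ek (insert s S) r" using ek_ek[OF rR, of S "{s}"] by simp
  ultimately have "ek {s} r \<in> K S" using r by (simp add: K)
  then show "r \<in> {a + Xel s * r | a r. a \<in> K S \<and> r \<in> R0 d}" using q by blast
next
  fix r assume "r \<in> {a + Xel s * r | a r. a \<in> K S \<and> r \<in> R0 d}"
  then obtain a q where a: "r = a + Xel s * q" "a \<in> K S" "q \<in> R0 d" by blast
  have aR: "a \<in> R0 d" using a(2) by (simp add: K)
  have XR: "Xel s * q \<in> R0 d" using subring_setD(5)[OF R0_subring[OF d]] Xel_R0[OF s] a(3) by blast
  have "ek (insert s S) r = ek {s} (ek S a)"
    unfolding a(1) ek_add[OF aR XR] ek_mult[OF Xel_R0[OF s] a(3)] ek_ek[OF aR] by (simp add: ek_Xel)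
  moreover have "r \<in> R0 d" unfolding a(1) by (rule subring_setD(3)[OF R0_subring[OF d] aR XR])
  ultimately show "r \<in> K (insert s S)" using a(2) P by (simp add: K)
qed

lemma II_insert:
  assumes "d > 0" "s \<in> {1..<d}"
  shows "II d (insert s S) = {a + Xel s * r | a r. a \<in> II d S \<and> r \<in> R0 d}"
  by (rule substitution_ideal_insert[OF assms, where P = "\<lambda>r. e0 r = 0 \<and> y1 r = 0 \<and> y2 r = 0 \<and> z1 r = 0 \<and> z2 r = 0"])
    (auto simp: II_iff simp del: ek_sel, auto)

lemma JJ_insert:
  assumes "d > 0" "s \<in> {1..<d}"
  shows "JJ d (insert s S) = {a + Xel s * r | a r. a \<in> JJ d S \<and> r \<in> R0 d}"
  by (rule substitution_ideal_insert[OF assms, where P = "\<lambda>r. r = 0"]) (auto simp: JJ_def ek_0)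

text \<open>\<open>ek S\<close> fixes \<open>Xel s\<close> for s outside S, and multiplication by
  \<open>Xel s\<close> scales every coordinate by the nonzero field element
  \<open>xv s\<close>.\<close>

lemma regular_mod:
  assumes d: "d > 0" and s: "s \<in> {1..<d}" "s \<notin> S" and r: "r \<in> R0 d"
  shows "Xel s * r \<in> II d S \<Longrightarrow> r \<in> II d S" "Xel s * r \<in> JJ d S \<Longrightarrow> r \<in> JJ d S"
proof -
  have e: "ek S (Xel s * r) = Xel s * ek S r"
    using ek_mult[OF Xel_R0[OF s(1)] r] s(2) by (simp add: ek_Xel)
  show "Xel s * r \<in> II d S \<Longrightarrow> r \<in> II d S"
    unfolding II_iff e using r by (simp add: Xel_def del: ek_sel)
  show "Xel s * r \<in> JJ d S \<Longrightarrow> r \<in> JJ d S"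
    unfolding JJ_def mem_Collect_eq e using r by (simp add: elt_eq_iff Xel_def del: ek_sel)
qed

lemma ek_empty: "r \<in> R0 d \<Longrightarrow> ek {} r = r"
  using R0D[of r d] by (auto simp: elt_eq_iff BB_def CC_def intro!: lkill_id)

lemma JJ_empty: "d > 0 \<Longrightarrow> JJ d {} = {0}"
  using subring_setD(1)[OF R0_subring] by (auto simp: JJ_def ek_empty ek_0)

lemma II_empty:
  assumes d: "d > 0"
  shows "II d {} = {u * Tel | u. u \<in> R0 d}"
proof (intro equalityI subsetI)
  fix r assume "r \<in> II d {}"
  then have r: "r \<in> R0 d" "e0 r = 0" "y1 r = 0" "y2 r = 0" "z1 r = 0" "z2 r = 0"
    using ek_empty[of r d] by (auto simp: II_iff simp del: ek_sel)
  note D = R0D(1-9)[OF r(1)]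
  obtain u where u: "u \<in> BB d" "bb r = e1 r * tt + tt * tt * u" using R0D(10)[OF r(1)] r(2) by auto
  obtain c v where c: "c \<in> CC d" "v \<in> BB d" "u = c + tt * v" using BB_split[OF d u(1)] by blast
  \<comment> \<open>Division by t: the new \<open>e0\<close> is the old \<open>e1\<close>, the new
    \<open>e1\<close> is the part c of u free of t, and since f_i = t z_i the f coordinates of r
    become z coordinates.\<close>
  let ?q = "Elt (e1 r + tt * u) (e1 r) c 0 0 (f1 r) (f2 r) 0 0"
  have "?q \<in> R0 d"
    by (rule R0I[of _ _ v])
      (use D(3)[THEN CC_BB] BB_closed(7)[OF d] in \<open>simp_all add: D CC_closed u(1) c BB_closed(3,4) algebra_simps CC_BB\<close>)
  moreover have "r = ?q * Tel" using r u(2) by (simp add: elt_eq_iff Tel_def algebra_simps)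
  ultimately show "r \<in> {u * Tel | u. u \<in> R0 d}" by blast
next
  fix r assume "r \<in> {u * Tel | u. u \<in> R0 d}"
  then obtain u where u: "u \<in> R0 d" "r = u * Tel" by blast
  then have "r \<in> R0 d" using subring_setD(5)[OF R0_subring[OF d]] Tel_R0[OF d] by blast
  then show "r \<in> II d {}" using u(2) by (simp add: II_iff ek_empty Tel_def del: ek_sel)
qed

text \<open>The ideal (t, x_S) is t R + (x_S); the generators x_s are added one at a time on both
  sides.\<close>

lemma II_subset_T_JJ:
  assumes d: "d > 0" and "finite S"
  shows "S \<subseteq> {1..<d} \<Longrightarrow> c \<in> II d S \<Longrightarrow> \<exists>u\<in>R0 d. c - Tel * u \<in> JJ d S"
  using assms(2)
proof (induction S arbitrary: c)
  case empty
  then obtain u where "u \<in> R0 d" "c = u * Tel" using II_empty[OF d] by auto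
  then show ?case using JJ_empty[OF d] by (intro bexI[of _ u]) (simp_all add: mult.commute)
next
  case (insert s S)
  then have s: "s \<in> {1..<d}" by simp
  obtain a r where a: "c = a + Xel s * r" "a \<in> II d S" "r \<in> R0 d"
    using insert.prems(2) II_insert[OF d s] by auto
  obtain u where u: "u \<in> R0 d" "a - Tel * u \<in> JJ d S" using insert a by auto
  have "c - Tel * u = (a - Tel * u) + Xel s * r" by (simp add: a(1))
  then have "c - Tel * u \<in> JJ d (insert s S)" unfolding JJ_insert[OF d s] using u(2) a(3) by blast
  then show ?case using u(1) by blast
qed

lemma annihilator_base:
  assumes d: "d > 0" and S: "S \<subseteq> {1..<d}" and c: "c \<in> R0 d"
    and ann: "\<And>s. s \<in> R0 d \<Longrightarrow> s * Tel = 0 \<Longrightarrow> s * c \<in> JJ d S"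
  shows "\<exists>u\<in>R0 d. c - Tel * u \<in> JJ d S"
proof -
  \<comment> \<open>The elements \<open>y\<^sub>1, y\<^sub>2\<close> of \<open>0 : t\<close> already detect all coordinates that are not multiples of \<open>t\<close>.\<close>
  let ?Y1 = "Elt 0 0 0 1 0 0 0 0 0" and ?Y2 = "Elt 0 0 0 0 1 0 0 0 0"
  have "?Y1 \<in> R0 d" "?Y2 \<in> R0 d" by (rule R0I[of _ _ 0]; simp add: BB_closed CC_closed)+
  moreover have "?Y1 * Tel = 0" "?Y2 * Tel = 0" by (simp_all add: elt_eq_iff Tel_def)
  ultimately have "?Y1 * c \<in> JJ d S" "?Y2 * c \<in> JJ d S" using ann by blast+
  \<comment> \<open>y_1 c has coordinates y1 = e0 c, f1 = y1 c, f2 = z2 c, and y_2 c has y2 = e0 c,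
    f1 = z1 c, f2 = y2 c. That these vanish under \<open>lkill S\<close> gives the five conditions
    of \<open>II\<close>.\<close>
  then have "c \<in> II d S" using c by (simp add: JJ_def II_def elt_eq_iff)
  then show ?thesis using II_subset_T_JJ[OF d finite_subset[OF S] S] by simp
qed

lemma II_generated:
  assumes d: "d > 0" and "finite S"
  shows "S \<subseteq> {1..<d} \<Longrightarrow> generates (R0 d) (insert Tel (Xel ` S)) (II d S)"
  using assms(2)
proof (induction S)
  case empty
  show ?case unfolding generates_def II_empty[OF d]
  proof (intro conjI allI impI)
    show "insert Tel (Xel ` {}) \<subseteq> {u * Tel | u. u \<in> R0 d}"
      using subring_setD(2)[OF R0_subring[OF d]] by (auto intro: exI[of _ 1])
  qed (auto simp: sideal_def)
next
  case (insert s S)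
  then have s: "s \<in> {1..<d}" and IH: "generates (R0 d) (insert Tel (Xel ` S)) (II d S)" by auto
  note id = sidealD[OF II_sideal[OF d, of S]]
  have sub: "II d S \<subseteq> II d (insert s S)"
  proof
    fix a assume a: "a \<in> II d S"
    have "a = a + Xel s * 0" by simp
    then show "a \<in> II d (insert s S)" unfolding II_insert[OF d s]
      using a subring_setD(1)[OF R0_subring[OF d]] by blast
  qed
  have "Xel s = 0 + Xel s * 1" by simp
  then have "Xel s \<in> II d (insert s S)" unfolding II_insert[OF d s]
    using id(2) subring_setD(2)[OF R0_subring[OF d]] by blast
  then have "insert Tel (Xel ` insert s S) \<subseteq> II d (insert s S)"
    using sub IH unfolding generates_def by auto
  moreover have "II d (insert s S) \<subseteq> J" if J: "sideal (R0 d) J" "insert Tel (Xel ` insert s S) \<subseteq> J" for J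
  proof -
    have "II d S \<subseteq> J" using IH J unfolding generates_def by auto
    moreover have "r * Xel s \<in> J" if "r \<in> R0 d" for r using sidealD(4)[OF J(1) that] J(2) by auto
    ultimately show ?thesis unfolding II_insert[OF d s] using sidealD(3)[OF J(1)] by (auto simp: mult.commute)
  qed
  ultimately show ?case unfolding generates_def by blast
qed

lemma lkill_max:
  assumes d: "d > 0" and r: "r \<in> R0 d"
  shows "lkill UNIV (bb r) = lkill {1..<d} (e0 r)"
proof -
  obtain u where u: "u \<in> BB d" "bb r = e0 r + e1 r * tt + tt * tt * u" using R0D(10)[OF r] by blast
  note D = R0D(1-9)[OF r]
  have "lkill UNIV (bb r) = lkill UNIV (e0 r)"
    unfolding u(2) using D(2,3)[THEN CC_BB] u(1) BB_closed(7)[OF d] by (simp add: lkill_BB[of _ d] BB_closed lkill_xv)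
  also have "\<dots> = lkill UNIV (lkill {1..<d} (e0 r))" using lkill_comp(2)[OF D(2)] by simp
  also have "\<dots> = lkill {1..<d} (e0 r)"
    by (rule lkill_id[of _ "{}"]) (use lkill_Loc[of "e0 r" "{1..<d}" "{1..<d}"] D(2) in \<open>simp_all add: CC_def\<close>)
  finally show ?thesis .
qed

text \<open>The coordinates of r r constrained by \<open>II\<close> are multiples of
  \<open>e0 r\<close>, which vanishes under the substitution for r in the maximal ideal; so squares
  suffice to reach the parameter ideal.\<close>

lemma II_max0:
  assumes d: "d > 0"
  shows "II d {1..<d} \<subseteq> max0 d" "r \<in> max0 d \<Longrightarrow> r * r \<in> II d {1..<d}"
proof -
  show "II d {1..<d} \<subseteq> max0 d" using lkill_max[OF d] by (auto simp: II_def max0_def)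
  show "r * r \<in> II d {1..<d}" if "r \<in> max0 d"
  proof -
    have r: "r \<in> R0 d" "lkill {1..<d} (e0 r) = 0" using that lkill_max[OF d, of r] by (auto simp: max0_def)
    have "r * r \<in> R0 d" using subring_setD(5)[OF R0_subring[OF d]] r by blast
    then show ?thesis using r by (simp add: II_iff ek_mult[OF r(1) r(1)] del: ek_sel) simp
  qed
qed

section \<open>Transfer to ring records\<close>

text \<open>\<open>R\<close> is the copy along \<open>h\<close> of a subring of a type of class \<open>comm_ring_1\<close>.\<close>

locale ring_rep =
  fixes R :: "'a ring" (structure) and A :: "'r::comm_ring_1 set" and h :: "'r \<Rightarrow> 'a"
  assumes A: "subring_set A" and inj: "inj_on h A" and carrier_eq: "carrier R = h ` A"
    and zero_eq: "\<zero> = h 0" and one_eq: "\<one> = h 1"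
    and add_eq: "\<And>x y. x \<in> A \<Longrightarrow> y \<in> A \<Longrightarrow> h x \<oplus> h y = h (x + y)"
    and mult_eq: "\<And>x y. x \<in> A \<Longrightarrow> y \<in> A \<Longrightarrow> h x \<otimes> h y = h (x * y)"
begin

lemmas Ac = subring_setD[OF A]

lemma h_eq_iff: "x \<in> A \<Longrightarrow> y \<in> A \<Longrightarrow> h x = h y \<longleftrightarrow> x = y"
  using inj by (auto simp: inj_on_def)

lemma h_mem_iff: "x \<in> A \<Longrightarrow> I \<subseteq> A \<Longrightarrow> h x \<in> h ` I \<longleftrightarrow> x \<in> I"
  using h_eq_iff by blast

lemma neg_closed: "x \<in> A \<Longrightarrow> - x \<in> A"
  using Ac(4)[OF Ac(1)] by fastforce

lemma rep_cring: "cring R"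
proof (rule cringI)
  show "abelian_group R"
  proof (rule abelian_groupI)
    fix x assume "x \<in> carrier R"
    then obtain a where "a \<in> A" "x = h a" by (auto simp: carrier_eq)
    then show "\<exists>y\<in>carrier R. y \<oplus> x = \<zero>"
      by (intro bexI[of _ "h (- a)"]) (auto simp: carrier_eq add_eq neg_closed zero_eq)
  qed (auto simp: carrier_eq add_eq zero_eq Ac ac_simps)
  show "comm_monoid R"
    by (rule comm_monoidI) (auto simp: carrier_eq mult_eq one_eq Ac ac_simps)
qed (auto simp: carrier_eq add_eq mult_eq Ac distrib_right)

sublocale cring R by (rule rep_cring)

lemma neg_eq: "x \<in> A \<Longrightarrow> \<ominus> h x = h (- x)"
  by (rule minus_equality) (auto simp: add_eq neg_closed zero_eq carrier_eq)

lemma diff_eq: "x \<in> A \<Longrightarrow> y \<in> A \<Longrightarrow> h x \<ominus> h y = h (x - y)"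
  by (simp add: a_minus_def neg_eq add_eq neg_closed)

lemma pow_eq: "x \<in> A \<Longrightarrow> h x [^] (n :: nat) = h (x ^ n)"
  by (induction n) (simp_all add: one_eq mult_eq Ac mult.commute)

lemma sideal_ideal:
  assumes "sideal A I"
  shows "ideal (h ` I) R"
proof (rule idealI)
  note I = sidealD[OF assms]
  show "ring R" by (rule ring_axioms)
  show "subgroup (h ` I) (add_monoid R)"
  proof (rule add.subgroupI)
    show "h ` I \<subseteq> carrier R" using I(1) by (auto simp: carrier_eq)
    show "h ` I \<noteq> {}" using I(2) by blast
    show "\<ominus> a \<in> h ` I" if a: "a \<in> h ` I" for a
    proof -
      obtain x where x: "x \<in> I" "a = h x" using a by blast
      then have "- 1 * x \<in> I" using I(4) neg_closed[OF Ac(2)] by blast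
      then show ?thesis using x I(1) neg_eq[of x] by auto
    qed
    show "a \<oplus> b \<in> h ` I" if "a \<in> h ` I" "b \<in> h ` I" for a b
      using that I by (auto simp: add_eq subset_iff)
  qed
  fix a x assume "a \<in> h ` I" "x \<in> carrier R"
  then obtain i r where "i \<in> I" "a = h i" "r \<in> A" "x = h r" by (auto simp: carrier_eq)
  then show "x \<otimes> a \<in> h ` I" "a \<otimes> x \<in> h ` I"
    using I(1) I(4)[of r i] by (auto simp: mult_eq subset_iff mult.commute)
qed

lemma ideal_sideal:
  assumes "ideal J R"
  shows "sideal A {x \<in> A. h x \<in> J}" "J = h ` {x \<in> A. h x \<in> J}"
proof -
  interpret J: ideal J R by fact
  show "J = h ` {x \<in> A. h x \<in> J}" using J.a_subset by (auto simp: carrier_eq)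
  show "sideal A {x \<in> A. h x \<in> J}"
    unfolding sideal_def using J.zero_closed J.a_closed J.I_l_closed
    by (auto simp: Ac zero_eq carrier_eq simp flip: add_eq mult_eq)
qed

lemma generates_Idl:
  assumes "generates A F I" "sideal A I"
  shows "Idl (h ` F) = h ` I"
proof
  have "F \<subseteq> I" using assms(1) by (simp add: generates_def)
  then show "Idl (h ` F) \<subseteq> h ` I" by (intro genideal_minimal sideal_ideal assms) blast
  have FA: "h ` F \<subseteq> carrier R" using \<open>F \<subseteq> I\<close> sidealD(1)[OF assms(2)] by (auto simp: carrier_eq)
  have id: "ideal (Idl (h ` F)) R" by (rule genideal_ideal[OF FA])
  have "F \<subseteq> {x \<in> A. h x \<in> Idl (h ` F)}"
    using genideal_self[OF FA] \<open>F \<subseteq> I\<close> sidealD(1)[OF assms(2)] by blast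
  then have "I \<subseteq> {x \<in> A. h x \<in> Idl (h ` F)}"
    using assms(1) ideal_sideal(1)[OF id] unfolding generates_def by blast
  then show "h ` I \<subseteq> Idl (h ` F)" by blast
qed

lemma rep_noetherian:
  assumes "noeth A"
  shows "noetherian_ring R"
proof (rule noetherian_ringI)
  fix J assume J: "ideal J R"
  obtain F where F: "finite F" "generates A F {x \<in> A. h x \<in> J}"
    using assms ideal_sideal(1)[OF J] unfolding noeth_def by blast
  have "J = Idl (h ` F)" using generates_Idl[OF F(2) ideal_sideal(1)[OF J]] ideal_sideal(2)[OF J] by simp
  moreover have "h ` F \<subseteq> carrier R" using F(2) by (auto simp: generates_def carrier_eq)
  ultimately show "\<exists>F\<subseteq>carrier R. finite F \<and> J = Idl F" using F(1) by blast
qed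

lemma sprime_primeideal:
  assumes "sprime A p"
  shows "primeideal (h ` p) R"
proof (rule primeidealI)
  have p: "sideal A p" "1 \<notin> p" "\<And>a b. a \<in> A \<Longrightarrow> b \<in> A \<Longrightarrow> a * b \<in> p \<Longrightarrow> a \<in> p \<or> b \<in> p"
    using assms by (auto simp: sprime_def)
  note pA = sidealD(1)[OF p(1)]
  show "ideal (h ` p) R" by (rule sideal_ideal[OF p(1)])
  show "cring R" by (rule rep_cring)
  show "carrier R \<noteq> h ` p" using h_mem_iff[OF Ac(2) pA] p(2) Ac(2) by (auto simp: carrier_eq)
  fix a b assume "a \<in> carrier R" "b \<in> carrier R" "a \<otimes> b \<in> h ` p"
  then obtain x y where "x \<in> A" "a = h x" "y \<in> A" "b = h y" "h (x * y) \<in> h ` p"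
    by (auto simp: carrier_eq mult_eq)
  then show "a \<in> h ` p \<or> b \<in> h ` p" using h_mem_iff[OF Ac(5) pA] p(3) by blast
qed

lemma primeideal_sprime:
  assumes "primeideal P R"
  shows "sprime A {x \<in> A. h x \<in> P}"
proof -
  interpret P: primeideal P R by fact
  have "\<one> \<notin> P" using P.one_imp_carrier P.I_notcarr by auto
  then show ?thesis
    unfolding sprime_def using ideal_sideal(1)[OF P.is_ideal] P.I_prime
    by (auto simp: one_eq carrier_eq simp flip: mult_eq)
qed

lemma rep_krull_dim:
  assumes p: "\<And>i. i \<le> d \<Longrightarrow> sprime A (p i)" "\<And>i. i < d \<Longrightarrow> p i \<subset> p (Suc i)"
    and bound: "\<And>n q. (\<And>i. i \<le> n \<Longrightarrow> sprime A (q i)) \<Longrightarrow> (\<And>i. i < n \<Longrightarrow> q i \<subset> q (Suc i)) \<Longrightarrow> n \<le> d"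
  shows "krull_dim R = enat d"
proof -
  let ?S = "{enat n | n. \<exists>p :: nat \<Rightarrow> 'a set. (\<forall>i\<le>n. primeideal (p i) R) \<and> (\<forall>i<n. p i \<subset> p (Suc i))}"
  have chain: "h ` p i \<subset> h ` p (Suc i)" if "i < d" for i
  proof -
    have "sideal A (p (Suc i))" using p(1)[of "Suc i"] that by (simp add: sprime_def)
    then have "p (Suc i) \<subseteq> A" by (rule sidealD)
    then show ?thesis using p(2)[OF that] h_mem_iff by (smt (verit) image_mono psubsetE psubsetI subset_eq imageI)
  qed
  have "\<exists>p :: nat \<Rightarrow> 'a set. (\<forall>i\<le>d. primeideal (p i) R) \<and> (\<forall>i<d. p i \<subset> p (Suc i))"
    by (rule exI[of _ "\<lambda>i. h ` p i"]) (simp add: sprime_primeideal p(1) chain)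
  then have "enat d \<in> ?S" by blast
  moreover have "x \<le> enat d" if xS: "x \<in> ?S" for x
  proof -
    obtain n q where x: "x = enat n" and q: "\<And>i. i \<le> n \<Longrightarrow> primeideal (q i) R" "\<And>i. i < n \<Longrightarrow> q i \<subset> q (Suc i)"
      using xS by auto
    have "{x \<in> A. h x \<in> q i} \<subset> {x \<in> A. h x \<in> q (Suc i)}" if "i < n" for i
      using ideal_sideal(2)[OF primeideal.axioms(1)[OF q(1)], of i]
        ideal_sideal(2)[OF primeideal.axioms(1)[OF q(1)], of "Suc i"] q(2)[OF that] that by auto
    then have "n \<le> d" using bound[of n "\<lambda>i. {x \<in> A. h x \<in> q i}"] primeideal_sprime[OF q(1)] by blast
    then show ?thesis using x by simp
  qed
  ultimately have "Sup ?S = enat d" by (intro Sup_eqI) auto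
  then show ?thesis unfolding krull_dim_def .
qed

text \<open>All nonunits lie in the proper ideal \<open>M\<close>, so every proper ideal
  does.\<close>

lemma rep_local:
  assumes M: "sideal A M" "1 \<notin> M" and unit: "\<And>x. x \<in> A \<Longrightarrow> x \<notin> M \<Longrightarrow> \<exists>y\<in>A. x * y = 1"
  shows "local_ring R" "max_ideal R = h ` M"
proof -
  have MA: "M \<subseteq> A" using sidealD(1)[OF M(1)] .
  have id: "ideal (h ` M) R" by (rule sideal_ideal[OF M(1)])
  have ne: "carrier R \<noteq> h ` M" using h_mem_iff[OF Ac(2) MA] M(2) Ac(2) by (auto simp: carrier_eq)
  have sub: "J \<subseteq> h ` M" if J: "ideal J R" "J \<noteq> carrier R" for J
  proof
    fix a assume a: "a \<in> J"
    interpret J: ideal J R by fact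
    obtain x where x: "x \<in> A" "a = h x" using a J.a_subset by (auto simp: carrier_eq)
    show "a \<in> h ` M"
    proof (rule ccontr)
      assume "a \<notin> h ` M"
      then obtain y where y: "y \<in> A" "x * y = 1" using unit x by blast
      then have "a \<otimes> h y = \<one>" using x by (simp add: mult_eq one_eq)
      then have "\<one> \<in> J" using J.I_r_closed[OF a, of "h y"] y(1) by (auto simp: carrier_eq)
      then show False using J.one_imp_carrier J(2) by blast
    qed
  qed
  have max: "maximalideal (h ` M) R"
    by (rule maximalidealI[OF id ne]) (use sub in blast)
  have uniq: "J = h ` M" if "maximalideal J R" for J
  proof -
    interpret J: maximalideal J R by fact
    have "J \<subseteq> h ` M" using sub[OF J.is_ideal] J.I_notcarr by blast
    then show ?thesis using J.I_maximal[OF id] id ideal.axioms(1) ne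
      by (metis additive_subgroup.a_subset)
  qed
  show "local_ring R" unfolding local_ring_def using rep_cring max uniq by blast
  show "max_ideal R = h ` M" unfolding max_ideal_def using max uniq by (rule the_equality)
qed

text \<open>Elements outside \<open>M\<close> are units, so a product in \<open>Q\<close> with one
  factor outside \<open>M\<close> has the other factor in \<open>Q\<close>. The radical is
  \<open>M\<close>, with exponent 2 sufficing.\<close>

lemma rep_parameter_ideal:
  assumes M: "sideal A M" "1 \<notin> M" and unit: "\<And>x. x \<in> A \<Longrightarrow> x \<notin> M \<Longrightarrow> \<exists>y\<in>A. x * y = 1"
    and Mprime: "\<And>x n. x \<in> A \<Longrightarrow> x ^ n \<in> M \<Longrightarrow> n > 0 \<Longrightarrow> x \<in> M"
    and Q: "sideal A Q" "generates A (set xs) Q" "Q \<subseteq> M" "\<And>x. x \<in> M \<Longrightarrow> x * x \<in> Q"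
    and len: "enat (length xs) = krull_dim R"
  shows "parameter_ideal R (h ` Q)"
proof -
  note loc = rep_local[OF M unit]
  have MA: "M \<subseteq> A" using sidealD(1)[OF M(1)] .
  have QA: "Q \<subseteq> A" using sidealD(1)[OF Q(1)] .
  have rad: "ideal_radical R (h ` Q) = h ` M"
  proof (intro equalityI subsetI)
    fix a assume "a \<in> ideal_radical R (h ` Q)"
    then obtain x n where x: "x \<in> A" "a = h x" "n > 0" "h (x ^ n) \<in> h ` Q"
      by (auto simp: ideal_radical_def carrier_eq pow_eq)
    then have "x ^ n \<in> M" using h_mem_iff[OF Ac(6) QA] Q(3) by blast
    then show "a \<in> h ` M" using Mprime x by blast
  next
    fix a assume "a \<in> h ` M"
    then obtain x where x: "x \<in> M" "a = h x" by blast
    then have xA: "x \<in> A" using MA by blast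
    have "a [^] (2::nat) = h (x * x)" using x pow_eq[OF xA, of 2] by (simp add: power2_eq_square)
    then have "a [^] (2::nat) \<in> h ` Q" using Q(4)[OF x(1)] by simp
    then show "a \<in> ideal_radical R (h ` Q)" unfolding ideal_radical_def
      using x(2) xA by (auto simp: carrier_eq intro!: exI[of _ "2::nat"])
  qed
  have "primary_ideal R (h ` Q)"
    unfolding primary_ideal_def rad
  proof (intro conjI ballI impI)
    show "ideal (h ` Q) R" by (rule sideal_ideal[OF Q(1)])
    show "h ` Q \<noteq> carrier R" using h_mem_iff[OF Ac(2) QA] M(2) Q(3) Ac(2) by (auto simp: carrier_eq)
    fix a b assume "a \<in> carrier R" "b \<in> carrier R" and ab: "a \<otimes> b \<in> h ` Q"
    then obtain x y where xy: "x \<in> A" "a = h x" "y \<in> A" "b = h y" by (auto simp: carrier_eq)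
    show "a \<in> h ` Q \<or> b \<in> h ` M"
    proof (cases "y \<in> M")
      case False
      then obtain z where z: "z \<in> A" "y * z = 1" using unit xy by blast
      have "x * y \<in> Q" using ab xy h_mem_iff[OF Ac(5) QA] by (simp add: mult_eq)
      then have "z * (x * y) \<in> Q" using sidealD(4)[OF Q(1) z(1)] by blast
      moreover have "z * (x * y) = x" using z(2) by (metis mult.commute mult.left_commute mult_1)
      ultimately show ?thesis using xy by simp
    qed (use xy in simp)
  qed
  moreover have "\<exists>ys. enat (length ys) = krull_dim R \<and> set ys \<subseteq> max_ideal R \<and> h ` Q = Idl (set ys)"
  proof (intro exI[of _ "map h xs"] conjI)
    show "enat (length (map h xs)) = krull_dim R" using len by simp
    show "set (map h xs) \<subseteq> max_ideal R" using Q(2,3) loc(2) by (auto simp: generates_def)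
    show "h ` Q = Idl (set (map h xs))" using generates_Idl[OF Q(2,1)] by simp
  qed
  ultimately show ?thesis unfolding parameter_ideal_def using rad loc(2) by simp
qed

end

section \<open>Copying the ring into the prescribed type\<close>

lemma ring_rep_exists:
  fixes A :: "'r::comm_ring_1 set" and h :: "'r \<Rightarrow> 'a"
  assumes "subring_set A" "inj_on h A"
  shows "\<exists>R. ring_rep R A h"
proof -
  define g where "g = the_inv_into A h"
  have g: "g (h x) = x" if "x \<in> A" for x unfolding g_def by (rule the_inv_into_f_f[OF assms(2) that])
  have "ring_rep \<lparr>carrier = h ` A, monoid.mult = (\<lambda>u v. h (g u * g v)), one = h 1, zero = h 0,
      add = (\<lambda>u v. h (g u + g v))\<rparr> A h"
    by unfold_locales (use assms g in simp_all)
  then show ?thesis by blast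
qed

text \<open>Each of the nine coordinates is a fraction, stored as a chosen numerator and
  denominator. The resulting 18 polynomials become a set of functions, and the tags recover their
  order.\<close>

lemma inj_into_ring_elem: "\<exists>h :: elt \<Rightarrow> ring_elem. inj h"
proof -
  define num where "num b = (SOME f. \<exists>g. b = em f / em g)" for b
  define den where "den b = (SOME g. b = em (num b) / em g)" for b
  have nd: "b = em (num b) / em (den b)" for b
  proof -
    have "\<exists>g. b = em (num b) / em g" unfolding num_def by (rule someI_ex) (use ratfun_eq_quotient in blast)
    then show ?thesis unfolding den_def by (rule someI_ex)
  qed
  \<comment> \<open>The constant function 1 is no exponent vector, so the value there is free to carry the index.\<close>
  define tag :: "nat \<Rightarrow> mpol \<Rightarrow> (nat \<Rightarrow> nat) \<Rightarrow> complex" where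
    "tag i p = (\<lambda>m. Poly_Mapping.lookup p (Abs_poly_mapping m))(\<lambda>_. 1 := of_nat i)" for i p
  have tag: "i = j \<and> p = q" if eq: "tag i p = tag j q" for i j p q
  proof
    show "i = j" using fun_cong[OF eq, of "\<lambda>_. 1"] by (simp add: tag_def)
    show "p = q"
    proof (rule poly_mapping_eqI)
      fix m :: "nat \<Rightarrow>\<^sub>0 nat"
      have "Poly_Mapping.lookup m \<noteq> (\<lambda>_. 1)"
      proof
        assume "Poly_Mapping.lookup m = (\<lambda>_. 1)"
        then have "finite (UNIV :: nat set)" using Poly_Mapping.finite_lookup[of m] by simp
        then show False by simp
      qed
      then show "Poly_Mapping.lookup p m = Poly_Mapping.lookup q m"
        using fun_cong[OF eq, of "Poly_Mapping.lookup m"] by (simp add: tag_def)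
    qed
  qed
  define cs where "cs r = [bb r, e0 r, e1 r, y1 r, y2 r, z1 r, z2 r, f1 r, f2 r]" for r
  define ps where "ps r = map num (cs r) @ map den (cs r)" for r
  define h where "h r = {tag i (ps r ! i) | i. i < 18}" for r
  have len: "length (ps r) = 18" for r by (simp add: ps_def cs_def)
  have "r = s" if "h r = h s" for r s
  proof -
    have "ps r = ps s"
    proof (rule nth_equalityI)
      fix i assume "i < length (ps r)"
      then have "tag i (ps r ! i) \<in> h s" unfolding that[symmetric] by (auto simp: h_def len)
      then show "ps r ! i = ps s ! i" using tag by (auto simp: h_def)
    qed (simp add: len)
    then have "map num (cs r) = map num (cs s)" "map den (cs r) = map den (cs s)" by (simp_all add: ps_def cs_def)
    then have "cs r = cs s" unfolding cs_def using nd by simp metis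
    then show ?thesis by (simp add: cs_def elt_eq_iff)
  qed
  then show ?thesis by (auto simp: inj_def)
qed

theorem theorem1p3:
  fixes d :: nat
  assumes "d > 0"
  shows "\<exists>(R :: ring_elem ring) Q.
    noetherian_ring R \<and> local_ring R \<and> krull_dim R = enat d \<and> parameter_ideal R Q \<and>
    carrier (Ext R d (quotient_module (self_module R) Q) (self_module R)) =
      {\<zero>\<^bsub>Ext R d (quotient_module (self_module R) Q) (self_module R)\<^esub>}"
proof -
  obtain h :: "elt \<Rightarrow> ring_elem" where h: "inj h" using inj_into_ring_elem by blast
  then have "inj_on h (R0 d)" by (rule inj_on_subset) simp
  then obtain R where "ring_rep R (R0 d) h" using ring_rep_exists[OF R0_subring[OF assms]] by blast
  then interpret ring_rep R "R0 d" h .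
  define n where "n = d - 1"
  have d: "d = Suc n" using assms by (simp add: n_def)
  have noeth: "noetherian_ring R" by (rule rep_noetherian[OF R0_noeth[OF assms]])
  note max0 = max0_sideal[OF assms] and unit = R0_unit[OF assms]
  have loc: "local_ring R" by (rule rep_local[OF max0 unit])
  have dim: "krull_dim R = enat d"
    by (rule rep_krull_dim[of d "prime_chain d", OF prime_chain_sprime[OF assms] prime_chain_strict[OF assms]
        R0_prime_chain_bound[OF assms]])
  \<comment> \<open>The sets {1, ..., j} and {j + 1, ..., n}: the first ideal contains t and x_1,
    ..., x_j, the second the remaining variables. Index 0 belongs to t, so the j-th regular element
    is \<open>Xel (Suc j)\<close>.\<close>
  let ?S = "\<lambda>j. {1..<Suc j}" and ?S' = "\<lambda>j. {Suc j..<Suc n}"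
  have param: "parameter_ideal R (h ` II d {1..<d})"
  proof (rule rep_parameter_ideal[OF max0 unit])
    have "set (Tel # map Xel [1..<d]) = insert Tel (Xel ` {1..<d})" by simp
    then show "generates (R0 d) (set (Tel # map Xel [1..<d])) (II d {1..<d})"
      using II_generated[OF assms, of "{1..<d}"] by simp
    show "enat (length (Tel # map Xel [1..<d])) = krull_dim R" using dim assms by simp
    show "sideal (R0 d) (II d {1..<d})" by (rule II_sideal[OF assms])
    show "II d {1..<d} \<subseteq> max0 d" by (rule II_max0[OF assms])
    show "r * r \<in> II d {1..<d}" if "r \<in> max0 d" for r by (rule II_max0(2)[OF assms that])
    \<comment> \<open>An element outside \<open>max0 d\<close> is a unit, and so are its
      powers.\<close>
    show "x \<in> max0 d" if x: "x \<in> R0 d" "x ^ k \<in> max0 d" "k > 0" for x k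
    proof (rule ccontr)
      assume "x \<notin> max0 d"
      then obtain y where y: "y \<in> R0 d" "x * y = 1" using unit x(1) by blast
      have "y ^ k * x ^ k \<in> max0 d" using sidealD(4)[OF max0(1) Ac(6)[OF y(1)] x(2)] .
      then show False using max0(2) y(2) by (simp add: power_mult_distrib[symmetric] mult.commute)
    qed
  qed
  have nontriv: "\<one>\<^bsub>R\<^esub> \<noteq> \<zero>\<^bsub>R\<^esub>" using h_eq_iff[OF Ac(2,1)] by (simp add: one_eq zero_eq elt_eq_iff)
  have tT: "h Tel \<in> carrier R" using Tel_R0[OF assms] by (simp add: carrier_eq)
  have img: "h ` {a + x * r | a r. a \<in> I \<and> r \<in> R0 d} =
      {a \<oplus>\<^bsub>R\<^esub> h x \<otimes>\<^bsub>R\<^esub> r | a r. a \<in> h ` I \<and> r \<in> carrier R}" if "I \<subseteq> R0 d" "x \<in> R0 d" for I x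
  proof -
    have "h (a + x * r) = h a \<oplus>\<^bsub>R\<^esub> h x \<otimes>\<^bsub>R\<^esub> h r" if "a \<in> I" "r \<in> R0 d" for a r
      using that \<open>I \<subseteq> R0 d\<close> \<open>x \<in> R0 d\<close> by (auto simp: add_eq mult_eq Ac subset_iff)
    then show ?thesis unfolding carrier_eq by (force simp: image_iff)
  qed
  have sub: "II d S \<subseteq> R0 d" "JJ d S \<subseteq> R0 d" for S by (auto simp: II_def JJ_def)
  have "carrier (Ext R (Suc n) (quot R (h ` II d (?S n))) (self_module R)) =
    {\<zero>\<^bsub>Ext R (Suc n) (quot R (h ` II d (?S n))) (self_module R)\<^esub>}"
  proof (rule Ext_quot_eq_zero[OF rep_cring nontriv tT, where x = "\<lambda>j. h (Xel (Suc j))" and I = "\<lambda>j. h ` II d (?S j)"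
      and J = "\<lambda>j. h ` JJ d (?S' j)"])
    fix j assume j: "j < n"
    then have s: "Suc j \<in> {1..<d}" "Suc j \<notin> ?S j" "Suc j \<notin> ?S' (Suc j)" using d by auto
    note X = Xel_R0[OF s(1)]
    show "h (Xel (Suc j)) \<in> carrier R" using X by (simp add: carrier_eq)
    have "?S (Suc j) = insert (Suc j) (?S j)" by auto
    then show "h ` II d (?S (Suc j)) = {a \<oplus>\<^bsub>R\<^esub> h (Xel (Suc j)) \<otimes>\<^bsub>R\<^esub> r | a r. a \<in> h ` II d (?S j) \<and> r \<in> carrier R}"
      using II_insert[OF assms s(1), of "?S j"] img[OF sub(1) X] by simp
    have "?S' j = insert (Suc j) (?S' (Suc j))" using j by auto
    then show "h ` JJ d (?S' j) = {a \<oplus>\<^bsub>R\<^esub> h (Xel (Suc j)) \<otimes>\<^bsub>R\<^esub> r | a r. a \<in> h ` JJ d (?S' (Suc j)) \<and> r \<in> carrier R}"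
      using JJ_insert[OF assms s(1), of "?S' (Suc j)"] img[OF sub(2) X] by simp
    fix r assume "r \<in> carrier R"
    then obtain q where q: "q \<in> R0 d" "r = h q" by (auto simp: carrier_eq)
    note Xq = Ac(5)[OF X q(1)]
    show "h (Xel (Suc j)) \<otimes>\<^bsub>R\<^esub> r \<in> h ` II d (?S j) \<Longrightarrow> r \<in> h ` II d (?S j)"
      using regular_mod(1)[OF assms s(1,2) q(1)] h_mem_iff[OF Xq sub(1)] q by (simp add: mult_eq X)
    show "h (Xel (Suc j)) \<otimes>\<^bsub>R\<^esub> r \<in> h ` JJ d (?S' (Suc j)) \<Longrightarrow> r \<in> h ` JJ d (?S' (Suc j))"
      using regular_mod(2)[OF assms s(1,3) q(1)] h_mem_iff[OF Xq sub(2)] q by (simp add: mult_eq X)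
  next
    show "ideal (h ` II d (?S j)) R" "ideal (h ` JJ d (?S' j)) R" for j
      by (rule sideal_ideal[OF II_sideal[OF assms]], rule sideal_ideal[OF JJ_sideal[OF assms]])
    show "h ` II d (?S 0) = {u \<otimes>\<^bsub>R\<^esub> h Tel | u. u \<in> carrier R}"
      using II_empty[OF assms] Tel_R0[OF assms] by (force simp: carrier_eq mult_eq image_iff)
    show "h ` JJ d (?S' n) = {\<zero>\<^bsub>R\<^esub>}" using JJ_empty[OF assms] by (simp add: zero_eq)
    fix c assume "c \<in> carrier R"
      and ann: "\<And>s. s \<in> carrier R \<Longrightarrow> s \<otimes>\<^bsub>R\<^esub> h Tel = \<zero>\<^bsub>R\<^esub> \<Longrightarrow> s \<otimes>\<^bsub>R\<^esub> c \<in> h ` JJ d (?S' 0)"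
    then obtain q where q: "q \<in> R0 d" "c = h q" by (auto simp: carrier_eq)
    have S0: "?S' 0 \<subseteq> {1..<d}" using d by auto
    have "\<exists>u\<in>R0 d. q - Tel * u \<in> JJ d (?S' 0)"
    proof (rule annihilator_base[OF assms S0 q(1)])
      fix s assume s: "s \<in> R0 d" "s * Tel = 0"
      then have "h s \<otimes>\<^bsub>R\<^esub> h Tel = \<zero>\<^bsub>R\<^esub>" by (simp add: mult_eq Tel_R0[OF assms] zero_eq)
      then have "h s \<otimes>\<^bsub>R\<^esub> c \<in> h ` JJ d (?S' 0)" using ann[of "h s"] s(1) by (auto simp: carrier_eq)
      then show "s * q \<in> JJ d (?S' 0)" using h_mem_iff[OF Ac(5)[OF s(1) q(1)] sub(2)] s(1) q by (simp add: mult_eq)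
    qed
    then obtain u where u: "u \<in> R0 d" "q - Tel * u \<in> JJ d (?S' 0)" by blast
    have "c \<ominus>\<^bsub>R\<^esub> h Tel \<otimes>\<^bsub>R\<^esub> h u = h (q - Tel * u)"
      using q u(1) Tel_R0[OF assms] by (simp add: mult_eq diff_eq Ac)
    then show "\<exists>u\<in>carrier R. c \<ominus>\<^bsub>R\<^esub> h Tel \<otimes>\<^bsub>R\<^esub> u \<in> h ` JJ d (?S' 0)"
      using u by (intro bexI[of _ "h u"]) (auto simp: carrier_eq)
  qed
  then have "carrier (Ext R d (quotient_module (self_module R) (h ` II d {1..<d})) (self_module R)) =
      {\<zero>\<^bsub>Ext R d (quotient_module (self_module R) (h ` II d {1..<d})) (self_module R)\<^esub>}"
    by (simp add: d)
  with noeth loc dim param show ?thesis by blast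
qed

end
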